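(* Let $m_{n,\mathcal L}$ be the oblique decision tree (ODT) regression estimator with $t_n$ leaves ($1\le t_n\le n$) built from the i.i.d. sample $\mathcal D_n$, as defined in the context. Assume that $\mathbf E(e^{c Y^2})<\infty$ for some $c>0$ and that $m(X)$ is $L^2$ integrable. If $t_n\to\infty$ and $t_n=o\left(\frac{n}{\ln^4 n}\right)$, then $$\mathbf E\left(\int |m_{n,\mathcal L}(x)-m(x)|^2\,d\mu(x)\right)\to 0\quad\text{as } n\to\infty .$$
   Context: **Setting.** $p\ge1$ is a fixed integer, $X$ is a random vector in $[0,1]^p$ with distribution $\mu$, $Y$ is a real random variable, $m(x)=\mathbf E(Y\mid X=x)$ for $x\in[0,1]^p$, and $\mathcal D_n=\{(X_i,Y_i)\}_{i=1}^n$ are i.i.d. copies of $(X,Y)$. "$m(X)$ is $L^2$ integrable" means $\mathbf E(m(X)^2)<\infty$. $\Theta^p=\{\theta\in\mathbb R^p:\|\theta\|_2=1\}$. **Impurity gain.** For $A\subseteq[0,1]^p$ let $N(A)$ be the number of indices $i$ with $X_i\in A$, and $\bar Y_A=\frac1{N(A)}\sum_{X_i\in A}Y_i$ (with $\bar Y_A=0$ if $N(A)=0$). For $\theta\in\Theta^p,s\in\mathbb R$ put $A^+_{\theta,s}=\{x\in A:\theta^Tx\le s\}$, $A^-_{\theta,s}=\{x\in A:\theta^Tx>s\}$ (either may be empty), and, for $N(A)\ge 1$, $$\Delta_A(\theta,s)=\frac1{N(A)}\Big[\sum_{X_i\in A}(Y_i-\bar Y_A)^2-\sum_{X_i\in A^+_{\theta,s}}(Y_i-\bar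 Y_{A^+_{\theta,s}})^2-\sum_{X_i\in A^-_{\theta,s}}(Y_i-\bar Y_{A^-_{\theta,s}})^2\Big].$$ **ODT with $t_n$ leaves.** Start with layer $0$ consisting of the single node $[0,1]^p$. Nodes of the current layer are processed one after another: a node containing at most one data point is passed unchanged to the next layer; a node $A$ with at least two data points is split into $A^+_{\hat\theta_A,\hat s_A}$ and $A^-_{\hat\theta_A,\hat s_A}$, where $(\hat\theta_A,\hat s_A)$ is a maximizer of $\Delta_A(\theta,s)$ over $\theta\in\Theta^p,s\in\mathbb R$, and both daughters are put in the next layer. When a layer is exhausted one moves to the next. The procedure stops as soon as the current partition of $[0,1]^p$ has $t_n$ cells; these are the leaves $\mathbb A^1_{\mathcal L},\dots,\mathbb A^{t_n}_{\mathcal L}$ ($\mathcal L$ is the index of the last layer). The estimator is $$m_{n,\mathcal L}(x)=\sum_{j=1}^{t_n}\mathbb I(x\in\mathbb A^j_{\mathcal L})\,\bar Y_{\mathbb A^j_{\mathcal L}},\qquad x\in[0,1]^p.$$ The expectation is over $\mathcal D_n$. *)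

theory Defs
  imports "HOL-Probability.Probability" "HOL-Library.Multiset" "HOL-Library.Landau_Symbols"
begin

text \<open>
  A sample of size \<open>n\<close> is a function \<open>d\<close> of which only the values \<open>d i = (X\<^sub>i, Y\<^sub>i)\<close> with
  \<open>i < n\<close> matter.
\<close>

type_synonym 'p sample = "nat \<Rightarrow> (real ^ 'p) \<times> real"

abbreviation unit_cube :: "(real ^ 'p::finite) set" where
  "unit_cube \<equiv> cbox 0 1"

definition points_in :: "nat \<Rightarrow> 'p::finite sample \<Rightarrow> (real ^ 'p) set \<Rightarrow> nat set" where
  "points_in n d A = {i. i < n \<and> fst (d i) \<in> A}"

definition node_count :: "nat \<Rightarrow> 'p::finite sample \<Rightarrow> (real ^ 'p) set \<Rightarrow> nat" where
  "node_count n d A = card (points_in n d A)"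

text \<open>A node without data gets the mean \<open>0\<close>, since \<open>x / 0 = 0\<close>.\<close>

definition node_mean :: "nat \<Rightarrow> 'p::finite sample \<Rightarrow> (real ^ 'p) set \<Rightarrow> real" where
  "node_mean n d A = (\<Sum>i\<in>points_in n d A. snd (d i)) / real (node_count n d A)"

definition node_sse :: "nat \<Rightarrow> 'p::finite sample \<Rightarrow> (real ^ 'p) set \<Rightarrow> real" where
  "node_sse n d A = (\<Sum>i\<in>points_in n d A. (snd (d i) - node_mean n d A)\<^sup>2)"

definition daughter_le :: "(real ^ 'p::finite) set \<Rightarrow> real ^ 'p \<Rightarrow> real \<Rightarrow> (real ^ 'p) set" where
  "daughter_le A \<theta> s = {x \<in> A. \<theta> \<bullet> x \<le> s}"

definition daughter_gt :: "(real ^ 'p::finite) set \<Rightarrow> real ^ 'p \<Rightarrow> real \<Rightarrow> (real ^ 'p) set" where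
  "daughter_gt A \<theta> s = {x \<in> A. \<theta> \<bullet> x > s}"

definition impurity_gain ::
    "nat \<Rightarrow> 'p::finite sample \<Rightarrow> (real ^ 'p) set \<Rightarrow> real ^ 'p \<Rightarrow> real \<Rightarrow> real" where
  "impurity_gain n d A \<theta> s =
     (node_sse n d A - node_sse n d (daughter_le A \<theta> s) - node_sse n d (daughter_gt A \<theta> s))
       / real (node_count n d A)"

definition best_split ::
    "nat \<Rightarrow> 'p::finite sample \<Rightarrow> (real ^ 'p) set \<Rightarrow> real ^ 'p \<Rightarrow> real \<Rightarrow> bool" where
  "best_split n d A \<theta> s \<longleftrightarrow>
     is_arg_max (\<lambda>(\<theta>, s). impurity_gain n d A \<theta> s) (\<lambda>(\<theta>, s). norm \<theta> = 1) (\<theta>, s)"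

text \<open>
  \<open>odt_state n d t C D\<close>: growing a tree with target number \<open>t\<close> of leaves can reach the
  situation where \<open>C\<close> collects the nodes of the current layer that still await processing and
  \<open>D\<close> the nodes already put into the next layer; the current partition is \<open>C + D\<close>.
  Multisets are needed because degenerate splits can produce several empty cells, each of which
  counts as a cell. Neither the order of processing inside a layer nor the choice among several
  maximizers is prescribed. A step is possible only while there are fewer than \<open>t\<close> cells.
\<close>

inductive odt_state ::
    "nat \<Rightarrow> 'p::finite sample \<Rightarrow> nat \<Rightarrow>
       (real ^ 'p) set multiset \<Rightarrow> (real ^ 'p) set multiset \<Rightarrow> bool"
  for n d t where
  root: "odt_state n d t {#unit_cube#} {#}"
| pass: "odt_state n d t (add_mset A C) D \<Longrightarrow> size (add_mset A C + D) < t \<Longrightarrow>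
           node_count n d A \<le> 1 \<Longrightarrow> odt_state n d t C (add_mset A D)"
| split: "odt_state n d t (add_mset A C) D \<Longrightarrow> size (add_mset A C + D) < t \<Longrightarrow>
           node_count n d A \<ge> 2 \<Longrightarrow> best_split n d A \<theta> s \<Longrightarrow>
           odt_state n d t C (D + {#daughter_le A \<theta> s, daughter_gt A \<theta> s#})"
| next_layer: "odt_state n d t {#} D \<Longrightarrow> size D < t \<Longrightarrow> odt_state n d t D {#}"

definition odt_leaves ::
    "nat \<Rightarrow> 'p::finite sample \<Rightarrow> nat \<Rightarrow> (real ^ 'p) set multiset \<Rightarrow> bool" where
  "odt_leaves n d t L \<longleftrightarrow> (\<exists>C D. odt_state n d t C D \<and> L = C + D \<and> size L = t)"

definition leaf_estimate ::
    "nat \<Rightarrow> 'p::finite sample \<Rightarrow> (real ^ 'p) set multiset \<Rightarrow> real ^ 'p \<Rightarrow> real" where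
  "leaf_estimate n d L x = (\<Sum>A\<in>#L. indicator A x * node_mean n d A)"

text \<open>
  An ODT estimator is a regression estimator, i.e. a jointly measurable function of the sample
  and of the point of evaluation, whose value at every sample is the estimate of some tree grown
  from that sample. This covers every measurable tie-breaking rule; measurability is what gives
  the expectation of its error a meaning.
\<close>

definition odt_estimator ::
    "nat \<Rightarrow> nat \<Rightarrow> ('p::finite sample \<Rightarrow> real ^ 'p \<Rightarrow> real) \<Rightarrow> bool" where
  "odt_estimator n t mhat \<longleftrightarrow>
     (\<lambda>(d, x). mhat d x) \<in> borel_measurable ((\<Pi>\<^sub>M i\<in>{..<n}. borel) \<Otimes>\<^sub>M borel) \<and>
     (\<forall>d \<in> {..<n} \<rightarrow>\<^sub>E unit_cube \<times> UNIV.
        \<exists>L. odt_leaves n d t L \<and> (\<forall>x\<in>unit_cube. mhat d x = leaf_estimate n d L x))"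

end

theory Submission
  imports Defs "HOL-Real_Asymp.Real_Asymp"
begin

text \<open>
  The risk is compared with the training error.  If \<open>g\<close> is a combination of indicators of
  halfspaces with total coefficient mass \<open>v\<close>, then the responses centred in a node are correlated
  with \<open>g\<close> at most \<open>v\<close> times as much as with the best halfspace.  Hence the best split of a node
  with positive excess of squared error over \<open>g\<close> lowers this excess by a multiple of its square, and
  after \<open>k\<close> complete layers the training error exceeds that of \<open>g\<close> by at most \<open>O(v\<^sup>2 / k)\<close>; a layer at
  most doubles the number of nodes, so \<open>k\<close> grows with the number of leaves.

  Generalisation error is bounded by adding an independent copy of the sample and exchanging each
  observation with its copy at random.  Given the \<open>2n\<close> points, the leaf values enter the signed sum
  of squared errors linearly and through their squares, so it is dominated by its values at
  \<open>\<plusminus>1\<close> labellings of the cells, scaled by the largest response.  By Radon's theorem and Pajor's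
  lemma there are at most \<open>(2 t (2n + 1)\<^sup>p\<^sup>+\<^sup>1)\<^sup>t\<close> of these, and Massart's finite class
  argument gives a gap of order \<open>ln n\<close> times \<open>sqrt (t ln n / n)\<close>, where the factor \<open>ln n\<close> bounds the expected largest squared response.

  Finally, halfspace combinations are dense in \<open>L\<^sup>2\<close> of the law of \<open>X\<close>.
\<close>

section \<open>Training error\<close>

text \<open>Two obstacles shape the proof. The tree depends on the responses, so exchanging
  observations changes the tree itself. The bounds therefore quantify over all partitions obtained
  by successive hyperplane cuts: their traces on the \<open>2 * n\<close> points are counted without
  looking at the responses, and an exchange only permutes these points. Moreover, the responses are
  unbounded. Instead of truncating them, each doubled sample gets its own bound \<open>B\<close>,
  the square root of \<open>envelope\<close>, which is integrated at the very end. The regression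
  function is in general no combination of halfspaces. A combination \<open>g\<close> close to it is
  fixed first, then a number \<open>K\<close> of layers that is large against the mass
  \<open>v\<close> of \<open>g\<close>, and only then \<open>n\<close> grows. The noise, the mean of
  (m(X) - Y)^2, occurs in the risk of the tree and in that of \<open>g\<close>, and cancels because
  it is finite. In the square of the generalisation gap the largest response accounts for two
  logarithms and the number of labellings for a third; they meet the four in the growth
  condition.\<close>

lemma finite_points_in [simp]: "finite (points_in n d A)"
  by (simp add: points_in_def)

section \<open>Squared error within a node and its drop under one cut\<close>

lemma node_sum_centered: "(\<Sum>i\<in>points_in n d A. snd (d i) - node_mean n d A) = 0"
proof (cases "points_in n d A = {}")
  case False
  then have "node_count n d A \<noteq> 0" by (simp add: node_count_def)
  then show ?thesis by (simp add: sum_subtractf node_mean_def node_count_def)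
qed simp

text \<open>The cross term dies because deviations from the node mean sum to zero. Applied to a
  daughter, with \<open>c\<close> the mean of the parent, it shows what the daughter contributes to
  the drop.\<close>

lemma node_sse_shift:
  "(\<Sum>i\<in>points_in n d A. (snd (d i) - c)\<^sup>2)
     = node_sse n d A + real (node_count n d A) * (node_mean n d A - c)\<^sup>2"
proof -
  let ?m = "node_mean n d A"
  have "(\<Sum>i\<in>points_in n d A. (snd (d i) - c)\<^sup>2)
      = (\<Sum>i\<in>points_in n d A. (snd (d i) - ?m)\<^sup>2 + 2 * (?m - c) * (snd (d i) - ?m) + (?m - c)\<^sup>2)"
    by (intro sum.cong refl) (simp add: power2_eq_square algebra_simps)
  also have "\<dots> = node_sse n d A + 2 * (?m - c) * (\<Sum>i\<in>points_in n d A. snd (d i) - ?m)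
      + real (node_count n d A) * (?m - c)\<^sup>2"
    by (simp add: sum.distrib node_sse_def node_count_def sum_distrib_left)
  finally show ?thesis by (simp add: node_sum_centered)
qed

lemma points_in_split:
  "points_in n d A = points_in n d (daughter_le A \<theta> s) \<union> points_in n d (daughter_gt A \<theta> s)"
  "points_in n d (daughter_le A \<theta> s) \<inter> points_in n d (daughter_gt A \<theta> s) = {}"
  by (auto simp: points_in_def daughter_le_def daughter_gt_def)

lemma sum_points_in_split:
  "(\<Sum>i\<in>points_in n d A. f i)
     = (\<Sum>i\<in>points_in n d (daughter_le A \<theta> s). f i) + (\<Sum>i\<in>points_in n d (daughter_gt A \<theta> s). f i)"
  by (subst points_in_split(1)[of n d A \<theta> s], rule sum.union_disjoint) (auto simp: points_in_split)

lemma node_count_split: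
  "node_count n d A = node_count n d (daughter_le A \<theta> s) + node_count n d (daughter_gt A \<theta> s)"
  unfolding node_count_def
  by (subst points_in_split(1)[of n d A \<theta> s], rule card_Un_disjoint) (auto simp: points_in_split)

text \<open>The impurity gain multiplied by the node count: drops add up over the nodes of a layer,
  and for a nonempty node the maximizers are the same.\<close>

definition sse_drop :: "nat \<Rightarrow> 'p::finite sample \<Rightarrow> (real ^ 'p) set \<Rightarrow> real ^ 'p \<Rightarrow> real \<Rightarrow> real" where
  "sse_drop n d A \<theta> s
     = node_sse n d A - node_sse n d (daughter_le A \<theta> s) - node_sse n d (daughter_gt A \<theta> s)"

text \<open>By the shift identity the drop is \<open>N_L e_L^2 + N_R e_R^2\<close>, where
  \<open>e\<close> is the difference between the mean of a daughter and that of the parent. The sum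
  to be bounded is \<open>N_L e_L\<close>, so the left daughter alone suffices, together with
  \<open>N_L\<close> being at most the count of the parent.\<close>

lemma sse_drop_ge:
  "(\<Sum>i\<in>points_in n d (daughter_le A \<theta> s). snd (d i) - node_mean n d A)\<^sup>2
     \<le> real (node_count n d A) * sse_drop n d A \<theta> s"
proof -
  let ?L = "daughter_le A \<theta> s" and ?R = "daughter_gt A \<theta> s"
  let ?m = "node_mean n d A" and ?N = "real (node_count n d ?L)"
  let ?e = "node_mean n d ?L - ?m"
  have "(\<Sum>i\<in>points_in n d ?L. snd (d i) - ?m)
     = (\<Sum>i\<in>points_in n d ?L. (snd (d i) - node_mean n d ?L) + ?e)"
    by simp
  also have "\<dots> = ?N * ?e"
    unfolding sum.distrib node_sum_centered by (simp add: node_count_def)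
  finally have D: "(\<Sum>i\<in>points_in n d ?L. snd (d i) - ?m) = ?N * ?e" .
  have "node_sse n d A = (\<Sum>i\<in>points_in n d ?L. (snd (d i) - ?m)\<^sup>2) + (\<Sum>i\<in>points_in n d ?R. (snd (d i) - ?m)\<^sup>2)"
    unfolding node_sse_def by (rule sum_points_in_split)
  then have drop: "?N * ?e\<^sup>2 \<le> sse_drop n d A \<theta> s"
    unfolding node_sse_shift sse_drop_def by simp
  have "(?N * ?e)\<^sup>2 = ?N * (?N * ?e\<^sup>2)" by (simp add: power2_eq_square)
  also have "\<dots> \<le> real (node_count n d A) * (?N * ?e\<^sup>2)"
    by (intro mult_right_mono) (simp_all add: node_count_split[of n d A \<theta> s])
  also have "\<dots> \<le> real (node_count n d A) * sse_drop n d A \<theta> s"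
    by (intro mult_left_mono drop) simp
  finally show ?thesis using D by simp
qed

section \<open>Best splits against combinations of halfspaces\<close>

lemma best_splitD:
  assumes "best_split n d A \<theta> s" "node_count n d A > 0"
  shows "norm \<theta> = 1" "norm \<theta>' = 1 \<Longrightarrow> sse_drop n d A \<theta>' s' \<le> sse_drop n d A \<theta> s"
proof -
  from assms(1) show 1: "norm \<theta> = 1"
    by (simp add: best_split_def is_arg_max_def)
  assume "norm \<theta>' = 1"
  with assms(1) have "impurity_gain n d A \<theta>' s' \<le> impurity_gain n d A \<theta> s"
    by (force simp: best_split_def is_arg_max_def not_less)
  then show "sse_drop n d A \<theta>' s' \<le> sse_drop n d A \<theta> s"
    using assms(2) by (simp add: impurity_gain_def sse_drop_def divide_le_cancel)
qed

text \<open>The index \<open>v\<close> belongs to a representation rather than to the function. Unit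
  directions make every term a cut with which the best split competes.\<close>

inductive ridge_step :: "real \<Rightarrow> (real ^ 'p::finite \<Rightarrow> real) \<Rightarrow> bool" where
  const: "ridge_step 0 (\<lambda>_. c)"
| step: "ridge_step v g \<Longrightarrow> norm \<theta> = 1 \<Longrightarrow>
           ridge_step (v + \<bar>a\<bar>) (\<lambda>x. g x + (if \<theta> \<bullet> x \<le> s then a else 0))"

text \<open>The pairing with \<open>g\<close> is linear in \<open>g\<close>. Centred responses
  annihilate constants, which is why constants carry no mass, and each halfspace term contributes at
  most \<open>\<delta>\<close> times the absolute value of its coefficient.\<close>

lemma ridge_step_correlation:
  assumes "ridge_step v g" and "\<delta> \<ge> 0"
    and \<delta>: "\<And>\<theta> s. norm \<theta> = 1 \<Longrightarrow>
      \<bar>\<Sum>i\<in>points_in n d (daughter_le A \<theta> s). snd (d i) - node_mean n d A\<bar> \<le> \<delta>"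
  shows "\<bar>\<Sum>i\<in>points_in n d A. (snd (d i) - node_mean n d A) * g (fst (d i))\<bar> \<le> v * \<delta>"
  using assms(1)
proof induction
  case (const c)
  have "(\<Sum>i\<in>points_in n d A. (snd (d i) - node_mean n d A) * c)
      = (\<Sum>i\<in>points_in n d A. snd (d i) - node_mean n d A) * c"
    by (simp only: sum_distrib_right)
  then show ?case by (simp add: node_sum_centered)
next
  case (step v g \<theta> a s)
  let ?r = "\<lambda>i. snd (d i) - node_mean n d A"
  have "(\<Sum>i\<in>points_in n d A. ?r i * (if \<theta> \<bullet> fst (d i) \<le> s then a else 0))
      = (\<Sum>i\<in>points_in n d (daughter_le A \<theta> s). ?r i * a)"
    by (intro sum.mono_neutral_cong_right) (auto simp: points_in_def daughter_le_def)
  also have "\<dots> = (\<Sum>i\<in>points_in n d (daughter_le A \<theta> s). ?r i) * a"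
    by (simp only: sum_distrib_right)
  finally have "\<bar>\<Sum>i\<in>points_in n d A. ?r i * (if \<theta> \<bullet> fst (d i) \<le> s then a else 0)\<bar> \<le> \<delta> * \<bar>a\<bar>"
    using mult_right_mono[OF \<delta>[OF step.hyps(2), of s], of "\<bar>a\<bar>"] by (simp add: abs_mult)
  moreover have "(\<Sum>i\<in>points_in n d A. ?r i * (g (fst (d i)) + (if \<theta> \<bullet> fst (d i) \<le> s then a else 0)))
      = (\<Sum>i\<in>points_in n d A. ?r i * g (fst (d i)))
        + (\<Sum>i\<in>points_in n d A. ?r i * (if \<theta> \<bullet> fst (d i) \<le> s then a else 0))"
    by (simp only: distrib_left sum.distrib)
  ultimately show ?case
    using step.IH by (simp only: distrib_right mult.commute[of "\<bar>a\<bar>"])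
qed

text \<open>The comparison is with \<open>g\<close> on the points of the same node, so it splits
  additively and every drop of squared error is a drop of the excess. It may be negative.\<close>

definition excess :: "nat \<Rightarrow> 'p::finite sample \<Rightarrow> (real ^ 'p \<Rightarrow> real) \<Rightarrow> (real ^ 'p) set \<Rightarrow> real" where
  "excess n d g A = node_sse n d A - (\<Sum>i\<in>points_in n d A. (snd (d i) - g (fst (d i)))\<^sup>2)"

lemma excess_split:
  "excess n d g (daughter_le A \<theta> s) + excess n d g (daughter_gt A \<theta> s)
     = excess n d g A - sse_drop n d A \<theta> s"
  using sum_points_in_split[where f = "\<lambda>i. (snd (d i) - g (fst (d i)))\<^sup>2" and n = n and d = d and A = A and \<theta> = \<theta> and s = s]
  by (simp add: excess_def sse_drop_def)

text \<open>With \<open>a = Y - mean\<close> and \<open>b = g - mean\<close> one has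
  \<open>a^2 - (a - b)^2 = 2 a b - b^2\<close>. The last square is discarded, and centring removes
  the mean from \<open>b\<close>.\<close>

lemma excess_le:
  "excess n d g A \<le> 2 * (\<Sum>i\<in>points_in n d A. (snd (d i) - node_mean n d A) * g (fst (d i)))"
proof -
  let ?m = "node_mean n d A"
  have "excess n d g A = (\<Sum>i\<in>points_in n d A. 2 * ((snd (d i) - ?m) * g (fst (d i)))
      - 2 * ?m * (snd (d i) - ?m) - (g (fst (d i)) - ?m)\<^sup>2)"
    unfolding excess_def node_sse_def sum_subtractf[symmetric]
    by (intro sum.cong refl) (simp add: power2_eq_square algebra_simps)
  also have "\<dots> = 2 * (\<Sum>i\<in>points_in n d A. (snd (d i) - ?m) * g (fst (d i)))
      - 2 * ?m * (\<Sum>i\<in>points_in n d A. snd (d i) - ?m) - (\<Sum>i\<in>points_in n d A. (g (fst (d i)) - ?m)\<^sup>2)"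
    unfolding sum_subtractf[of "\<lambda>i. 2 * ((snd (d i) - ?m) * g (fst (d i))) - 2 * ?m * (snd (d i) - ?m)"]
      sum_subtractf[of "\<lambda>i. 2 * ((snd (d i) - ?m) * g (fst (d i)))"] sum_distrib_left ..
  also have "\<dots> \<le> 2 * (\<Sum>i\<in>points_in n d A. (snd (d i) - ?m) * g (fst (d i)))"
    unfolding node_sum_centered by (simp add: sum_nonneg)
  finally show ?thesis .
qed

text \<open>A bound on the correlation with every single halfspace bounds the correlation with
  \<open>g\<close>, and with it the excess. \<open>W\<close> in place of
  \<open>4 * v\<^sup>2\<close> keeps later quotients by \<open>W\<close> meaningful when
  \<open>v = 0\<close>.\<close>

lemma best_split_drop:
  assumes g: "ridge_step v g" and W: "4 * v\<^sup>2 \<le> W"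
    and b: "best_split n d A \<theta> s" and N: "node_count n d A > 0"
  shows "(max 0 (excess n d g A))\<^sup>2 \<le> W * real (node_count n d A) * sse_drop n d A \<theta> s"
proof -
  \<comment> \<open>No halfspace correlates more than this: \<open>sse_drop_ge\<close> bounds the
    squared correlation by the count times the drop of that halfspace, and the best split has the
    largest drop.\<close>
  define \<delta> where "\<delta> = sqrt (real (node_count n d A) * sse_drop n d A \<theta> s)"
  have nn: "0 \<le> real (node_count n d A) * sse_drop n d A \<theta> s"
    by (rule order_trans[OF zero_le_power2 sse_drop_ge])
  then have "\<delta> \<ge> 0" by (simp add: \<delta>_def)
  have "\<bar>\<Sum>i\<in>points_in n d (daughter_le A \<theta>' s'). snd (d i) - node_mean n d A\<bar> \<le> \<delta>"
    if "norm \<theta>' = 1" for \<theta>' s'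
    unfolding \<delta>_def real_sqrt_abs[symmetric]
    by (intro real_sqrt_le_mono order_trans[OF sse_drop_ge] mult_left_mono best_splitD[OF b N] that) simp
  from ridge_step_correlation[OF g \<open>\<delta> \<ge> 0\<close> this]
  have "excess n d g A \<le> 2 * (v * \<delta>)" and v\<delta>: "0 \<le> v * \<delta>"
    using excess_le[of n d g A] by linarith+
  then have "max 0 (excess n d g A) \<le> 2 * (v * \<delta>)"
    by simp
  then have "(max 0 (excess n d g A))\<^sup>2 \<le> (2 * (v * \<delta>))\<^sup>2"
    by (intro power_mono) auto
  also have "\<dots> = 4 * v\<^sup>2 * \<delta>\<^sup>2" by (simp add: power_mult_distrib)
  also have "\<dots> \<le> W * \<delta>\<^sup>2" by (intro mult_right_mono W) simp
  finally show ?thesis using nn by (simp add: \<delta>_def mult.assoc)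
qed

text \<open>Such a node is fitted exactly, so passing it on unsplit forfeits no guaranteed
  gain.\<close>

lemma excess_le_0:
  assumes "node_count n d A \<le> 1"
  shows "excess n d g A \<le> 0"
proof -
  have "node_sse n d A = 0"
  proof (cases "node_count n d A = 0")
    case True
    then show ?thesis by (simp add: node_count_def node_sse_def)
  next
    case False
    with assms have "card (points_in n d A) = 1" by (simp add: node_count_def le_Suc_eq)
    then obtain i where "points_in n d A = {i}" by (auto simp: card_1_singleton_iff)
    then show ?thesis by (simp add: node_sse_def node_mean_def node_count_def)
  qed
  then show ?thesis by (simp add: excess_def sum_nonneg)
qed

text \<open>What a best split is guaranteed to take off the excess. For an empty node the quotient
  is 0.\<close>

definition gain_bound :: "nat \<Rightarrow> 'p::finite sample \<Rightarrow> (real ^ 'p \<Rightarrow> real) \<Rightarrow> real \<Rightarrow> (real ^ 'p) set \<Rightarrow> real" where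
  "gain_bound n d g W A = (max 0 (excess n d g A))\<^sup>2 / (W * real (node_count n d A))"

text \<open>The tangent line of the square at \<open>\<kappa>\<close> replaces the Cauchy-Schwarz inequality.\<close>

lemma gain_bound_ge:
  assumes "W > 0" "\<kappa> \<ge> 0"
  shows "(2 * \<kappa> * excess n d g A - \<kappa>\<^sup>2 * real (node_count n d A)) / W \<le> gain_bound n d g W A"
proof (cases "node_count n d A = 0")
  case True
  then have "excess n d g A \<le> 0" by (intro excess_le_0) simp
  with assms True show ?thesis
    by (simp add: gain_bound_def divide_nonpos_nonneg mult_nonneg_nonpos)
next
  case False
  let ?N = "real (node_count n d A)" and ?f = "max 0 (excess n d g A)"
  have "0 \<le> (?f - \<kappa> * ?N)\<^sup>2" by simp
  then have "(2 * \<kappa> * ?f - \<kappa>\<^sup>2 * ?N) * ?N \<le> ?f\<^sup>2"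
    by (simp add: power2_eq_square algebra_simps)
  then have "2 * \<kappa> * ?f - \<kappa>\<^sup>2 * ?N \<le> ?f\<^sup>2 / ?N"
    using False by (simp add: pos_le_divide_eq)
  moreover have "2 * \<kappa> * excess n d g A \<le> 2 * \<kappa> * ?f"
    using assms by (intro mult_left_mono) auto
  ultimately have "(2 * \<kappa> * excess n d g A - \<kappa>\<^sup>2 * ?N) / W \<le> ?f\<^sup>2 / ?N / W"
    using assms by (intro divide_right_mono) auto
  then show ?thesis by (simp add: gain_bound_def mult.commute)
qed

section \<open>Decrease of the excess from layer to layer\<close>

lemma gain_bound_nonneg: "W > 0 \<Longrightarrow> 0 \<le> gain_bound n d g W A"
  by (simp add: gain_bound_def)

text \<open>In units of \<open>n * W\<close> the recursion \<open>u' \<le> u - u^2\<close> turns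
  \<open>u \<le> 1 / k\<close> into \<open>u' \<le> 1 / (k + 1)\<close>. Multiplying by
  \<open>k\<close> instead of dividing lets the induction start at \<open>k = 0\<close> with an
  empty claim.\<close>

lemma layer_step_ineq:
  fixes e e' W :: real
  assumes "n > 0" "W > 0" and k: "real k * e \<le> real n * W"
    and e': "0 \<le> e \<Longrightarrow> e' \<le> e - e\<^sup>2 / (real n * W)" "e' \<le> e"
  shows "real (Suc k) * e' \<le> real n * W"
proof (cases "e' \<le> 0")
  case True
  then have "real (Suc k) * e' \<le> 0" by (simp add: mult_nonneg_nonpos)
  also have "0 \<le> real n * W" using assms by simp
  finally show ?thesis .
next
  case False
  define b where "b = real n * W"
  define u where "u = e / b"
  have b: "b > 0" using assms by (simp add: b_def)
  have e: "e = u * b" using b by (simp add: u_def)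
  have "0 < e" using False e'(2) by simp
  then have "u > 0" using b by (simp add: u_def)
  have "e' \<le> e - e\<^sup>2 / b" using e' \<open>0 < e\<close> by (simp add: b_def)
  also have "\<dots> = u * (1 - u) * b"
    using b by (simp add: e power2_eq_square field_simps)
  finally have e'u: "e' \<le> u * (1 - u) * b" .
  have u1: "u < 1"
  proof (rule ccontr)
    assume "\<not> u < 1"
    then have "u * (1 - u) * b \<le> 0" using \<open>u > 0\<close> b by (simp add: mult_nonneg_nonpos mult_nonpos_nonneg)
    with e'u False show False by simp
  qed
  have ku: "real k * u \<le> 1"
    using k b by (simp add: e b_def[symmetric] mult.assoc[symmetric])
  \<comment> \<open>The expression on the right equals
    \<open>1 - (k + 1) * u * (1 - u)\<close>.\<close>
  have "0 \<le> (1 - real k * u) * (1 - u) + u\<^sup>2" using ku u1 by (intro add_nonneg_nonneg) simp_all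
  then have "real (Suc k) * (u * (1 - u)) \<le> 1"
    by (simp add: power2_eq_square algebra_simps)
  have "real (Suc k) * e' \<le> real (Suc k) * (u * (1 - u) * b)"
    using e'u by (intro mult_left_mono) auto
  also have "\<dots> = real (Suc k) * (u * (1 - u)) * b" by simp
  also have "\<dots> \<le> 1 * b"
    using b \<open>real (Suc k) * (u * (1 - u)) \<le> 1\<close> by (intro mult_right_mono) auto
  finally show ?thesis by (simp add: b_def)
qed

text \<open>\<open>P\<close> is the layer that is being processed, \<open>P'\<close> its part that has already been processed.\<close>

lemma odt_state_excess:
  assumes st: "odt_state n d t C D" and g: "ridge_step v g" and W: "4 * v\<^sup>2 \<le> W" "W > 0"
    and n: "n > 0" and cube: "\<forall>i<n. fst (d i) \<in> unit_cube"
  shows "\<exists>P P' k. P = P' + C \<and> size P \<le> 2 ^ k \<and> size D \<le> 2 * size P'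
     \<and> (\<Sum>A\<in>#P. node_count n d A) = n \<and> (\<Sum>A\<in>#D. node_count n d A) = (\<Sum>A\<in>#P'. node_count n d A)
     \<and> real k * (\<Sum>A\<in>#P. excess n d g A) \<le> real n * W
     \<and> (\<Sum>A\<in>#D. excess n d g A) \<le> (\<Sum>A\<in>#P'. excess n d g A - gain_bound n d g W A)"
  using st
proof induction
  case root
  have "points_in n d unit_cube = {..<n}" using cube by (auto simp: points_in_def)
  then have "node_count n d unit_cube = n" by (simp add: node_count_def)
  then show ?case using W n
    by (intro exI[of _ "{#unit_cube#}"] exI[of _ "{#}"] exI[of _ 0]) simp
next
  case (pass A C D)
  then obtain P P' k where IH: "P = P' + add_mset A C" "size P \<le> 2 ^ k" "size D \<le> 2 * size P'"
     "(\<Sum>A\<in>#P. node_count n d A) = n" "(\<Sum>A\<in>#D. node_count n d A) = (\<Sum>A\<in>#P'. node_count n d A)"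
     "real k * (\<Sum>A\<in>#P. excess n d g A) \<le> real n * W"
     "(\<Sum>A\<in>#D. excess n d g A) \<le> (\<Sum>A\<in>#P'. excess n d g A - gain_bound n d g W A)"
    by blast
  have "gain_bound n d g W A = 0"
    using excess_le_0[OF pass.hyps(3), of g] by (simp add: gain_bound_def)
  with IH show ?case
    by (intro exI[of _ P] exI[of _ "add_mset A P'"] exI[of _ k]) simp
next
  case (split A C D \<theta> s)
  then obtain P P' k where IH: "P = P' + add_mset A C" "size P \<le> 2 ^ k" "size D \<le> 2 * size P'"
     "(\<Sum>A\<in>#P. node_count n d A) = n" "(\<Sum>A\<in>#D. node_count n d A) = (\<Sum>A\<in>#P'. node_count n d A)"
     "real k * (\<Sum>A\<in>#P. excess n d g A) \<le> real n * W"
     "(\<Sum>A\<in>#D. excess n d g A) \<le> (\<Sum>A\<in>#P'. excess n d g A - gain_bound n d g W A)"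
    by blast
  have N: "node_count n d A > 0" using split.hyps(3) by simp
  have "gain_bound n d g W A \<le> sse_drop n d A \<theta> s"
    using best_split_drop[OF g W(1) split.hyps(4) N] W N
    by (simp add: gain_bound_def pos_divide_le_eq mult_ac)
  with excess_split[of n d g A \<theta> s] node_count_split[of n d A \<theta> s] IH show ?case
    by (intro exI[of _ P] exI[of _ "add_mset A P'"] exI[of _ k]) simp
next
  case (next_layer D)
  then obtain P k where IH: "size P \<le> 2 ^ k" "size D \<le> 2 * size P"
     "(\<Sum>A\<in>#P. node_count n d A) = n" "(\<Sum>A\<in>#D. node_count n d A) = (\<Sum>A\<in>#P. node_count n d A)"
     "real k * (\<Sum>A\<in>#P. excess n d g A) \<le> real n * W"
     "(\<Sum>A\<in>#D. excess n d g A) \<le> (\<Sum>A\<in>#P. excess n d g A - gain_bound n d g W A)"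
    by auto
  define e where "e = (\<Sum>A\<in>#P. excess n d g A)"
  have subtract: "(\<Sum>A\<in>#P. f A - h A) = (\<Sum>A\<in>#P. f A) - (\<Sum>A\<in>#P. h A)"
    for f h :: "(real ^ 'a) set \<Rightarrow> real"
    by (induction P) auto
  have "real (Suc k) * (\<Sum>A\<in>#D. excess n d g A) \<le> real n * W"
  proof (rule layer_step_ineq[OF n W(2) IH(5)])
    have "0 \<le> (\<Sum>A\<in>#P. gain_bound n d g W A)"
      by (induction P) (auto intro!: add_nonneg_nonneg gain_bound_nonneg W)
    then show "(\<Sum>A\<in>#D. excess n d g A) \<le> (\<Sum>A\<in>#P. excess n d g A)"
      using IH(6) unfolding subtract by linarith
    assume "0 \<le> (\<Sum>A\<in>#P. excess n d g A)"
    \<comment> \<open>The mean excess per observation serves as \<open>\<kappa>\<close> in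
      \<open>gain_bound_ge\<close>: as the counts of the layer sum to \<open>n\<close>, the tangents
      at this slope add up to \<open>e^2 / (n * W)\<close>.\<close>
    then have "0 \<le> e / real n" by (simp add: e_def)
    have "(\<Sum>A\<in>#P. real (node_count n d A)) = real (\<Sum>A\<in>#P. node_count n d A)"
      by (induction P) auto
    then have count: "(\<Sum>A\<in>#P. real (node_count n d A)) = real n"
      unfolding IH(3) .
    have "e\<^sup>2 / (real n * W)
      = (2 * (e / real n) * e - (e / real n)\<^sup>2 * (\<Sum>A\<in>#P. real (node_count n d A))) / W"
      unfolding count using n W by (simp add: field_simps power2_eq_square)
    also have "(2 * (e / real n) * e - (e / real n)\<^sup>2 * (\<Sum>A\<in>#P. real (node_count n d A))) / W
      = (\<Sum>A\<in>#P. (2 * (e / real n) * excess n d g A - (e / real n)\<^sup>2 * real (node_count n d A)) / W)"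
      unfolding e_def by (simp add: sum_mset_distrib_left subtract[symmetric] divide_inverse sum_mset_distrib_right)
    also have "\<dots> \<le> (\<Sum>A\<in>#P. gain_bound n d g W A)"
      by (intro sum_mset_mono gain_bound_ge W \<open>0 \<le> e / real n\<close>)
    finally show "(\<Sum>A\<in>#D. excess n d g A) \<le> (\<Sum>A\<in>#P. excess n d g A) - (\<Sum>A\<in>#P. excess n d g A)\<^sup>2 / (real n * W)"
      using IH(6) unfolding subtract e_def by linarith
  qed
  \<comment> \<open>The finished layer takes the place of \<open>P\<close> with nothing processed;
    its size is at most doubled, which matches the step from \<open>2 ^ k\<close> to
    \<open>2 ^ Suc k\<close>.\<close>
  with IH W show ?case
    by (intro exI[of _ D] exI[of _ "{#}"] exI[of _ "Suc k"]) simp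
qed

text \<open>Growth may stop inside a layer, so the leaves are the unprocessed part of the current
  layer \<open>P\<close> and what has become of the rest. They refine \<open>P\<close>, hence have
  no more excess, and are at most twice as many; more than \<open>2 ^ Suc K\<close> leaves thus
  force more than \<open>K\<close> complete layers before.\<close>

lemma odt_leaves_excess:
  assumes lv: "odt_leaves n d t L" and g: "ridge_step v g" and W: "4 * v\<^sup>2 \<le> W" "W > 0"
    and n: "n > 0" and cube: "\<forall>i<n. fst (d i) \<in> unit_cube"
    and t: "2 ^ Suc K < t"
  shows "real K * (\<Sum>A\<in>#L. excess n d g A) \<le> real n * W"
proof -
  from lv obtain C D where st: "odt_state n d t C D" and L: "L = C + D" "size L = t"
    unfolding odt_leaves_def by blast
  obtain P P' k where P: "P = P' + C" "size P \<le> 2 ^ k" "size D \<le> 2 * size P'"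
    and k: "real k * (\<Sum>A\<in>#P. excess n d g A) \<le> real n * W"
    and D: "(\<Sum>A\<in>#D. excess n d g A) \<le> (\<Sum>A\<in>#P'. excess n d g A - gain_bound n d g W A)"
    using odt_state_excess[OF st g W n cube] by (elim exE conjE) (rule that)
  note D
  also have "(\<Sum>A\<in>#P'. excess n d g A - gain_bound n d g W A) \<le> (\<Sum>A\<in>#P'. excess n d g A)"
    by (intro sum_mset_mono) (simp add: gain_bound_nonneg W(2))
  finally have le: "(\<Sum>A\<in>#L. excess n d g A) \<le> (\<Sum>A\<in>#P. excess n d g A)"
    by (simp add: P(1) L(1))
  have "2 ^ Suc K < size C + size D" using t L by simp
  also have "\<dots> \<le> 2 * size P" using P(1,3) by simp
  also have "\<dots> \<le> 2 ^ Suc k" using P(2) by simp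
  finally have "K < k" by (simp only: power_strict_increasing_iff Suc_less_eq)
  show ?thesis
  \<comment> \<open>Raising the factor from \<open>K\<close> to \<open>k\<close> is monotone only
    for a nonnegative excess.\<close>
  proof (cases "0 \<le> (\<Sum>A\<in>#L. excess n d g A)")
    case True
    then have "real K * (\<Sum>A\<in>#L. excess n d g A) \<le> real k * (\<Sum>A\<in>#P. excess n d g A)"
      using \<open>K < k\<close> le by (intro mult_mono) auto
    with k show ?thesis by simp
  next
    case False
    then have "real K * (\<Sum>A\<in>#L. excess n d g A) \<le> 0" by (simp add: mult_nonneg_nonpos)
    also have "0 \<le> real n * W" using W by simp
    finally show ?thesis .
  qed
qed

section \<open>Leaves as a partition of the cube\<close>

inductive split_partition :: "(real ^ 'p::finite) set multiset \<Rightarrow> bool" where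
  root: "split_partition {#unit_cube#}"
| split: "split_partition (add_mset A L) \<Longrightarrow>
            split_partition (L + {#daughter_le A \<theta> s, daughter_gt A \<theta> s#})"

text \<open>Of a tree only this survives in the generalisation bound: its cells arise by successive
  hyperplane cuts. Data and optimality are forgotten, because the count has to cover the trees of
  all exchanged samples at once.\<close>

lemma odt_state_split_partition: "odt_state n d t C D \<Longrightarrow> split_partition (C + D)"
proof (induction rule: odt_state.induct)
  case (split A C D \<theta> s)
  then show ?case
    using split_partition.split[of A "C + D" \<theta> s] by (simp add: add.assoc)
qed (auto intro: split_partition.root)

text \<open>Empty cells may be repeated, but each cut sends a point to just one daughter, so the
  cell around it keeps multiplicity one. This makes \<open>cell_of\<close> well defined.\<close>

lemma split_partition_cell:
  assumes "split_partition L" "x \<in> unit_cube"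
  shows "\<exists>A. filter_mset (\<lambda>A. x \<in> A) L = {#A#}"
  using assms
proof induction
  case (split A L \<theta> s)
  then show ?case
    by (cases "x \<in> A"; cases "\<theta> \<bullet> x \<le> s") (auto simp: daughter_le_def daughter_gt_def)
qed simp

definition cell_of :: "(real ^ 'p::finite) set multiset \<Rightarrow> real ^ 'p \<Rightarrow> (real ^ 'p) set" where
  "cell_of L x = (THE A. filter_mset (\<lambda>A. x \<in> A) L = {#A#})"

lemma filter_cell_of:
  assumes "split_partition L" "x \<in> unit_cube"
  shows "filter_mset (\<lambda>A. x \<in> A) L = {#cell_of L x#}"
  using split_partition_cell[OF assms] unfolding cell_of_def by (auto intro: theI)

lemma sum_mset_cell:
  assumes "split_partition L" "x \<in> unit_cube"
  shows "(\<Sum>A\<in>#L. if x \<in> A then f A else (0::real)) = f (cell_of L x)"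
proof -
  have "(\<Sum>A\<in>#L. if x \<in> A then f A else 0) = (\<Sum>A\<in>#filter_mset (\<lambda>A. x \<in> A) L. f A)"
    by (induction L) auto
  then show ?thesis by (simp add: filter_cell_of[OF assms])
qed

lemma leaf_estimate_cell:
  assumes "split_partition L" "x \<in> unit_cube"
  shows "leaf_estimate n d L x = node_mean n d (cell_of L x)"
proof -
  have "leaf_estimate n d L x = (\<Sum>A\<in>#L. if x \<in> A then node_mean n d A else 0)"
    unfolding leaf_estimate_def by (intro arg_cong[where f = sum_mset] image_mset_cong) auto
  then show ?thesis by (simp add: sum_mset_cell[OF assms])
qed

lemma sum_mset_points_in:
  assumes "split_partition L" "\<forall>i<n. fst (d i) \<in> unit_cube"
  shows "(\<Sum>A\<in>#L. \<Sum>i\<in>points_in n d A. f A i) = (\<Sum>i<n. f (cell_of L (fst (d i))) i :: real)"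
proof -
  have "(\<Sum>A\<in>#L. \<Sum>i\<in>points_in n d A. f A i) = (\<Sum>A\<in>#L. \<Sum>i<n. if fst (d i) \<in> A then f A i else 0)"
    by (intro arg_cong[where f = sum_mset] image_mset_cong sum.mono_neutral_cong_left)
       (auto simp: points_in_def)
  also have "\<dots> = (\<Sum>i<n. \<Sum>A\<in>#L. if fst (d i) \<in> A then f A i else 0)"
    by (induction L) (auto simp: sum.distrib)
  also have "\<dots> = (\<Sum>i<n. f (cell_of L (fst (d i))) i)"
    using assms by (intro sum.cong refl) (simp add: sum_mset_cell)
  finally show ?thesis .
qed

lemma odt_training_error:
  assumes lv: "odt_leaves n d t L" and g: "ridge_step v g" and W: "4 * v\<^sup>2 \<le> W" "W > 0"
    and n: "n > 0" and cube: "\<forall>i<n. fst (d i) \<in> unit_cube"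
    and t: "2 ^ Suc K < t" and K: "K > 0"
  shows "(\<Sum>i<n. (leaf_estimate n d L (fst (d i)) - snd (d i))\<^sup>2)
     \<le> (\<Sum>i<n. (g (fst (d i)) - snd (d i))\<^sup>2) + real n * W / real K"
proof -
  have sp: "split_partition L"
    using lv odt_state_split_partition by (auto simp: odt_leaves_def)
  have "(\<Sum>A\<in>#L. excess n d g A) = (\<Sum>A\<in>#L. \<Sum>i\<in>points_in n d A.
      (snd (d i) - node_mean n d A)\<^sup>2 - (snd (d i) - g (fst (d i)))\<^sup>2)"
    by (simp add: excess_def node_sse_def sum_subtractf)
  also have "\<dots> = (\<Sum>i<n. (snd (d i) - node_mean n d (cell_of L (fst (d i))))\<^sup>2 - (snd (d i) - g (fst (d i)))\<^sup>2)"
    by (rule sum_mset_points_in[OF sp cube])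
  also have "\<dots> = (\<Sum>i<n. (leaf_estimate n d L (fst (d i)) - snd (d i))\<^sup>2 - (g (fst (d i)) - snd (d i))\<^sup>2)"
    by (intro sum.cong refl) (simp add: leaf_estimate_cell[OF sp] cube power2_commute)
  finally have eq: "(\<Sum>A\<in>#L. excess n d g A) = \<dots>" .
  have "(\<Sum>A\<in>#L. excess n d g A) \<le> real n * W / real K"
    using odt_leaves_excess[OF lv g W n cube t] K by (simp add: pos_le_divide_eq mult.commute)
  then show ?thesis unfolding eq by (simp add: sum_subtractf)
qed

section \<open>Counting the traces of halfspaces and partitions\<close>

definition shatters :: "'b set set \<Rightarrow> 'b set \<Rightarrow> bool" where
  "shatters F S \<longleftrightarrow> (\<forall>T\<subseteq>S. \<exists>A\<in>F. A \<inter> S = T)"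

lemma shatters_mono: "shatters F S \<Longrightarrow> F \<subseteq> G \<Longrightarrow> shatters G S"
  unfolding shatters_def by (meson subsetD)

text \<open>Induction on the ground set. \<open>F0\<close> holds the members without
  \<open>x\<close>, \<open>F1\<close> those with \<open>x\<close>, after its removal. A set
  shattered by either family is shattered by \<open>F\<close>, and one shattered by both yields a
  second set shattered by \<open>F\<close> on adding \<open>x\<close>, so nothing is lost in the
  count.\<close>

lemma card_le_card_shattered:
  assumes "finite V" "F \<subseteq> Pow V"
  shows "card F \<le> card {S. S \<subseteq> V \<and> shatters F S}"
  using assms
proof (induction V arbitrary: F rule: finite_induct)
  case empty
  then have "F = {} \<or> F = {{}}" by (simp add: subset_singleton_iff)
  then show ?case
  proof
    assume "F = {{}}"
    then have "{S. S \<subseteq> {} \<and> shatters F S} = {{}}" by (auto simp: shatters_def)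
    with \<open>F = {{}}\<close> show ?thesis by simp
  qed simp
next
  case (insert x V)
  define F0 where "F0 = {A \<in> F. x \<notin> A}"
  define F1 where "F1 = (\<lambda>A. A - {x}) ` {A \<in> F. x \<in> A}"
  define S0 where "S0 = {S. S \<subseteq> V \<and> shatters F0 S}"
  define S1 where "S1 = {S. S \<subseteq> V \<and> shatters F1 S}"
  define Sh where "Sh = {S. S \<subseteq> insert x V \<and> shatters F S}"
  have finF: "finite F" using insert by (auto intro: finite_subset)
  have fin: "finite S0" "finite S1" "finite Sh"
    using insert.hyps(1) by (auto simp: S0_def S1_def Sh_def)
  have "inj_on (\<lambda>A. A - {x}) {A \<in> F. x \<in> A}"
    by (rule inj_onI) blast
  then have c1: "card F1 = card {A \<in> F. x \<in> A}"
    unfolding F1_def by (rule card_image)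
  have "card (F0 \<union> {A \<in> F. x \<in> A}) = card F0 + card F1"
    unfolding c1 using finF by (intro card_Un_disjoint) (auto simp: F0_def)
  moreover have "F0 \<union> {A \<in> F. x \<in> A} = F" by (auto simp: F0_def)
  ultimately have cF: "card F = card F0 + card F1" by simp
  have "F0 \<subseteq> Pow V" "F1 \<subseteq> Pow V" using insert.prems by (auto simp: F0_def F1_def)
  then have "card F0 \<le> card S0" "card F1 \<le> card S1"
    unfolding S0_def S1_def by (auto intro: insert.IH)
  with cF have "card F \<le> card S0 + card S1" by simp
  \<comment> \<open>Sets counted twice are traded for their extensions by \<open>x\<close>, which
    are new because \<open>x\<close> is not in \<open>V\<close>.\<close>
  also have "\<dots> = card (S0 \<union> S1) + card (S0 \<inter> S1)"
    by (rule card_Un_Int[OF fin(1,2)])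
  also have "card (S0 \<inter> S1) = card (insert x ` (S0 \<inter> S1))"
    using insert.hyps(2) by (intro card_image[symmetric] inj_onI) (auto simp: S0_def)
  also have "card (S0 \<union> S1) + \<dots> = card ((S0 \<union> S1) \<union> insert x ` (S0 \<inter> S1))"
    using insert.hyps(2) fin by (intro card_Un_disjoint[symmetric]) (auto simp: S0_def S1_def)
  also have "\<dots> \<le> card Sh"
  proof (rule card_mono[OF fin(3)])
    have "F0 \<subseteq> F" by (auto simp: F0_def)
    then have "S0 \<subseteq> Sh"
      unfolding S0_def Sh_def using shatters_mono by blast
    moreover have "S1 \<subseteq> Sh"
    proof
      fix S assume S: "S \<in> S1"
      then have "x \<notin> S" using insert.hyps(2) by (auto simp: S1_def)
      have "shatters F S"
        unfolding shatters_def
      proof (intro allI impI)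
        fix T assume "T \<subseteq> S"
        with S obtain B where "B \<in> F1" "B \<inter> S = T"
          unfolding S1_def shatters_def by blast
        then obtain A where "A \<in> F" "(A - {x}) \<inter> S = T"
          unfolding F1_def by blast
        with \<open>x \<notin> S\<close> show "\<exists>A\<in>F. A \<inter> S = T" by blast
      qed
      with S show "S \<in> Sh" by (auto simp: S1_def Sh_def)
    qed
    moreover have "insert x S \<in> Sh" if S: "S \<in> S0" "S \<in> S1" for S
    proof -
      have "x \<notin> S" using S insert.hyps(2) by (auto simp: S1_def)
      have "shatters F (insert x S)"
        unfolding shatters_def
      proof (intro allI impI)
        fix T assume T: "T \<subseteq> insert x S"
        show "\<exists>A\<in>F. A \<inter> insert x S = T"
        proof (cases "x \<in> T")
          case True
          from T have "T - {x} \<subseteq> S" by blast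
          with S obtain B where "B \<in> F1" "B \<inter> S = T - {x}"
            unfolding S1_def shatters_def by blast
          then obtain A where "A \<in> F" "x \<in> A" "(A - {x}) \<inter> S = T - {x}"
            unfolding F1_def by blast
          with True \<open>x \<notin> S\<close> show ?thesis by (intro bexI[of _ A]) auto
        next
          case False
          with T have "T \<subseteq> S" by auto
          with S obtain A where "A \<in> F0" "A \<inter> S = T" unfolding S0_def shatters_def by blast
          then show ?thesis by (intro bexI[of _ A]) (auto simp: F0_def)
        qed
      qed
      with S show ?thesis by (auto simp: Sh_def S0_def)
    qed
    ultimately show "(S0 \<union> S1) \<union> insert x ` (S0 \<inter> S1) \<subseteq> Sh" by auto
  qed
  finally show ?case by (simp add: Sh_def)
qed

text \<open>A subset is read off a list of length \<open>k\<close> that enumerates it and is padded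
  with \<open>N\<close>, a letter outside the ground set; hence \<open>Suc N\<close>
  letters.\<close>

lemma card_small_subsets:
  "card {S. S \<subseteq> {..<N} \<and> card S \<le> k} \<le> Suc N ^ k"
proof -
  let ?X = "{xs. set xs \<subseteq> {..N} \<and> length xs = k}"
  have fin: "finite ?X" by (rule finite_lists_length_eq) simp
  have "{S. S \<subseteq> {..<N} \<and> card S \<le> k} \<subseteq> (\<lambda>xs. set xs \<inter> {..<N}) ` ?X"
  proof
    fix S assume "S \<in> {S. S \<subseteq> {..<N} \<and> card S \<le> k}"
    then have S: "S \<subseteq> {..<N}" "card S \<le> k" "finite S" by (auto intro: finite_subset)
    then have "S = set (sorted_list_of_set S @ replicate (k - card S) N) \<inter> {..<N}"
      by (auto split: if_splits)
    moreover have "sorted_list_of_set S @ replicate (k - card S) N \<in> ?X"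
      using S by auto
    ultimately show "S \<in> (\<lambda>xs. set xs \<inter> {..<N}) ` ?X" by blast
  qed
  then have "card {S. S \<subseteq> {..<N} \<and> card S \<le> k} \<le> card ?X"
    using fin by (rule surj_card_le[rotated])
  then show ?thesis by (simp add: card_lists_length_eq)
qed

section \<open>Traces of halfspaces on finitely many points\<close>

definition halfspace_traces :: "(nat \<Rightarrow> real ^ 'p::finite) \<Rightarrow> nat \<Rightarrow> nat set set" where
  "halfspace_traces x N = {{j. j < N \<and> \<theta> \<bullet> x j \<le> s} | \<theta> s. True}"

lemma finite_halfspace_traces: "finite (halfspace_traces x N)"
  by (rule finite_subset[of _ "Pow {..<N}"]) (auto simp: halfspace_traces_def)

text \<open>Among \<open>p + 2\<close> distinct points in dimension \<open>p\<close> Radon's theorem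
  finds two disjoint subsets with intersecting convex hulls, and no halfspace can contain the one
  and miss the other.\<close>

lemma card_shattered_by_halfspaces:
  fixes x :: "nat \<Rightarrow> real ^ 'p::finite"
  assumes S: "S \<subseteq> {..<N}" and sh: "shatters (halfspace_traces x N) S"
  shows "card S \<le> CARD('p) + 1"
proof (rule ccontr)
  assume "\<not> ?thesis"
  then have cS: "card S \<ge> CARD('p) + 2" by simp
  have ex: "\<exists>\<theta> s. \<forall>j\<in>S. \<theta> \<bullet> x j \<le> s \<longleftrightarrow> j \<in> T" if T: "T \<subseteq> S" for T
  proof -
    obtain A where "A \<in> halfspace_traces x N" "A \<inter> S = T"
      using sh T by (auto simp: shatters_def)
    then obtain \<theta> s where "{j. j < N \<and> \<theta> \<bullet> x j \<le> s} \<inter> S = T"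
      by (auto simp: halfspace_traces_def)
    then show ?thesis using S by (intro exI[of _ \<theta>] exI[of _ s]) auto
  qed
  \<comment> \<open>Sample points may coincide, but equal points cannot be told apart by a
    halfspace; so the indices of a shattered set name distinct points and the cardinality carries
    over.\<close>
  have "inj_on x S"
  proof (rule inj_onI, rule ccontr)
    fix i j assume ij: "i \<in> S" "j \<in> S" "x i = x j" "i \<noteq> j"
    from ij(1) obtain \<theta> s where "\<forall>k\<in>S. \<theta> \<bullet> x k \<le> s \<longleftrightarrow> k \<in> {i}"
      using ex[of "{i}"] by blast
    with ij show False by (metis singletonD singletonI)
  qed
  then have "card (x ` S) \<ge> DIM(real ^ 'p) + 2" using cS by (simp add: card_image)
  then have "affine_dependent (x ` S)"
    using S by (intro affine_dependent_biggerset) (auto intro: finite_subset)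
  then obtain P Q where PQ: "P \<subseteq> x ` S" "Q \<subseteq> x ` S" "P \<inter> Q = {}" "convex hull P \<inter> convex hull Q \<noteq> {}"
    by (rule Radon)
  obtain \<theta> s where \<theta>: "\<forall>j\<in>S. \<theta> \<bullet> x j \<le> s \<longleftrightarrow> x j \<in> P"
    using ex[of "{j \<in> S. x j \<in> P}"] by auto
  have "convex hull P \<subseteq> {y. \<theta> \<bullet> y \<le> s}"
    using \<theta> PQ by (intro hull_minimal convex_halfspace_le) auto
  moreover have "convex hull Q \<subseteq> {y. \<theta> \<bullet> y > s}"
    using \<theta> PQ by (intro hull_minimal convex_halfspace_gt) force+
  ultimately show False using PQ(4) by fastforce
qed

lemma card_halfspace_traces:
  fixes x :: "nat \<Rightarrow> real ^ 'p::finite"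
  shows "card (halfspace_traces x N) \<le> Suc N ^ (CARD('p) + 1)"
proof -
  have "card (halfspace_traces x N) \<le> card {S. S \<subseteq> {..<N} \<and> shatters (halfspace_traces x N) S}"
    by (rule card_le_card_shattered) (auto simp: halfspace_traces_def)
  also have "\<dots> \<le> card {S. S \<subseteq> {..<N} \<and> card S \<le> CARD('p) + 1}"
    using card_shattered_by_halfspaces[of _ N x] by (intro card_mono) auto
  also have "\<dots> \<le> Suc N ^ (CARD('p) + 1)" by (rule card_small_subsets)
  finally show ?thesis .
qed

section \<open>Traces of partitions and their sign labellings\<close>

definition trace_on :: "(nat \<Rightarrow> real ^ 'p::finite) \<Rightarrow> nat \<Rightarrow> (real ^ 'p) set \<Rightarrow> nat set" where
  "trace_on x N A = {j. j < N \<and> x j \<in> A}"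

text \<open>Multisets, so that cells without points still count towards \<open>k\<close>, however
  many there are.\<close>

definition partition_traces :: "(nat \<Rightarrow> real ^ 'p::finite) \<Rightarrow> nat \<Rightarrow> nat \<Rightarrow> nat set multiset set" where
  "partition_traces x N k = {image_mset (trace_on x N) L | L. split_partition L \<and> size L = k}"

lemma card_set_mset_le_size: "card (set_mset T) \<le> size T"
  by (induction T) (auto simp: card_insert_if)

lemma partition_traces_1:
  fixes x :: "nat \<Rightarrow> real ^ 'p::finite"
  shows "partition_traces x N 1 \<subseteq> {{#trace_on x N unit_cube#}}"
proof -
  have "L = {#unit_cube#}" if "split_partition L" "size L = 1" for L :: "(real ^ 'p) set multiset"
    using that(1)
  proof cases
    case (split A L0 \<theta> s)
    with that show ?thesis by simp
  qed
  then show ?thesis unfolding partition_traces_def by fastforce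
qed

text \<open>Cutting a cell acts on its trace as intersection with a halfspace trace and its
  complement, so the last cut is determined on traces by the parent trace and one halfspace
  trace.\<close>

lemma partition_traces_Suc:
  assumes "k > 0"
  shows "partition_traces x N (Suc k) \<subseteq> (\<Union>T\<in>partition_traces x N k. \<Union>B\<in>set_mset T.
           (\<lambda>h. T - {#B#} + {#B \<inter> h, B - h#}) ` halfspace_traces x N)"
proof
  fix T assume "T \<in> partition_traces x N (Suc k)"
  then obtain L where L: "split_partition L" "size L = Suc k" "T = image_mset (trace_on x N) L"
    by (auto simp: partition_traces_def)
  from L(1) show "T \<in> (\<Union>T\<in>partition_traces x N k. \<Union>B\<in>set_mset T.
           (\<lambda>h. T - {#B#} + {#B \<inter> h, B - h#}) ` halfspace_traces x N)"
  proof cases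
    case root
    with L(2) assms show ?thesis by simp
  next
    case (split A L0 \<theta> s)
    let ?T0 = "image_mset (trace_on x N) (add_mset A L0)" and ?h = "{j. j < N \<and> \<theta> \<bullet> x j \<le> s}"
    have "?T0 \<in> partition_traces x N k"
      using split L(2) unfolding partition_traces_def
      by (intro CollectI exI[of _ "add_mset A L0"]) simp
    moreover have "trace_on x N A \<in># ?T0" by simp
    moreover have "?h \<in> halfspace_traces x N" by (auto simp: halfspace_traces_def)
    moreover have "T = ?T0 - {#trace_on x N A#} + {#trace_on x N A \<inter> ?h, trace_on x N A - ?h#}"
    proof -
      have "trace_on x N (daughter_le A \<theta> s) = trace_on x N A \<inter> ?h"
        "trace_on x N (daughter_gt A \<theta> s) = trace_on x N A - ?h"
        by (auto simp: trace_on_def daughter_le_def daughter_gt_def)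
      then show ?thesis by (simp add: L(3) split(1))
    qed
    ultimately show ?thesis by blast
  qed
qed

text \<open>Each cut chooses one of at most \<open>t\<close> cells and one of at most
  \<open>H\<close> halfspace traces, and \<open>Suc k\<close> cells need \<open>k\<close>
  cuts.\<close>

lemma card_partition_traces:
  assumes "k < t" "card (halfspace_traces x N) \<le> H"
  shows "finite (partition_traces x N (Suc k)) \<and> card (partition_traces x N (Suc k)) \<le> (t * H) ^ k"
  using assms(1)
proof (induction k)
  case 0
  from partition_traces_1[of x N] show ?case
    using card_mono[OF _ partition_traces_1[of x N]] by (auto intro: finite_subset)
next
  case (Suc k)
  let ?P = "partition_traces x N (Suc k)"
  let ?f = "\<lambda>T B. (\<lambda>h. T - {#B#} + {#B \<inter> h, B - h#}) ` halfspace_traces x N"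
  from Suc have IH: "finite ?P" "card ?P \<le> (t * H) ^ k" by auto
  have sub: "partition_traces x N (Suc (Suc k)) \<subseteq> (\<Union>T\<in>?P. \<Union>B\<in>set_mset T. ?f T B)"
    by (rule partition_traces_Suc) simp
  have fin: "finite (\<Union>T\<in>?P. \<Union>B\<in>set_mset T. ?f T B)"
    using IH finite_halfspace_traces by auto
  have "card (\<Union>B\<in>set_mset T. ?f T B) \<le> t * H" if "T \<in> ?P" for T
  proof -
    have "size T = Suc k" using that by (auto simp: partition_traces_def)
    then have "card (set_mset T) \<le> Suc k"
      using card_set_mset_le_size[of T] by simp
    have "card (\<Union>B\<in>set_mset T. ?f T B) \<le> (\<Sum>B\<in>set_mset T. card (?f T B))"
      by (rule card_UN_le) simp
    also have "\<dots> \<le> (\<Sum>B\<in>set_mset T. H)"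
      using assms(2) by (intro sum_mono order_trans[OF card_image_le[OF finite_halfspace_traces]])
    also have "\<dots> \<le> t * H"
      using \<open>card (set_mset T) \<le> Suc k\<close> Suc.prems by simp
    finally show ?thesis .
  qed
  then have "(\<Sum>T\<in>?P. card (\<Union>B\<in>set_mset T. ?f T B)) \<le> card ?P * (t * H)"
    using sum_bounded_above[of ?P "\<lambda>T. card (\<Union>B\<in>set_mset T. ?f T B)" "t * H"] by simp
  with card_UN_le[OF IH(1), of "\<lambda>T. \<Union>B\<in>set_mset T. ?f T B"]
  have "card (\<Union>T\<in>?P. \<Union>B\<in>set_mset T. ?f T B) \<le> card ?P * (t * H)" by simp
  also have "\<dots> \<le> (t * H) ^ k * (t * H)" using IH(2) by (intro mult_right_mono) auto
  finally have "card (partition_traces x N (Suc (Suc k))) \<le> (t * H) ^ Suc k"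
    using card_mono[OF fin sub] by (simp add: mult.commute)
  with finite_subset[OF sub fin] show ?case by blast
qed

text \<open>\<open>W\<close> collects the cells labelled 1. As a set of traces it cannot separate
  equal ones, but in the trace of a partition only empty traces can coincide, and these label no
  point.\<close>

definition sign_labelling :: "nat set multiset \<Rightarrow> nat set set \<Rightarrow> nat \<Rightarrow> real" where
  "sign_labelling T W j = (\<Sum>B\<in>#T. if j \<in> B then (if B \<in> W then 1 else -1) else 0)"

definition labellings :: "(nat \<Rightarrow> real ^ 'p::finite) \<Rightarrow> nat \<Rightarrow> nat \<Rightarrow> (nat \<Rightarrow> real) set" where
  "labellings x N t = (\<Union>T\<in>partition_traces x N t. sign_labelling T ` Pow (set_mset T))"

text \<open>There are at most \<open>(t * H) ^ (t - 1)\<close> partitions and \<open>2 ^ t\<close>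
  choices of the positive cells for each; the exponent \<open>t - 1\<close> is rounded up to obtain
  one power.\<close>

lemma labellings_card:
  fixes x :: "nat \<Rightarrow> real ^ 'p::finite"
  assumes "t > 0"
  shows "finite (labellings x N t)"
    and "card (labellings x N t) \<le> (2 * t * Suc N ^ (CARD('p) + 1)) ^ t"
proof -
  let ?H = "Suc N ^ (CARD('p) + 1)" and ?P = "partition_traces x N t"
  obtain k where k: "t = Suc k" using assms by (cases t) auto
  have P: "finite ?P" "card ?P \<le> (t * ?H) ^ k"
    using card_partition_traces[of k t x N, OF _ card_halfspace_traces] by (auto simp: k)
  show "finite (labellings x N t)"
    using P by (auto simp: labellings_def)
  have "card (sign_labelling T ` Pow (set_mset T)) \<le> 2 ^ t" if "T \<in> ?P" for T
  proof -
    have "size T = t" using that by (auto simp: partition_traces_def)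
    then have "card (set_mset T) \<le> t" using card_set_mset_le_size[of T] by simp
    then have "card (Pow (set_mset T)) \<le> 2 ^ t" by (simp add: card_Pow power_increasing)
    then show ?thesis by (rule order_trans[OF card_image_le, rotated]) simp
  qed
  then have "(\<Sum>T\<in>?P. card (sign_labelling T ` Pow (set_mset T))) \<le> card ?P * 2 ^ t"
    using sum_bounded_above[of ?P "\<lambda>T. card (sign_labelling T ` Pow (set_mset T))" "2 ^ t"] by simp
  with card_UN_le[OF P(1), of "\<lambda>T. sign_labelling T ` Pow (set_mset T)"]
  have "card (labellings x N t) \<le> card ?P * 2 ^ t" by (simp add: labellings_def)
  also have "\<dots> \<le> (t * ?H) ^ t * 2 ^ t"
  proof (rule mult_right_mono)
    have "0 < t * ?H" using assms by (simp only: nat_0_less_mult_iff zero_less_power zero_less_Suc)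
    then have "1 \<le> t * ?H" by linarith
    then have "(t * ?H) ^ k \<le> (t * ?H) ^ t"
      by (rule power_increasing[rotated]) (simp add: k)
    with P(2) show "card ?P \<le> (t * ?H) ^ t" by linarith
  qed simp
  also have "\<dots> = (2 * t * ?H) ^ t" by (simp only: power_mult_distrib[symmetric] mult_ac)
  finally show "card (labellings x N t) \<le> (2 * t * ?H) ^ t" .
qed

lemma labelling_bounded:
  assumes "split_partition L" "j < N" "x j \<in> unit_cube"
  shows "\<bar>sign_labelling (image_mset (trace_on x N) L) W j\<bar> \<le> 1"
proof -
  have "sign_labelling (image_mset (trace_on x N) L) W j
      = (\<Sum>A\<in>#L. if x j \<in> A then (if trace_on x N A \<in> W then 1 else -1) else 0)"
    unfolding sign_labelling_def image_mset.compositionality comp_def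
    using assms(2) by (simp add: trace_on_def)
  then show ?thesis by (simp add: sum_mset_cell[OF assms(1,3)])
qed

section \<open>Sign averages over finite classes\<close>

text \<open>For \<open>0 \<le> x \<le> 1\<close> the two exponentials are at most
  \<open>1 + x + x^2\<close> and \<open>1 - x + x^2\<close>; for larger \<open>x\<close> each is at
  most \<open>exp (x^2)\<close>. The exponent \<open>a^2\<close> instead of the sharp
  \<open>a^2 / 2\<close> affects constants only.\<close>

lemma exp_add_exp_minus_le: "exp a + exp (- a) \<le> 2 * exp (a\<^sup>2)" for a :: real
proof -
  have nonneg: "exp x + exp (- x) \<le> 2 * exp (x\<^sup>2)" if "0 \<le> x" for x :: real
  proof (cases "x \<le> 1")
    case True
    have "1 * 1 \<le> (1 + x) * (1 - x + x\<^sup>2)"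
      using \<open>0 \<le> x\<close> by (simp add: algebra_simps power2_eq_square)
    then have "1 / (1 + x) \<le> 1 - x + x\<^sup>2"
      using \<open>0 \<le> x\<close> by (simp add: pos_divide_le_eq mult.commute)
    moreover have "exp (- x) \<le> 1 / (1 + x)"
      using \<open>0 \<le> x\<close> exp_ge_add_one_self[of x] by (simp add: exp_minus inverse_eq_divide frac_le)
    ultimately have "exp (- x) \<le> 1 - x + x\<^sup>2" by (rule order_trans[rotated])
    then have "exp x + exp (- x) \<le> 2 * (1 + x\<^sup>2)"
      using exp_bound[OF that True] by simp
    also have "\<dots> \<le> 2 * exp (x\<^sup>2)"
      by (intro mult_left_mono exp_ge_add_one_self) simp
    finally show ?thesis .
  next
    case False
    then have "x * 1 \<le> x * x" by (intro mult_left_mono) auto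
    then have "exp x \<le> exp (x\<^sup>2)" "exp (- x) \<le> exp (x\<^sup>2)"
      using that by (simp_all add: power2_eq_square)
    then show ?thesis by linarith
  qed
  show ?thesis
    using nonneg[of a] nonneg[of "- a"] by (cases "0 \<le> a") auto
qed

text \<open>Random signs are encoded as subsets: \<open>i \<in> S\<close> means that observation
  \<open>i\<close> changes places with its copy, and expectations over signs are averages over
  \<open>Pow {..<n}\<close>.\<close>

definition flip :: "nat set \<Rightarrow> nat \<Rightarrow> real" where
  "flip S i = (if i \<in> S then - 1 else 1)"

lemma sum_Pow_lessThan_Suc:
  "(\<Sum>S\<in>Pow {..<Suc n}. f S) = (\<Sum>S\<in>Pow {..<n}. f S) + (\<Sum>S\<in>Pow {..<n}. f (insert n S))"
  for f :: "nat set \<Rightarrow> 'b::comm_monoid_add"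
proof -
  have "inj_on (insert n) (Pow {..<n})"
    by (rule inj_onI) (simp add: set_eq_iff subset_iff, metis less_irrefl)
  then show ?thesis
    unfolding lessThan_Suc Pow_insert
    by (subst sum.union_disjoint) (auto simp: sum.reindex)
qed

text \<open>The moment generating function of a random sign sum. Independence of the signs takes the
  form of a recursion that separates the subsets with and without the last index.\<close>

lemma sum_flip_exp_le:
  "(\<Sum>S\<in>Pow {..<n}. exp (\<Sum>i<n. flip S i * a i)) \<le> 2 ^ n * exp (\<Sum>i<n. (a i)\<^sup>2)"
proof (induction n)
  case (Suc n)
  let ?E = "\<lambda>S. exp (\<Sum>i<n. flip S i * a i)"
  have 1: "exp (\<Sum>i<Suc n. flip S i * a i) = ?E S * exp (a n)" if "S \<in> Pow {..<n}" for S
    using that by (auto simp: flip_def exp_add)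
  have 2: "exp (\<Sum>i<Suc n. flip (insert n S) i * a i) = ?E S * exp (- a n)" if "S \<in> Pow {..<n}" for S
  proof -
    have "(\<Sum>i<n. flip (insert n S) i * a i) = (\<Sum>i<n. flip S i * a i)"
      by (intro sum.cong) (auto simp: flip_def)
    then show ?thesis by (simp add: flip_def exp_diff exp_minus divide_inverse)
  qed
  have "(\<Sum>S\<in>Pow {..<Suc n}. exp (\<Sum>i<Suc n. flip S i * a i))
      = (\<Sum>S\<in>Pow {..<n}. ?E S) * (exp (a n) + exp (- a n))"
    by (simp only: sum_Pow_lessThan_Suc 1 2 sum_distrib_right distrib_left cong: sum.cong)
  also have "\<dots> \<le> (2 ^ n * exp (\<Sum>i<n. (a i)\<^sup>2)) * (2 * exp ((a n)\<^sup>2))"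
    by (intro mult_mono Suc.IH exp_add_exp_minus_le mult_nonneg_nonneg add_nonneg_nonneg) auto
  also have "\<dots> = 2 ^ Suc n * exp (\<Sum>i<Suc n. (a i)\<^sup>2)"
    by (simp add: exp_add)
  finally show ?case .
qed simp

text \<open>The tangent of the exponential at the level \<open>L\<close> takes the place of Jensen's inequality in
  Massart's argument.\<close>

lemma sum_flip_max_le:
  fixes K b :: real
  assumes V: "finite V" "real (card V) \<le> K" and K: "K > 1"
    and b: "b > 0" "\<And>h i. h \<in> V \<Longrightarrow> i < n \<Longrightarrow> \<bar>h i\<bar> \<le> b"
    and n: "n > 0"
    and M: "\<And>S. S \<subseteq> {..<n} \<Longrightarrow> \<exists>h\<in>V. M S \<le> (\<Sum>i<n. flip S i * h i)"
  shows "(\<Sum>S\<in>Pow {..<n}. M S) \<le> 2 ^ n * (2 * b * sqrt (real n * ln K))"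
proof -
  \<comment> \<open>This \<open>\<kappa>\<close> balances the two parts of \<open>L\<close>: both
    become \<open>ln K\<close>, and \<open>L / \<kappa>\<close> is the desired bound.
    \<open>L\<close> is chosen so that
    \<open>exp (- L) * K * exp (\<kappa>\<^sup>2 * n * b\<^sup>2) = 1\<close>, which cancels the
    \<open>- 1\<close> of the tangent.\<close>
  define \<kappa> where "\<kappa> = sqrt (ln K / real n) / b"
  define L where "L = ln K + \<kappa>\<^sup>2 * real n * b\<^sup>2"
  let ?s = "\<lambda>S h. \<Sum>i<n. flip S i * h i"
  have "ln K > 0" using K by simp
  then have \<kappa>: "\<kappa> > 0" using n b by (simp add: \<kappa>_def)
  have L: "L = 2 * ln K"
    using n b \<open>ln K > 0\<close> by (simp add: L_def \<kappa>_def power_divide)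
  have tangent: "\<kappa> * M S \<le> L - 1 + exp (- L) * (\<Sum>h\<in>V. exp (\<Sum>i<n. flip S i * (\<kappa> * h i)))"
    if S: "S \<in> Pow {..<n}" for S
  proof -
    obtain h where h: "h \<in> V" "M S \<le> ?s S h" using M S by blast
    have "\<kappa> * M S \<le> \<kappa> * ?s S h" using h \<kappa> by simp
    also have "\<dots> \<le> L - 1 + exp (- L) * exp (\<kappa> * ?s S h)"
      using exp_ge_add_one_self[of "\<kappa> * ?s S h - L"] by (simp add: exp_diff exp_minus divide_inverse mult.commute)
    also have "exp (\<kappa> * ?s S h) = exp (\<Sum>i<n. flip S i * (\<kappa> * h i))"
      by (simp add: sum_distrib_left mult_ac)
    also have "\<dots> \<le> (\<Sum>h\<in>V. exp (\<Sum>i<n. flip S i * (\<kappa> * h i)))"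
      using V h by (intro member_le_sum) auto
    finally show ?thesis by simp
  qed
  have mgf: "(\<Sum>S\<in>Pow {..<n}. exp (\<Sum>i<n. flip S i * (\<kappa> * h i))) \<le> 2 ^ n * exp (\<kappa>\<^sup>2 * real n * b\<^sup>2)"
    if h: "h \<in> V" for h
  proof -
    have "(\<kappa> * h i)\<^sup>2 \<le> \<kappa>\<^sup>2 * b\<^sup>2" if "i < n" for i
      using power_mono[OF b(2)[OF h that], of 2] by (simp add: power_mult_distrib mult_left_mono)
    then have "(\<Sum>i<n. (\<kappa> * h i)\<^sup>2) \<le> (\<Sum>i<n. \<kappa>\<^sup>2 * b\<^sup>2)"
      by (intro sum_mono) auto
    then have "exp (\<Sum>i<n. (\<kappa> * h i)\<^sup>2) \<le> exp (\<kappa>\<^sup>2 * real n * b\<^sup>2)"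
      by (simp add: mult_ac)
    then show ?thesis
      by (intro order_trans[OF sum_flip_exp_le] mult_left_mono) auto
  qed
  have "\<kappa> * (\<Sum>S\<in>Pow {..<n}. M S)
      \<le> (\<Sum>S\<in>Pow {..<n}. L - 1 + exp (- L) * (\<Sum>h\<in>V. exp (\<Sum>i<n. flip S i * (\<kappa> * h i))))"
    unfolding sum_distrib_left[of \<kappa>] by (intro sum_mono tangent)
  also have "\<dots> = 2 ^ n * (L - 1)
      + exp (- L) * (\<Sum>h\<in>V. \<Sum>S\<in>Pow {..<n}. exp (\<Sum>i<n. flip S i * (\<kappa> * h i)))"
    unfolding sum.distrib sum_distrib_left[symmetric] sum.swap[of _ V]
    by (simp add: card_Pow)
  also have "\<dots> \<le> 2 ^ n * (L - 1) + exp (- L) * (real (card V) * (2 ^ n * exp (\<kappa>\<^sup>2 * real n * b\<^sup>2)))"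
    using mgf by (intro add_left_mono mult_left_mono sum_bounded_above) auto
  also have "\<dots> \<le> 2 ^ n * (L - 1) + exp (- L) * (K * (2 ^ n * exp (\<kappa>\<^sup>2 * real n * b\<^sup>2)))"
    using V by (intro add_left_mono mult_left_mono mult_right_mono) auto
  also have "\<dots> = 2 ^ n * L"
    using K by (simp add: L_def exp_add exp_minus exp_diff field_simps)
  finally have "(\<Sum>S\<in>Pow {..<n}. M S) \<le> 2 ^ n * L / \<kappa>"
    using \<kappa> by (simp add: pos_le_divide_eq mult.commute)
  also have "L / \<kappa> = 2 * b * sqrt (real n * ln K)"
  proof -
    have "ln K = sqrt (ln K) * sqrt (ln K)" using \<open>ln K > 0\<close> by simp
    then show ?thesis
      unfolding L \<kappa>_def using \<open>ln K > 0\<close> n b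
      by (simp add: real_sqrt_divide real_sqrt_mult field_simps)
  qed
  then have "2 ^ n * L / \<kappa> = 2 ^ n * (2 * b * sqrt (real n * ln K))"
    by (simp only: times_divide_eq_right[symmetric])
  finally show ?thesis .
qed

section \<open>Signed sums of squared errors over the doubled sample\<close>

lemma sum_lessThan_add:
  "(\<Sum>j<n + m. f j) = (\<Sum>i<n. f i) + (\<Sum>i<m. f (n + i))" for f :: "nat \<Rightarrow> 'b::comm_monoid_add"
  by (induction m) (simp_all add: add.assoc)

text \<open>For a fixed partition the sum is linear in the values of the cells, so under
  \<open>\<bar>u A\<bar> \<le> U\<close> it is largest when each cell takes the value
  \<open>U\<close> with the sign of its coefficient. The labelling depends on \<open>c\<close>, but
  the class it comes from does not.\<close>

lemma labelling_dominates:
  assumes L: "split_partition L" and cube: "\<And>j. j < N \<Longrightarrow> x j \<in> unit_cube"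
    and u: "\<And>A. \<bar>u A\<bar> \<le> U"
  shows "\<exists>g\<in>labellings x N (size L). (\<Sum>j<N. c j * u (cell_of L (x j))) \<le> U * (\<Sum>j<N. c j * g j)"
proof -
  define s where "s B = (\<Sum>j<N. if j \<in> B then c j else 0)" for B
  define T where "T = image_mset (trace_on x N) L"
  define W where "W = {B \<in> set_mset T. 0 \<le> s B}"
  have "(\<Sum>j<N. c j * u (cell_of L (x j))) = (\<Sum>j<N. \<Sum>A\<in>#L. if x j \<in> A then c j * u A else 0)"
    using L cube by (intro sum.cong refl) (simp add: sum_mset_cell)
  also have "\<dots> = (\<Sum>A\<in>#L. \<Sum>j<N. if x j \<in> A then c j * u A else 0)"
    by (induction L) (auto simp: sum.distrib)
  also have "\<dots> = (\<Sum>A\<in>#L. u A * s (trace_on x N A))"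
    unfolding s_def sum_distrib_left
    by (intro arg_cong[where f = sum_mset] image_mset_cong sum.cong refl) (auto simp: trace_on_def)
  also have "\<dots> \<le> (\<Sum>A\<in>#L. U * \<bar>s (trace_on x N A)\<bar>)"
  proof (rule sum_mset_mono)
    fix A
    have "u A * s (trace_on x N A) \<le> \<bar>u A\<bar> * \<bar>s (trace_on x N A)\<bar>"
      unfolding abs_mult[symmetric] by (rule abs_ge_self)
    also have "\<dots> \<le> U * \<bar>s (trace_on x N A)\<bar>"
      by (intro mult_right_mono u) simp
    finally show "u A * s (trace_on x N A) \<le> U * \<bar>s (trace_on x N A)\<bar>" .
  qed
  also have "\<dots> = U * (\<Sum>B\<in>#T. \<bar>s B\<bar>)"
    by (simp add: T_def sum_mset_distrib_left image_mset.compositionality comp_def)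
  also have "(\<Sum>B\<in>#T. \<bar>s B\<bar>) = (\<Sum>B\<in>#T. \<Sum>j<N. c j * (if j \<in> B then (if B \<in> W then 1 else -1) else 0))"
  proof (intro arg_cong[where f = sum_mset] image_mset_cong)
    fix B assume "B \<in># T"
    then have "\<bar>s B\<bar> = (if B \<in> W then 1 else -1) * s B"
      by (auto simp: W_def)
    also have "\<dots> = (\<Sum>j<N. c j * (if j \<in> B then (if B \<in> W then 1 else -1) else 0))"
      unfolding s_def sum_distrib_left by (intro sum.cong) auto
    finally show "\<bar>s B\<bar> = (\<Sum>j<N. c j * (if j \<in> B then (if B \<in> W then 1 else -1) else 0))" .
  qed
  also have "\<dots> = (\<Sum>j<N. c j * sign_labelling T W j)"
    unfolding sign_labelling_def
    by (induction T) (simp_all add: sum.distrib distrib_left)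
  finally have "(\<Sum>j<N. c j * u (cell_of L (x j))) \<le> U * (\<Sum>j<N. c j * sign_labelling T W j)" .
  moreover have "sign_labelling T W \<in> labellings x N (size L)"
    using L by (auto simp: labellings_def partition_traces_def T_def W_def)
  ultimately show ?thesis by blast
qed

lemma labellings_bounded:
  assumes "\<And>j. j < N \<Longrightarrow> x j \<in> unit_cube" "g \<in> labellings x N t" "j < N"
  shows "\<bar>g j\<bar> \<le> 1"
  using assms labelling_bounded[of _ j N x] by (fastforce simp: labellings_def partition_traces_def)

text \<open>The bound of \<open>labellings_card\<close> for a sample together with its copy, hence
  \<open>2 * n\<close> in place of \<open>N\<close>.\<close>

definition class_bound :: "nat \<Rightarrow> nat \<Rightarrow> nat \<Rightarrow> real" where
  "class_bound p n t = real ((2 * t * Suc (2 * n) ^ (p + 1)) ^ t)"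

lemma class_bound_gt_1: "t > 0 \<Longrightarrow> class_bound p n t > 1"
proof -
  assume t: "t > 0"
  then have "0 < t * Suc (2 * n) ^ (p + 1)"
    by (simp only: nat_0_less_mult_iff zero_less_power zero_less_Suc)
  then have "1 < 2 * t * Suc (2 * n) ^ (p + 1)" by linarith
  then have "1 < (2 * t * Suc (2 * n) ^ (p + 1)) ^ t" using t by (rule one_less_power)
  then show ?thesis unfolding class_bound_def by linarith
qed

text \<open>The weights let one statement serve the leaf values alone and their products with
  responses. A difference of two terms bounded by 1 gives \<open>b = 2\<close> and so the factor
  \<open>4 = 2 * 2\<close>.\<close>

lemma sum_flip_labellings_le:
  fixes x :: "nat \<Rightarrow> real ^ 'p::finite"
  assumes cube: "\<And>j. j < 2 * n \<Longrightarrow> x j \<in> unit_cube" and w: "\<And>j. j < 2 * n \<Longrightarrow> \<bar>w j\<bar> \<le> 1"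
    and n: "n > 0" and t: "t > 0"
    and M: "\<And>S. S \<subseteq> {..<n} \<Longrightarrow> \<exists>g\<in>labellings x (2 * n) t.
              M S \<le> (\<Sum>i<n. flip S i * (w (n + i) * g (n + i) - w i * g i))"
  shows "(\<Sum>S\<in>Pow {..<n}. M S) \<le> 2 ^ n * (4 * sqrt (real n * ln (class_bound CARD('p) n t)))"
proof -
  let ?V = "(\<lambda>g i. w (n + i) * g (n + i) - w i * g i) ` labellings x (2 * n) t"
  have fin: "finite (labellings x (2 * n) t)"
    by (rule labellings_card(1)[OF t])
  have "card ?V \<le> (2 * t * Suc (2 * n) ^ (CARD('p) + 1)) ^ t"
    by (rule order_trans[OF card_image_le[OF fin] labellings_card(2)[OF t]])
  then have card: "real (card ?V) \<le> class_bound CARD('p) n t"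
    unfolding class_bound_def by linarith
  have bound: "\<bar>h i\<bar> \<le> 2" if h: "h \<in> ?V" and i: "i < n" for h i
  proof -
    obtain g where g: "g \<in> labellings x (2 * n) t" "h = (\<lambda>i. w (n + i) * g (n + i) - w i * g i)"
      using h by blast
    have "\<bar>w j * g j\<bar> \<le> 1" if "j < 2 * n" for j
      using mult_mono[OF w[OF that] labellings_bounded[OF cube g(1) that]] by (simp add: abs_mult)
    from this[of i] this[of "n + i"] i show ?thesis by (simp add: g(2))
  qed
  have "(\<Sum>S\<in>Pow {..<n}. M S) \<le> 2 ^ n * (2 * 2 * sqrt (real n * ln (class_bound CARD('p) n t)))"
  proof (rule sum_flip_max_le[where V = ?V])
    show "finite ?V" using fin by simp
    show "\<exists>h\<in>?V. M S \<le> (\<Sum>i<n. flip S i * h i)" if "S \<subseteq> {..<n}" for S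
      using M[OF that] by simp
  qed (use card class_bound_gt_1[OF t] bound n in auto)
  then show ?thesis by simp
qed

text \<open>Expanding the squares leaves signed sums of \<open>f\<^sup>2\<close>,
  \<open>y * f\<close> and \<open>y\<^sup>2\<close>. The first two are linear in suitable cell
  values. Since the cross term counts twice, the constants add up to
  \<open>4 + 2 * 4 + 2 = 14\<close>. The function \<open>f S\<close> may change with
  \<open>S\<close>; it only has to be bounded and constant on the cells of some partition.\<close>

lemma symmetrized_sum_le:
  fixes x :: "nat \<Rightarrow> real ^ 'p::finite"
  assumes cube: "\<And>j. j < 2 * n \<Longrightarrow> x j \<in> unit_cube"
    and y: "\<And>j. j < 2 * n \<Longrightarrow> \<bar>y j\<bar> \<le> B" and B: "B > 0"
    and n: "n > 0" and t: "t > 0"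
    and f: "\<And>S. S \<subseteq> {..<n} \<Longrightarrow> \<exists>L u. split_partition L \<and> size L = t \<and> (\<forall>A. \<bar>u A\<bar> \<le> B)
              \<and> (\<forall>j<2 * n. f S (x j) = u (cell_of L (x j)))"
  shows "(\<Sum>S\<in>Pow {..<n}. \<Sum>i<n. flip S i * ((f S (x (n + i)) - y (n + i))\<^sup>2 - (f S (x i) - y i)\<^sup>2))
           \<le> 2 ^ n * (14 * B\<^sup>2 * sqrt (real n * ln (class_bound CARD('p) n t)))"
proof -
  let ?K = "class_bound CARD('p) n t"
  let ?r = "sqrt (real n * ln ?K)"
  define s where "s S h = (\<Sum>i<n. flip S i * (h (n + i) - h i))" for S and h :: "nat \<Rightarrow> real"
  \<comment> \<open>Reading the paired differences as one sum over \<open>2 * n\<close> indices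
    brings them into the form of \<open>labelling_dominates\<close>.\<close>
  define c where "c S j = (if j < n then - flip S j else flip S (j - n))" for S j
  have sc: "s S h = (\<Sum>j<2 * n. c S j * h j)" for S h
    unfolding mult_2 sum_lessThan_add s_def
    by (simp add: c_def sum_subtractf right_diff_distrib sum_negf)
  have dom: "\<exists>g\<in>labellings x (2 * n) t. s S (\<lambda>j. w j * u (cell_of L (x j))) \<le> U * s S (\<lambda>j. w j * g j)"
    if "split_partition L" "size L = t" "\<And>A. \<bar>u A\<bar> \<le> U" for S L u U and w :: "nat \<Rightarrow> real"
  proof -
    have "\<exists>g\<in>labellings x (2 * n) (size L). (\<Sum>j<2 * n. (c S j * w j) * u (cell_of L (x j)))
        \<le> U * (\<Sum>j<2 * n. (c S j * w j) * g j)"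
      by (rule labelling_dominates[OF that(1) cube that(3)])
    then show ?thesis by (simp add: sc that(2) mult.assoc)
  qed
  have 1: "(\<Sum>S\<in>Pow {..<n}. s S (\<lambda>j. (f S (x j))\<^sup>2) / B\<^sup>2) \<le> 2 ^ n * (4 * ?r)"
  proof (rule sum_flip_labellings_le[OF cube, where w = "\<lambda>_. 1"])
    fix S assume "S \<subseteq> {..<n}"
    from f[OF this] obtain L u where L: "split_partition L" "size L = t" and u: "\<And>A. \<bar>u A\<bar> \<le> B"
      and fS: "\<forall>j<2 * n. f S (x j) = u (cell_of L (x j))" by blast
    have u2: "\<bar>(u A)\<^sup>2\<bar> \<le> B\<^sup>2" for A using power_mono[OF u[of A], of 2] by simp
    obtain g where g: "g \<in> labellings x (2 * n) t"
      "s S (\<lambda>j. 1 * (u (cell_of L (x j)))\<^sup>2) \<le> B\<^sup>2 * s S (\<lambda>j. 1 * g j)"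
      using dom[where u = "\<lambda>A. (u A)\<^sup>2" and S = S and w = "\<lambda>_. 1", OF L u2] by (elim bexE) (rule that)
    have "s S (\<lambda>j. (f S (x j))\<^sup>2) = s S (\<lambda>j. 1 * (u (cell_of L (x j)))\<^sup>2)"
      unfolding s_def using fS by (intro sum.cong) auto
    with g B show "\<exists>g\<in>labellings x (2 * n) t. s S (\<lambda>j. (f S (x j))\<^sup>2) / B\<^sup>2
        \<le> (\<Sum>i<n. flip S i * (1 * g (n + i) - 1 * g i))"
      by (intro bexI[of _ g]) (simp_all add: s_def pos_divide_le_eq mult.commute)
  qed (use n t in auto)
  \<comment> \<open>The weight \<open>y / B\<close> and the cell value \<open>- u / B\<close> absorb
    one factor \<open>B\<close> each, and both are at most 1 in absolute value.\<close>
  have 2: "(\<Sum>S\<in>Pow {..<n}. s S (\<lambda>j. - (y j * f S (x j))) / B\<^sup>2) \<le> 2 ^ n * (4 * ?r)"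
  proof (rule sum_flip_labellings_le[OF cube, where w = "\<lambda>j. y j / B"])
    fix S assume "S \<subseteq> {..<n}"
    from f[OF this] obtain L u where L: "split_partition L" "size L = t" and u: "\<And>A. \<bar>u A\<bar> \<le> B"
      and fS: "\<forall>j<2 * n. f S (x j) = u (cell_of L (x j))" by blast
    have u1: "\<bar>- u A / B\<bar> \<le> 1" for A using u[of A] B by simp
    obtain g where g: "g \<in> labellings x (2 * n) t"
      "s S (\<lambda>j. y j / B * (- u (cell_of L (x j)) / B)) \<le> 1 * s S (\<lambda>j. y j / B * g j)"
      using dom[where u = "\<lambda>A. - u A / B" and S = S and w = "\<lambda>j. y j / B", OF L u1] by (elim bexE) (rule that)
    have "s S (\<lambda>j. - (y j * f S (x j))) / B\<^sup>2 = s S (\<lambda>j. y j / B * (- u (cell_of L (x j)) / B))"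
      unfolding s_def sum_divide_distrib using fS B
      by (intro sum.cong) (auto simp: field_simps power2_eq_square)
    with g show "\<exists>g\<in>labellings x (2 * n) t. s S (\<lambda>j. - (y j * f S (x j))) / B\<^sup>2
        \<le> (\<Sum>i<n. flip S i * (y (n + i) / B * g (n + i) - y i / B * g i))"
      by (intro bexI[of _ g]) (simp_all add: s_def)
  qed (use n t y B in auto)
  \<comment> \<open>This part does not involve the tree: the class consists of a single vector with
    entries bounded by 1.\<close>
  have 3: "(\<Sum>S\<in>Pow {..<n}. s S (\<lambda>j. (y j)\<^sup>2) / B\<^sup>2) \<le> 2 ^ n * (2 * 1 * ?r)"
  proof (rule sum_flip_max_le[where V = "{\<lambda>i. ((y (n + i))\<^sup>2 - (y i)\<^sup>2) / B\<^sup>2}"])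
    fix h i assume h: "h \<in> {\<lambda>i. ((y (n + i))\<^sup>2 - (y i)\<^sup>2) / B\<^sup>2}" and "i < n"
    have y2: "(y j)\<^sup>2 \<le> B\<^sup>2" if "j < 2 * n" for j
      using power_mono[OF y[OF that], of 2] by simp
    have "(y i)\<^sup>2 \<le> B\<^sup>2" "(y (n + i))\<^sup>2 \<le> B\<^sup>2" using \<open>i < n\<close> by (auto intro: y2)
    then have "\<bar>(y (n + i))\<^sup>2 - (y i)\<^sup>2\<bar> \<le> B\<^sup>2"
      using zero_le_power2[of "y i"] zero_le_power2[of "y (n + i)"] by (simp only: abs_le_iff) linarith
    with h B show "\<bar>h i\<bar> \<le> 1" by simp
  qed (use n class_bound_gt_1[OF t, of "CARD('p)" n] in \<open>auto simp: s_def sum_divide_distrib\<close>)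
  have split: "(\<Sum>i<n. flip S i * ((f S (x (n + i)) - y (n + i))\<^sup>2 - (f S (x i) - y i)\<^sup>2))
      = B\<^sup>2 * (s S (\<lambda>j. (f S (x j))\<^sup>2) / B\<^sup>2 + 2 * (s S (\<lambda>j. - (y j * f S (x j))) / B\<^sup>2)
          + s S (\<lambda>j. (y j)\<^sup>2) / B\<^sup>2)" for S
  proof -
    have "(\<Sum>i<n. flip S i * ((f S (x (n + i)) - y (n + i))\<^sup>2 - (f S (x i) - y i)\<^sup>2))
      = s S (\<lambda>j. (f S (x j))\<^sup>2) + 2 * s S (\<lambda>j. - (y j * f S (x j))) + s S (\<lambda>j. (y j)\<^sup>2)"
      unfolding s_def sum_distrib_left sum.distrib[symmetric]
      by (intro sum.cong refl) (simp add: power2_eq_square algebra_simps)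
    then show ?thesis using B by (simp add: field_simps)
  qed
  have "(\<Sum>S\<in>Pow {..<n}. \<Sum>i<n. flip S i * ((f S (x (n + i)) - y (n + i))\<^sup>2 - (f S (x i) - y i)\<^sup>2))
      = B\<^sup>2 * ((\<Sum>S\<in>Pow {..<n}. s S (\<lambda>j. (f S (x j))\<^sup>2) / B\<^sup>2)
          + 2 * (\<Sum>S\<in>Pow {..<n}. s S (\<lambda>j. - (y j * f S (x j))) / B\<^sup>2)
          + (\<Sum>S\<in>Pow {..<n}. s S (\<lambda>j. (y j)\<^sup>2) / B\<^sup>2))"
    unfolding split by (simp only: sum_distrib_left sum.distrib distrib_left)
  also have "\<dots> \<le> B\<^sup>2 * (2 ^ n * (4 * ?r) + 2 * (2 ^ n * (4 * ?r)) + 2 ^ n * (2 * 1 * ?r))"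
    using 1 2 3 by (intro mult_left_mono add_mono) auto
  finally show ?thesis by (simp add: algebra_simps)
qed

lemma abs_node_mean_le:
  assumes "\<And>i. i < n \<Longrightarrow> \<bar>snd (d i)\<bar> \<le> B" "B \<ge> 0"
  shows "\<bar>node_mean n d A\<bar> \<le> B"
proof (cases "node_count n d A = 0")
  case True
  then show ?thesis using assms by (simp add: node_mean_def)
next
  case False
  have "\<bar>\<Sum>i\<in>points_in n d A. snd (d i)\<bar> \<le> (\<Sum>i\<in>points_in n d A. \<bar>snd (d i)\<bar>)"
    by (rule sum_abs)
  also have "\<dots> \<le> real (node_count n d A) * B"
    unfolding node_count_def using assms by (intro sum_bounded_above) (auto simp: points_in_def)
  finally show ?thesis
    using False by (simp add: node_mean_def pos_divide_le_eq mult.commute)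
qed

section \<open>Density of halfspace combinations\<close>

lemma ridge_step_add_const: "ridge_step v g \<Longrightarrow> ridge_step v (\<lambda>x. g x + c)"
proof (induction rule: ridge_step.induct)
  case (const b)
  show ?case by (rule ridge_step.const[of "b + c"])
next
  case (step v g \<theta> a s)
  from ridge_step.step[OF step.IH step.hyps(2), of a s] show ?case by (simp add: add_ac)
qed

lemma ridge_step_add:
  assumes g: "ridge_step v g" and h: "ridge_step w h"
  shows "ridge_step (v + w) (\<lambda>x. g x + h x)"
  using h
proof induction
  case (const c)
  from ridge_step_add_const[OF g] show ?case by simp
next
  case (step w h \<theta> a s)
  from ridge_step.step[OF step.IH step.hyps(2), of a s] show ?case by (simp add: add_ac)
qed

lemma ridge_step_scale: "ridge_step v g \<Longrightarrow> ridge_step (\<bar>c\<bar> * v) (\<lambda>x. c * g x)"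
proof (induction rule: ridge_step.induct)
  case (const b)
  from ridge_step.const[of "c * b"] show ?case by simp
next
  case (step v g \<theta> a s)
  have "(\<lambda>x. c * (g x + (if \<theta> \<bullet> x \<le> s then a else 0))) = (\<lambda>x. c * g x + (if \<theta> \<bullet> x \<le> s then c * a else 0))"
    by (auto simp: distrib_left)
  with ridge_step.step[OF step.IH step.hyps(2), of "c * a" s] show ?case
    by (simp add: abs_mult distrib_left)
qed

lemma ridge_step_measurable: "ridge_step v g \<Longrightarrow> g \<in> borel_measurable borel"
proof (induction rule: ridge_step.induct)
  case (step v g \<theta> a s)
  have "Measurable.pred borel (\<lambda>x. \<theta> \<bullet> x \<le> s)" by simp
  with step.IH show ?case by measurable
qed simp

lemma ridge_step_bounded: "ridge_step v g \<Longrightarrow> \<exists>B. \<forall>x. \<bar>g x\<bar> \<le> B"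
proof (induction rule: ridge_step.induct)
  case (step v g \<theta> a s)
  then obtain B where "\<forall>x. \<bar>g x\<bar> \<le> B" by blast
  then have "\<bar>g x + (if \<theta> \<bullet> x \<le> s then a else 0)\<bar> \<le> B + \<bar>a\<bar>" for x
    using abs_triangle_ineq[of "g x" "if \<theta> \<bullet> x \<le> s then a else 0"] by (smt (verit))
  then show ?case by blast
qed auto

text \<open>The link between halfspaces and continuous functions: exponentials of linear forms span
  an algebra, while each of them depends on a single projection and is therefore within reach of
  halfspaces of one direction.\<close>

inductive_set exp_sums :: "(real ^ 'p::finite \<Rightarrow> real) set" where
  single: "(\<lambda>x. c * exp (a \<bullet> x)) \<in> exp_sums"
| add: "f \<in> exp_sums \<Longrightarrow> g \<in> exp_sums \<Longrightarrow> (\<lambda>x. f x + g x) \<in> exp_sums"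

lemma exp_sums_mult_single:
  "f \<in> exp_sums \<Longrightarrow> (\<lambda>x. c * exp (a \<bullet> x) * f x) \<in> exp_sums"
proof (induction rule: exp_sums.induct)
  case (single d b)
  from exp_sums.single[of "c * d" "a + b"] show ?case
    by (simp add: inner_add_left exp_add mult_ac)
next
  case (add f g)
  from exp_sums.add[OF add.IH] show ?case by (simp add: distrib_left)
qed

lemma exp_sums_mult:
  assumes "f \<in> exp_sums" "g \<in> exp_sums"
  shows "(\<lambda>x. f x * g x) \<in> exp_sums"
  using assms(1)
proof induction
  case (single c a)
  from exp_sums_mult_single[OF assms(2)] show ?case .
next
  case (add f1 f2)
  from exp_sums.add[OF add.IH] show ?case by (simp add: distrib_right)
qed

text \<open>Stone-Weierstrass; the exponential in direction \<open>x - y\<close> separates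
  \<open>x\<close> from \<open>y\<close>.\<close>

lemma exp_sums_dense:
  fixes f :: "real ^ 'p::finite \<Rightarrow> real"
  assumes "continuous_on unit_cube f" "e > 0"
  shows "\<exists>g\<in>exp_sums. \<forall>x\<in>unit_cube. \<bar>f x - g x\<bar> < e"
proof -
  interpret function_ring_on exp_sums "unit_cube :: (real ^ 'p) set"
  proof
    show "compact (unit_cube :: (real ^ 'p) set)" by (rule compact_cbox)
    fix g :: "real ^ 'p \<Rightarrow> real" assume "g \<in> exp_sums"
    then show "continuous_on unit_cube g"
      by induction (intro continuous_intros)+
  next
    fix c :: real
    from exp_sums.single[of c 0] show "(\<lambda>_ :: real ^ 'p. c) \<in> exp_sums" by simp
  next
    fix x y :: "real ^ 'p" assume "x \<noteq> y"
    then have "(x - y) \<bullet> x \<noteq> (x - y) \<bullet> y"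
      by (metis eq_iff_diff_eq_0 inner_diff_right inner_eq_zero_iff)
    with exp_sums.single[of 1 "x - y"] show "\<exists>f\<in>exp_sums. f x \<noteq> f y"
      by (intro bexI[of _ "\<lambda>z. 1 * exp ((x - y) \<bullet> z)"]) auto
  qed (auto intro: exp_sums.add exp_sums_mult)
  show ?thesis by (rule Stone_Weierstrass_basic[OF assms])
qed

section \<open>Mean-square approximation under the law of X\<close>

lemma sum_square_le: "(a + b)\<^sup>2 \<le> 2 * (a\<^sup>2 + b\<^sup>2)" for a b :: real
proof -
  have "0 \<le> (a - b)\<^sup>2" by simp
  then show ?thesis by (simp add: power2_eq_square algebra_simps)
qed

locale cube_law = prob_space \<mu> for \<mu> :: "(real ^ 'p::finite) measure" +
  assumes sets_law [measurable_cong, simp]: "sets \<mu> = sets borel"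
    and AE_cube: "AE x in \<mu>. x \<in> unit_cube"
begin

definition l2_dist :: "(real ^ 'p \<Rightarrow> real) \<Rightarrow> (real ^ 'p \<Rightarrow> real) \<Rightarrow> ennreal" where
  "l2_dist f g = (\<integral>\<^sup>+x. ennreal ((f x - g x)\<^sup>2) \<partial>\<mu>)"

text \<open>The mass \<open>v\<close> is free to grow as \<open>e\<close> shrinks. Since
  \<open>g\<close> is fixed before the sample size grows, this does not hurt in the limit.\<close>

definition approximable :: "(real ^ 'p \<Rightarrow> real) \<Rightarrow> bool" where
  "approximable f \<longleftrightarrow> (\<forall>e>0. \<exists>v g. ridge_step v g \<and> l2_dist f g < ennreal e)"

lemma space_law [simp]: "space \<mu> = UNIV"
  using sets_eq_imp_space_eq[OF sets_law] by simp

lemma emeasure_UNIV_law [simp]: "emeasure \<mu> UNIV = 1"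
  using emeasure_space_1 by simp

lemma measurable_law [simp]: "borel_measurable \<mu> = borel_measurable borel"
  by (rule measurable_cong_sets) simp_all

lemma approximableD:
  assumes "approximable f" "e > 0"
  obtains v g where "ridge_step v g" "g \<in> borel_measurable borel" "l2_dist f g < ennreal e"
  using assms ridge_step_measurable unfolding approximable_def by blast

lemma approximable_ridge_step: "ridge_step v g \<Longrightarrow> approximable g"
  unfolding approximable_def l2_dist_def by (intro allI impI exI[of _ v] exI[of _ g]) simp

text \<open>\<open>l2_dist\<close> is a squared distance, so
  \<open>(a + b)^2 \<le> 2 * (a^2 + b^2)\<close> replaces the triangle inequality and
  \<open>e / 4\<close> is the share of each part. The identity for differences covers sums of
  approximations as well as passing through an intermediate function.\<close>

lemma l2_dist_le_sum:
  assumes [measurable]: "f1 \<in> borel_measurable borel" "f2 \<in> borel_measurable borel"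
      "g1 \<in> borel_measurable borel" "g2 \<in> borel_measurable borel"
    and eq: "\<And>x. f x - g x = (f1 x - g1 x) + (f2 x - g2 x)"
    and e: "l2_dist f1 g1 < ennreal (e / 4)" "l2_dist f2 g2 < ennreal (e / 4)" and "e > 0"
  shows "l2_dist f g < ennreal e"
proof -
  have "l2_dist f g \<le> (\<integral>\<^sup>+x. 2 * (ennreal ((f1 x - g1 x)\<^sup>2) + ennreal ((f2 x - g2 x)\<^sup>2)) \<partial>\<mu>)"
    unfolding l2_dist_def
  proof (rule nn_integral_mono)
    fix x
    have "ennreal ((f x - g x)\<^sup>2) \<le> ennreal (2 * ((f1 x - g1 x)\<^sup>2 + (f2 x - g2 x)\<^sup>2))"
      unfolding eq by (intro ennreal_leI sum_square_le)
    then show "ennreal ((f x - g x)\<^sup>2) \<le> 2 * (ennreal ((f1 x - g1 x)\<^sup>2) + ennreal ((f2 x - g2 x)\<^sup>2))"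
      by (simp add: distrib_left ennreal_mult')
  qed
  also have "\<dots> = 2 * (l2_dist f1 g1 + l2_dist f2 g2)"
    unfolding l2_dist_def by (simp add: nn_integral_cmult nn_integral_add)
  also have "\<dots> < 2 * (ennreal (e / 4) + ennreal (e / 4))"
    using e by (intro ennreal_mult_strict_left_mono add_strict_mono) auto
  also have "\<dots> = ennreal (2 * (e / 4 + e / 4))"
    using \<open>e > 0\<close> by (subst ennreal_mult') (simp_all add: ennreal_plus[symmetric] del: ennreal_plus)
  finally show ?thesis by simp
qed

lemma approximable_add:
  assumes "approximable f" "approximable h"
    and [measurable]: "f \<in> borel_measurable borel" "h \<in> borel_measurable borel"
  shows "approximable (\<lambda>x. f x + h x)"
  unfolding approximable_def
proof (intro allI impI)
  fix e :: real assume "e > 0"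
  then have "e / 4 > 0" by simp
  obtain v g where g: "ridge_step v g" "g \<in> borel_measurable borel" "l2_dist f g < ennreal (e / 4)"
    using approximableD[OF assms(1) \<open>e / 4 > 0\<close>] .
  obtain w k where k: "ridge_step w k" "k \<in> borel_measurable borel" "l2_dist h k < ennreal (e / 4)"
    using approximableD[OF assms(2) \<open>e / 4 > 0\<close>] .
  have "l2_dist (\<lambda>x. f x + h x) (\<lambda>x. g x + k x) < ennreal e"
    by (rule l2_dist_le_sum[OF assms(3,4) g(2) k(2) _ g(3) k(3) \<open>e > 0\<close>]) simp
  with ridge_step_add[OF g(1) k(1)]
  show "\<exists>v g. ridge_step v g \<and> l2_dist (\<lambda>x. f x + h x) g < ennreal e" by blast
qed

lemma approximable_limit:
  assumes [measurable]: "f \<in> borel_measurable borel"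
    and lim: "\<And>e. e > 0 \<Longrightarrow> \<exists>h. h \<in> borel_measurable borel \<and> approximable h \<and> l2_dist f h < ennreal e"
  shows "approximable f"
  unfolding approximable_def
proof (intro allI impI)
  fix e :: real assume "e > 0"
  then have "e / 4 > 0" by simp
  obtain h where h: "h \<in> borel_measurable borel" "approximable h" "l2_dist f h < ennreal (e / 4)"
    using lim[OF \<open>e / 4 > 0\<close>] by blast
  obtain v g where g: "ridge_step v g" "g \<in> borel_measurable borel" "l2_dist h g < ennreal (e / 4)"
    using approximableD[OF h(2) \<open>e / 4 > 0\<close>] .
  have "l2_dist f g < ennreal e"
    by (rule l2_dist_le_sum[OF assms(1) h(1) h(1) g(2) _ h(3) g(3) \<open>e > 0\<close>]) simp
  with g(1) show "\<exists>v g. ridge_step v g \<and> l2_dist f g < ennreal e" by blast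
qed

lemma approximable_cmult:
  assumes "approximable f" and [measurable]: "f \<in> borel_measurable borel"
  shows "approximable (\<lambda>x. c * f x)"
  unfolding approximable_def
proof (intro allI impI)
  fix e :: real assume "e > 0"
  \<comment> \<open>The summand 1 covers the case \<open>c = 0\<close>.\<close>
  then have pos: "e / (c\<^sup>2 + 1) > 0" by (simp add: add_nonneg_pos)
  obtain v g where g: "ridge_step v g" and [measurable]: "g \<in> borel_measurable borel"
    and le: "l2_dist f g < ennreal (e / (c\<^sup>2 + 1))"
    using approximableD[OF assms(1) pos] .
  have "l2_dist (\<lambda>x. c * f x) (\<lambda>x. c * g x) = (\<integral>\<^sup>+x. ennreal (c\<^sup>2) * ennreal ((f x - g x)\<^sup>2) \<partial>\<mu>)"
    unfolding l2_dist_def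
    by (intro nn_integral_cong) (simp add: ennreal_mult'[symmetric] power_mult_distrib[symmetric] algebra_simps)
  also have "\<dots> = ennreal (c\<^sup>2) * l2_dist f g"
    unfolding l2_dist_def by (simp add: nn_integral_cmult)
  also have "\<dots> \<le> ennreal (c\<^sup>2) * ennreal (e / (c\<^sup>2 + 1))"
    using le by (intro mult_left_mono) auto
  also have "\<dots> = ennreal (c\<^sup>2 * (e / (c\<^sup>2 + 1)))"
    by (rule ennreal_mult[symmetric]) (use pos in auto)
  also have "\<dots> < ennreal e"
  proof -
    have "0 < c\<^sup>2 + 1" by (simp add: add_nonneg_pos)
    then have "c\<^sup>2 * (e / (c\<^sup>2 + 1)) < e"
      using \<open>e > 0\<close> by (simp add: field_simps)
    then show ?thesis using \<open>e > 0\<close> by (simp add: ennreal_less_iff)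
  qed
  finally show "\<exists>v g. ridge_step v g \<and> l2_dist (\<lambda>x. c * f x) g < ennreal e"
    using ridge_step_scale[OF g] by blast
qed

lemma approximable_const: "approximable (\<lambda>_. c)"
  by (rule approximable_ridge_step[OF ridge_step.const])

lemma approximable_empty: "approximable (indicator {})"
proof -
  have "indicator {} = (\<lambda>_ :: real ^ 'p. 0 :: real)" by auto
  then show ?thesis using approximable_const[of 0] by simp
qed

lemma approximable_sum:
  assumes "finite I" "\<And>i. i \<in> I \<Longrightarrow> approximable (f i)" "\<And>i. i \<in> I \<Longrightarrow> f i \<in> borel_measurable borel"
  shows "approximable (\<lambda>x. \<Sum>i\<in>I. f i x)"
  using assms
proof (induction I rule: finite_induct)
  case (insert i I)
  have "approximable (\<lambda>x. f i x + (\<Sum>i\<in>I. f i x))"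
    using insert by (intro approximable_add borel_measurable_sum) auto
  with insert.hyps show ?case by simp
qed (simp add: approximable_const)

lemma approximable_dominated:
  assumes [measurable]: "f \<in> borel_measurable borel" "w \<in> borel_measurable borel"
    "\<And>k. h k \<in> borel_measurable borel"
    and h: "\<And>k. approximable (h k)"
    and lim: "\<And>x. (\<lambda>k. h k x) \<longlonglongrightarrow> f x"
    and bound: "\<And>k x. (f x - h k x)\<^sup>2 \<le> w x"
    and w: "(\<integral>\<^sup>+x. ennreal (w x) \<partial>\<mu>) < \<infinity>"
  shows "approximable f"
proof (rule approximable_limit)
  fix e :: real assume "e > 0"
  have "(\<lambda>k. \<integral>\<^sup>+x. ennreal ((f x - h k x)\<^sup>2) \<partial>\<mu>) \<longlonglongrightarrow> (\<integral>\<^sup>+x. ennreal 0 \<partial>\<mu>)"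
  proof (rule nn_integral_dominated_convergence[where w = "\<lambda>x. ennreal (w x)"])
    show "AE x in \<mu>. (\<lambda>k. ennreal ((f x - h k x)\<^sup>2)) \<longlonglongrightarrow> ennreal 0"
    proof (intro AE_I2 tendsto_ennrealI)
      fix x
      have "(\<lambda>k. (f x - h k x)\<^sup>2) \<longlonglongrightarrow> (f x - f x)\<^sup>2"
        by (intro tendsto_intros lim)
      then show "(\<lambda>k. (f x - h k x)\<^sup>2) \<longlonglongrightarrow> 0" by simp
    qed
  qed (use bound w in \<open>auto intro: ennreal_leI\<close>)
  then have "(\<lambda>k. l2_dist f (h k)) \<longlonglongrightarrow> 0" by (simp add: l2_dist_def)
  then have "\<forall>\<^sub>F k in sequentially. l2_dist f (h k) < ennreal e"
    using \<open>e > 0\<close> by (intro order_tendstoD) auto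
  then obtain k where "l2_dist f (h k) < ennreal e"
    by (auto simp: eventually_sequentially)
  with h show "\<exists>h. h \<in> borel_measurable borel \<and> approximable h \<and> l2_dist f h < ennreal e"
    by (intro exI[of _ "h k"]) auto
qed simp

text \<open>A Dynkin class argument: approximable functions are closed under linear combinations and
  dominated limits but not visibly under products, so complements and disjoint unions have to do.
  The map \<open>T\<close> lets it serve both projections with half-lines and the identity with
  closed sets.\<close>

lemma approximable_indicator_vimage:
  fixes T :: "real ^ 'p \<Rightarrow> 'b::topological_space"
  assumes T [measurable]: "T \<in> borel_measurable borel"
    and borel: "(borel :: 'b measure) = sigma UNIV G" and "Int_stable G"
    and G: "\<And>B. B \<in> G \<Longrightarrow> approximable (indicator (T -` B))"
    and B: "B \<in> sets borel"
  shows "approximable (indicator (T -` B))"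
proof -
  have vimage: "indicator (T -` A) \<in> borel_measurable borel" if "A \<in> sets borel" for A
    using measurable_sets[OF T that] by (intro borel_measurable_indicator) simp
  have sig: "sigma_sets UNIV G = sets borel" unfolding borel by simp
  have "G \<subseteq> Pow UNIV" "B \<in> sigma_sets UNIV G" using B sig by auto
  with \<open>Int_stable G\<close> show ?thesis
  proof (induction rule: sigma_sets_induct_disjoint[consumes 3])
    case (basic A)
    then show ?case by (rule G)
  next
    case empty
    show ?case using approximable_const[of 0] by simp
  next
    case (compl A)
    have "approximable (\<lambda>x. 1 + (- 1) * indicator (T -` A) x :: real)"
      using compl vimage[of A] sig
      by (intro approximable_add approximable_const approximable_cmult) auto
    also have "(\<lambda>x. 1 + (- 1) * indicator (T -` A) x :: real) = indicator (T -` (UNIV - A))"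
      by (auto simp: indicator_def fun_eq_iff)
    finally show ?case .
  next
    case (union A)
    have A: "A i \<in> sets borel" for i using union sig by auto
    have approx: "approximable (indicator (\<Union>i<k. T -` A i))" for k
    proof -
      have "approximable (\<lambda>x. \<Sum>i<k. indicator (T -` A i) x)"
        using union A by (intro approximable_sum vimage) auto
      also have "(\<lambda>x. \<Sum>i<k. indicator (T -` A i) x) = (indicator (\<Union>i<k. T -` A i) :: _ \<Rightarrow> real)"
        using union(1) by (intro ext indicator_UN_disjoint[symmetric]) (auto simp: disjoint_family_on_def)
      finally show ?thesis .
    qed
    have "approximable (indicator (\<Union>i. T -` A i))"
    proof (rule approximable_dominated[where w = "\<lambda>_. 1" and h = "\<lambda>k. indicator (\<Union>i<k. T -` A i)"])
      show "indicator (\<Union>i<k. T -` A i) \<in> borel_measurable borel" for k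
        using measurable_sets[OF T A] by (intro borel_measurable_indicator sets.finite_UN) auto
      show "indicator (\<Union>i. T -` A i) \<in> borel_measurable borel"
        using measurable_sets[OF T A] by (intro borel_measurable_indicator sets.countable_UN) auto
      show "(indicator (\<Union>i. T -` A i) x - indicator (\<Union>i<k. T -` A i) x)\<^sup>2 \<le> (1 :: real)" for k x
        unfolding indicator_def by simp
    qed (simp_all add: approx LIMSEQ_indicator_UN)
    then show ?case by (simp add: vimage_UN)
  qed
qed

lemma approximable_comp:
  fixes T :: "real ^ 'p \<Rightarrow> 'b::topological_space" and u :: "'b \<Rightarrow> real"
  assumes T [measurable]: "T \<in> borel_measurable borel"
    and ind: "\<And>B. B \<in> sets borel \<Longrightarrow> approximable (indicator (T -` B))"
    and u [measurable]: "u \<in> borel_measurable borel"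
    and fin: "(\<integral>\<^sup>+x. ennreal ((u (T x))\<^sup>2) \<partial>\<mu>) < \<infinity>"
  shows "approximable (\<lambda>x. u (T x))"
proof -
  obtain F where F: "\<And>i. simple_function borel (F i)"
    and lim: "\<And>x. (\<lambda>i. F i x) \<longlonglongrightarrow> u x"
    and bound: "\<And>i x. dist (F i x) 0 \<le> 2 * dist (u x) 0"
    using borel_measurable_implies_sequence_metric[OF u, of 0] by auto
  have approx: "approximable (\<lambda>x. F i (T x))" for i
  proof -
    have "approximable (\<lambda>x. \<Sum>y\<in>F i ` UNIV. y * indicator (T -` (F i -` {y})) x)"
    proof (intro approximable_sum approximable_cmult ind borel_measurable_times borel_measurable_const)
      show "finite (range (F i))" using simple_functionD(1)[OF F[of i]] by simp
      fix y assume "y \<in> range (F i)"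
      show S: "F i -` {y} \<in> sets borel"
        using simple_functionD(2)[OF F[of i], of "{y}"] by simp
      show "indicator (T -` F i -` {y}) \<in> borel_measurable borel"
        using measurable_sets[OF T S] by (intro borel_measurable_indicator) simp
      then show "indicator (T -` F i -` {y}) \<in> borel_measurable borel" .
    qed
    also have "(\<lambda>x. \<Sum>y\<in>F i ` UNIV. y * indicator (T -` (F i -` {y})) x) = (\<lambda>x. F i (T x))"
    proof
      fix x
      have "(\<Sum>y\<in>F i ` UNIV. y * indicator (T -` (F i -` {y})) x)
          = (\<Sum>y\<in>F i ` UNIV. if F i (T x) = y then y else 0)"
        by (intro sum.cong) auto
      then show "(\<Sum>y\<in>F i ` UNIV. y * indicator (T -` (F i -` {y})) x) = F i (T x)"
        using simple_functionD(1)[OF F[of i]] by simp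
    qed
    finally show ?thesis .
  qed
  have [measurable]: "F i \<in> borel_measurable borel" for i
    using F by (rule borel_measurable_simple_function)
  show ?thesis
  \<comment> \<open>The simple functions are bounded by \<open>2 * \<bar>u\<bar>\<close>, so the
    error is at most \<open>3 * \<bar>u\<bar>\<close>; squaring gives 9.\<close>
  proof (rule approximable_dominated[where w = "\<lambda>x. 9 * (u (T x))\<^sup>2"])
    fix i x
    have "\<bar>u (T x) - F i (T x)\<bar> \<le> \<bar>3 * u (T x)\<bar>"
      using bound[of i "T x"] by (simp add: dist_real_def)
    then have "(u (T x) - F i (T x))\<^sup>2 \<le> (3 * u (T x))\<^sup>2"
      by (simp only: abs_le_square_iff)
    then show "(u (T x) - F i (T x))\<^sup>2 \<le> 9 * (u (T x))\<^sup>2"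
      by (simp add: power_mult_distrib)
  next
    have "(\<integral>\<^sup>+x. ennreal (9 * (u (T x))\<^sup>2) \<partial>\<mu>) = 9 * (\<integral>\<^sup>+x. ennreal ((u (T x))\<^sup>2) \<partial>\<mu>)"
      by (simp add: ennreal_mult' nn_integral_cmult)
    also have "\<dots> < \<infinity>" using fin by (simp add: ennreal_mult_less_top)
    finally show "(\<integral>\<^sup>+x. ennreal (9 * (u (T x))\<^sup>2) \<partial>\<mu>) < \<infinity>" .
    show "(\<lambda>x. F i (T x)) \<in> borel_measurable borel" for i by measurable
  qed (use approx lim in simp_all)
qed

section \<open>From halfspaces to all square-integrable functions\<close>

lemma continuous_square_integrable:
  assumes "continuous_on UNIV f"
  shows "(\<integral>\<^sup>+x. ennreal ((f x :: real)\<^sup>2) \<partial>\<mu>) < \<infinity>"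
proof -
  have "compact (f ` unit_cube)"
    using assms by (intro compact_continuous_image compact_cbox) (auto intro: continuous_on_subset)
  then obtain B where B: "\<And>x. x \<in> unit_cube \<Longrightarrow> \<bar>f x\<bar> \<le> B"
    by (force dest!: compact_imp_bounded simp: bounded_iff)
  have "(\<integral>\<^sup>+x. ennreal ((f x)\<^sup>2) \<partial>\<mu>) \<le> (\<integral>\<^sup>+x. ennreal (B\<^sup>2) \<partial>\<mu>)"
  proof (rule nn_integral_mono_AE)
    show "AE x in \<mu>. ennreal ((f x)\<^sup>2) \<le> ennreal (B\<^sup>2)"
      using AE_cube
    proof eventually_elim
      case (elim x)
      then show ?case using power_mono[OF B[OF elim], of 2] by (intro ennreal_leI) simp
    qed
  qed
  also have "\<dots> < \<infinity>" by simp
  finally show ?thesis .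
qed

lemma approximable_halfspace:
  assumes "norm \<theta> = 1"
  shows "approximable (indicator {x. \<theta> \<bullet> x \<le> s})"
proof -
  have "ridge_step (0 + \<bar>1\<bar>) (\<lambda>x. 0 + (if \<theta> \<bullet> x \<le> s then 1 else 0 :: real))"
    by (intro ridge_step.step ridge_step.const assms)
  then have "approximable (\<lambda>x. 0 + (if \<theta> \<bullet> x \<le> s then 1 else 0))"
    by (rule approximable_ridge_step)
  also have "(\<lambda>x. 0 + (if \<theta> \<bullet> x \<le> s then 1 else 0 :: real)) = indicator {x. \<theta> \<bullet> x \<le> s}"
    by (auto simp: indicator_def fun_eq_iff)
  finally show ?thesis .
qed

text \<open>Preimages of half-lines under one projection are halfspaces, and half-lines generate the
  Borel sets of the line, so every square-integrable function of a single projection is in reach.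
  The vector 0 has no direction and yields a constant.\<close>

lemma approximable_exp: "approximable (\<lambda>x. exp (a \<bullet> x))"
proof (cases "a = 0")
  case True
  then show ?thesis using approximable_const[of 1] by simp
next
  case False
  define \<theta> where "\<theta> = a /\<^sub>R norm a"
  have \<theta>: "norm \<theta> = 1" using False by (simp add: \<theta>_def)
  have a: "a \<bullet> x = norm a * (\<theta> \<bullet> x)" for x using False by (simp add: \<theta>_def)
  have "approximable (\<lambda>x. exp (norm a * (\<theta> \<bullet> x)))"
  proof (rule approximable_comp[where T = "\<lambda>x. \<theta> \<bullet> x" and u = "\<lambda>r. exp (norm a * r)"])
    fix B :: "real set" assume "B \<in> sets borel"
    show "approximable (indicator ((\<lambda>x. \<theta> \<bullet> x) -` B))"
    proof (rule approximable_indicator_vimage[OF _ borel_eq_atMost _ _ \<open>B \<in> sets borel\<close>])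
      show "Int_stable (range (\<lambda>a::real. {..a}))" by (auto simp: Int_stable_def)
      fix C :: "real set" assume "C \<in> range (\<lambda>a. {..a})"
      then obtain s where C: "C = {..s}" by auto
      have "(\<lambda>x. \<theta> \<bullet> x) -` C = {x. \<theta> \<bullet> x \<le> s}" by (auto simp: C)
      then show "approximable (indicator ((\<lambda>x. \<theta> \<bullet> x) -` C))"
        using approximable_halfspace[OF \<theta>] by simp
    qed simp
  next
    show "(\<integral>\<^sup>+x. ennreal ((exp (norm a * (\<theta> \<bullet> x)))\<^sup>2) \<partial>\<mu>) < \<infinity>"
      by (intro continuous_square_integrable continuous_intros)
  qed simp_all
  then show ?thesis by (simp add: a)
qed

lemma exp_sums_approximable: "f \<in> exp_sums \<Longrightarrow> f \<in> borel_measurable borel \<and> approximable f"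
proof (induction rule: exp_sums.induct)
  case (single c a)
  show ?case by (intro conjI approximable_cmult approximable_exp) simp_all
next
  case (add f g)
  then show ?case by (intro conjI approximable_add borel_measurable_add) simp_all
qed

lemma approximable_continuous:
  assumes "continuous_on UNIV f"
  shows "approximable f"
proof (rule approximable_limit)
  show "f \<in> borel_measurable borel" using assms by (rule borel_measurable_continuous_onI)
  fix e :: real assume "e > 0"
  then have "sqrt (e / 2) > 0" by simp
  obtain g where g: "g \<in> exp_sums" "\<forall>x\<in>unit_cube. \<bar>f x - g x\<bar> < sqrt (e / 2)"
    using exp_sums_dense[OF continuous_on_subset[OF assms subset_UNIV] \<open>sqrt (e / 2) > 0\<close>] by blast
  have "l2_dist f g \<le> (\<integral>\<^sup>+x. ennreal (e / 2) \<partial>\<mu>)"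
    unfolding l2_dist_def
  proof (rule nn_integral_mono_AE)
    show "AE x in \<mu>. ennreal ((f x - g x)\<^sup>2) \<le> ennreal (e / 2)"
      using AE_cube
    proof eventually_elim
      case (elim x)
      then have "\<bar>f x - g x\<bar> \<le> sqrt (e / 2)" using g(2) by force
      then have "\<bar>f x - g x\<bar>\<^sup>2 \<le> (sqrt (e / 2))\<^sup>2" by (intro power_mono) auto
      then show ?case using \<open>e > 0\<close> by (intro ennreal_leI) simp
    qed
  qed
  also have "\<dots> < ennreal e"
    using \<open>e > 0\<close> by (simp add: ennreal_less_iff)
  finally show "\<exists>h. h \<in> borel_measurable borel \<and> approximable h \<and> l2_dist f h < ennreal e"
    using exp_sums_approximable[OF g(1)] by blast
qed

text \<open>The continuous functions \<open>max 0 (1 - k * infdist x C)\<close> decrease to the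
  indicator as \<open>k\<close> grows. The empty set stands apart because
  \<open>infdist x {} = 0\<close> would turn the limit into 1.\<close>

lemma approximable_closed:
  assumes "closed C"
  shows "approximable (indicator C)"
proof (cases "C = {}")
  case True
  then show ?thesis by (simp add: approximable_empty)
next
  case False
  let ?h = "\<lambda>k x. max 0 (1 - real k * infdist x C)"
  have cont: "continuous_on UNIV (?h k)" for k
    by (intro continuous_intros)
  show ?thesis
  proof (rule approximable_dominated[where h = ?h and w = "\<lambda>_. 1"])
    fix x
    show "(\<lambda>k. ?h k x) \<longlonglongrightarrow> indicator C x"
    proof (cases "x \<in> C")
      case True
      then show ?thesis by (simp add: infdist_zero)
    next
      case False
      then have pos: "infdist x C > 0"
        using \<open>C \<noteq> {}\<close> \<open>closed C\<close> by (metis in_closed_iff_infdist_zero infdist_nonneg less_le)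
      obtain k0 where k0: "1 < real k0 * infdist x C"
        using reals_Archimedean3[OF pos] by blast
      have "?h k x = 0" if "k \<ge> k0" for k
      proof -
        have "real k0 * infdist x C \<le> real k * infdist x C"
          using that pos by (intro mult_right_mono) auto
        with k0 show ?thesis by simp
      qed
      then have "\<forall>\<^sub>F k in sequentially. ?h k x = 0"
        by (auto simp: eventually_sequentially)
      then show ?thesis using False by (auto intro: tendsto_eventually)
    qed
    fix k
    have "0 \<le> ?h k x" "?h k x \<le> 1" by (auto simp: infdist_nonneg)
    then have "\<bar>indicator C x - ?h k x\<bar> \<le> 1" by (auto simp: indicator_def)
    then show "(indicator C x - ?h k x)\<^sup>2 \<le> 1" by (simp add: abs_square_le_1)
  qed (use assms cont in \<open>auto intro: approximable_continuous borel_measurable_continuous_onI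
      borel_measurable_indicator\<close>)
qed

theorem square_integrable_approximable:
  assumes "m \<in> borel_measurable borel" "(\<integral>\<^sup>+x. ennreal ((m x)\<^sup>2) \<partial>\<mu>) < \<infinity>"
  shows "approximable m"
proof -
  have "approximable (indicator ((\<lambda>x. x) -` B))" if "B \<in> sets borel" for B
    by (rule approximable_indicator_vimage[OF _ borel_eq_closed _ _ that])
       (auto simp: Int_stable_def intro: approximable_closed)
  from approximable_comp[OF _ this assms] show ?thesis by simp
qed

end

section \<open>Symmetrization\<close>

text \<open>\<open>odt_estimator\<close> speaks about samples that are undefined outside
  \<open>{..<n}\<close>, hence the restriction; \<open>z\<close> itself may be longer, such as a
  sample followed by its copy.\<close>

lemma odt_estimator_cell:
  assumes est: "odt_estimator n t mh" and z: "\<And>i. i < n \<Longrightarrow> fst (z i) \<in> unit_cube"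
  obtains L where "odt_leaves n (restrict z {..<n}) t L" "split_partition L" "size L = t"
    "\<And>x. x \<in> unit_cube \<Longrightarrow> mh (restrict z {..<n}) x = leaf_estimate n (restrict z {..<n}) L x"
    "\<And>x. x \<in> unit_cube \<Longrightarrow> mh (restrict z {..<n}) x = node_mean n (restrict z {..<n}) (cell_of L x)"
proof -
  let ?d = "restrict z {..<n}"
  have "?d \<in> {..<n} \<rightarrow>\<^sub>E unit_cube \<times> UNIV"
    using z by (auto simp: mem_Times_iff)
  with est obtain L where L: "odt_leaves n ?d t L" "\<forall>x\<in>unit_cube. mh ?d x = leaf_estimate n ?d L x"
    unfolding odt_estimator_def by blast
  from L(1) obtain C D where "odt_state n ?d t C D" "L = C + D" "size L = t"
    unfolding odt_leaves_def by blast
  with odt_state_split_partition have sp: "split_partition L" "size L = t" by blast+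
  show ?thesis
    by (rule that[OF L(1) sp]) (use L(2) leaf_estimate_cell[OF sp(1)] in auto)
qed

section \<open>Exchanging observations with their copies\<close>

definition swap_halves :: "nat \<Rightarrow> nat set \<Rightarrow> nat \<Rightarrow> nat" where
  "swap_halves n S j = (if j < n then (if j \<in> S then n + j else j) else (if j - n \<in> S then j - n else j))"

lemma swap_halves_less: "S \<subseteq> {..<n} \<Longrightarrow> j < 2 * n \<Longrightarrow> swap_halves n S j < 2 * n"
  by (auto simp: swap_halves_def)

lemma swap_halves_involution: "S \<subseteq> {..<n} \<Longrightarrow> swap_halves n S (swap_halves n S j) = j"
  by (auto simp: swap_halves_def)

lemma inj_on_swap_halves: "S \<subseteq> {..<n} \<Longrightarrow> inj_on (swap_halves n S) A"
  by (metis inj_onI swap_halves_involution)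

lemma square_diff_le: "(a - b)\<^sup>2 \<le> 4 * B" if "a\<^sup>2 \<le> B" "b\<^sup>2 \<le> B" for a b B :: real
proof -
  have "0 \<le> (a + b)\<^sup>2" by simp
  with that show ?thesis by (simp add: power2_eq_square algebra_simps)
qed

section \<open>Law of the sample and size of the responses\<close>

locale sample_law = prob_space \<nu> for \<nu> :: "((real ^ 'p::finite) \<times> real) measure" +
  fixes c :: real
  assumes sets_law [measurable_cong, simp]: "sets \<nu> = sets borel"
    and AE_cube: "AE w in \<nu>. fst w \<in> unit_cube"
    and c_pos: "c > 0" and exp_integrable: "integrable \<nu> (\<lambda>w. exp (c * (snd w)\<^sup>2))"
begin

abbreviation sample :: "nat \<Rightarrow> (nat \<Rightarrow> (real ^ 'p) \<times> real) measure" where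
  "sample n \<equiv> \<Pi>\<^sub>M i\<in>{..<n}. \<nu>"

abbreviation exp_moment :: real where
  "exp_moment \<equiv> \<integral>w. exp (c * (snd w)\<^sup>2) \<partial>\<nu>"

lemma space_law [simp]: "space \<nu> = UNIV"
  using sets_eq_imp_space_eq[OF sets_law] by simp

lemma fst_snd_measurable [measurable]:
  "fst \<in> borel_measurable \<nu>" "snd \<in> borel_measurable \<nu>"
  unfolding measurable_cong_sets[OF sets_law refl]
  by (intro borel_measurable_continuous_onI continuous_on_fst continuous_on_snd continuous_on_id)+

text \<open>An upper bound for the largest squared response whose expectation is of order \<open>ln n\<close>.\<close>

definition envelope :: "nat \<Rightarrow> (nat \<Rightarrow> (real ^ 'p) \<times> real) \<Rightarrow> real" where
  "envelope n z = (ln (real n) + (\<Sum>j<n. exp (c * (snd (z j))\<^sup>2)) / real n) / c"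

text \<open>From \<open>1 + x \<le> exp x\<close> at \<open>x = a - ln n\<close> follows
  \<open>a \<le> ln n + exp a / n\<close>, and a single positive term is at most the whole sum.
  Centring at \<open>ln n\<close> keeps the expectation logarithmic.\<close>

lemma envelope_ge:
  assumes "j < n"
  shows "(snd (z j))\<^sup>2 \<le> envelope n z"
proof -
  let ?a = "c * (snd (z j))\<^sup>2"
  have n: "real n > 0" using assms by simp
  have "1 + (?a - ln (real n)) \<le> exp (?a - ln (real n))" by (rule exp_ge_add_one_self)
  also have "\<dots> = exp ?a / real n" using n by (simp add: exp_diff)
  also have "\<dots> \<le> (\<Sum>j<n. exp (c * (snd (z j))\<^sup>2)) / real n"
    using assms by (intro divide_right_mono member_le_sum) auto
  finally have "(snd (z j))\<^sup>2 * c \<le> ln (real n) + (\<Sum>j<n. exp (c * (snd (z j))\<^sup>2)) / real n"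
    by (simp add: mult.commute)
  then show ?thesis using c_pos by (simp add: envelope_def pos_le_divide_eq)
qed

lemma envelope_pos:
  assumes "n > 0"
  shows "envelope n z > 0"
proof -
  have "0 < (\<Sum>j<n. exp (c * (snd (z j))\<^sup>2)) / real n"
    using assms by (intro divide_pos_pos sum_pos) auto
  moreover have "0 \<le> ln (real n)" using assms by simp
  ultimately show ?thesis using c_pos unfolding envelope_def by (intro divide_pos_pos) auto
qed

lemma component_measurable: "j < n \<Longrightarrow> (\<lambda>z. z j) \<in> measurable (sample n) \<nu>"
  by (rule measurable_component_singleton) simp

lemma distr_component: "j < n \<Longrightarrow> distr (sample n) \<nu> (\<lambda>z. z j) = \<nu>"
  using distr_PiM_component[of "{..<n}" "\<lambda>_. \<nu>" j] prob_space_axioms by simp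

lemma integral_component:
  fixes h :: "(real ^ 'p) \<times> real \<Rightarrow> real"
  assumes "j < n" "integrable \<nu> h"
  shows "integrable (sample n) (\<lambda>z. h (z j))" "(\<integral>z. h (z j) \<partial>sample n) = (\<integral>w. h w \<partial>\<nu>)"
proof -
  have h: "h \<in> borel_measurable \<nu>" using assms by simp
  show "integrable (sample n) (\<lambda>z. h (z j))"
    using integrable_distr_eq[OF component_measurable[OF assms(1)] h] assms by (simp add: distr_component)
  show "(\<integral>z. h (z j) \<partial>sample n) = (\<integral>w. h w \<partial>\<nu>)"
    using integral_distr[OF component_measurable[OF assms(1)] h] assms by (simp add: distr_component)
qed

lemma prob_space_sample: "prob_space (sample n)"
  using prob_space_axioms by (intro prob_space_PiM) simp

lemma envelope_integral:
  assumes "n > 0"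
  shows "integrable (sample n) (envelope n)"
    and "(\<integral>z. envelope n z \<partial>sample n) = (ln (real n) + exp_moment) / c"
proof -
  interpret P: prob_space "sample n" by (rule prob_space_sample)
  have int: "integrable (sample n) (\<lambda>z. exp (c * (snd (z j))\<^sup>2))" if "j < n" for j
    by (rule integral_component[OF that exp_integrable])
  show "integrable (sample n) (envelope n)"
    unfolding envelope_def
    by (intro integrable_divide Bochner_Integration.integrable_add Bochner_Integration.integrable_sum int) auto
  have "(\<integral>z. envelope n z \<partial>sample n)
      = (ln (real n) + (\<Sum>j<n. \<integral>z. exp (c * (snd (z j))\<^sup>2) \<partial>sample n) / real n) / c"
  proof -
    have "integrable (sample n) (\<lambda>z. \<Sum>j<n. exp (c * (snd (z j))\<^sup>2))"
      by (intro Bochner_Integration.integrable_sum int) auto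
    then show ?thesis
      unfolding envelope_def by (simp add: int P.prob_space)
  qed
  also have "(\<Sum>j<n. \<integral>z. exp (c * (snd (z j))\<^sup>2) \<partial>sample n) = real n * exp_moment"
    using integral_component(2)[OF _ exp_integrable] by simp
  finally show "(\<integral>z. envelope n z \<partial>sample n) = (ln (real n) + exp_moment) / c"
    using assms by simp
qed

lemma AE_sample_cube: "AE z in sample n. \<forall>j<n. fst (z j) \<in> unit_cube"
proof -
  have "AE z in sample n. \<forall>j\<in>{..<n}. fst (z j) \<in> unit_cube"
    using prob_space_axioms AE_cube
    by (intro eventually_ball_finite ballI AE_PiM_component[where P = "\<lambda>w. fst w \<in> unit_cube"]) auto
  then show ?thesis unfolding Ball_def lessThan_iff .
qed

lemma sets_sample: "sets (sample n) = sets (\<Pi>\<^sub>M i\<in>{..<n}. borel)"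
  by (rule sets_PiM_cong) simp_all

lemma estimator_measurable:
  assumes est: "odt_estimator n t mh"
    and d: "d \<in> measurable N (sample n)" and x: "x \<in> borel_measurable N"
  shows "(\<lambda>\<omega>. mh (d \<omega>) (x \<omega>)) \<in> borel_measurable N"
proof -
  have "d \<in> measurable N (\<Pi>\<^sub>M i\<in>{..<n}. borel)"
    using d measurable_cong_sets[OF refl sets_sample] by blast
  then have dx: "(\<lambda>\<omega>. (d \<omega>, x \<omega>)) \<in> measurable N ((\<Pi>\<^sub>M i\<in>{..<n}. borel) \<Otimes>\<^sub>M borel)"
    using x by (rule measurable_Pair)
  have "(\<lambda>(d, x). mh d x) \<in> borel_measurable ((\<Pi>\<^sub>M i\<in>{..<n}. borel) \<Otimes>\<^sub>M borel)"
    using est by (simp add: odt_estimator_def)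
  from measurable_compose[OF dx this] show ?thesis by simp
qed

lemma restrict_measurable: "n \<le> N \<Longrightarrow> (\<lambda>z. restrict z {..<n}) \<in> measurable (sample N) (sample n)"
  by (intro measurable_restrict component_measurable) auto

lemma response_sq_integrable: "integrable \<nu> (\<lambda>w. (snd w)\<^sup>2)"
proof (rule Bochner_Integration.integrable_bound)
  show "integrable \<nu> (\<lambda>w. exp (c * (snd w)\<^sup>2) / c)"
    using exp_integrable by simp
  show "AE w in \<nu>. norm ((snd w)\<^sup>2) \<le> norm (exp (c * (snd w)\<^sup>2) / c)"
  proof (rule AE_I2)
    fix w :: "(real ^ 'p) \<times> real"
    have "c * (snd w)\<^sup>2 \<le> exp (c * (snd w)\<^sup>2)"
      using exp_ge_add_one_self[of "c * (snd w)\<^sup>2"] by linarith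
    then show "norm ((snd w)\<^sup>2) \<le> norm (exp (c * (snd w)\<^sup>2) / c)"
      using c_pos by (simp add: pos_le_divide_eq mult.commute)
  qed
qed measurable

lemma error_integrable:
  assumes [measurable]: "\<phi> \<in> borel_measurable borel" and B: "\<And>x. x \<in> unit_cube \<Longrightarrow> \<bar>\<phi> x\<bar> \<le> B"
  shows "integrable \<nu> (\<lambda>w. (\<phi> (fst w) - snd w)\<^sup>2)"
proof (rule Bochner_Integration.integrable_bound)
  show "integrable \<nu> (\<lambda>w. 4 * (B\<^sup>2 + (snd w)\<^sup>2))"
    using response_sq_integrable by simp
  show "AE w in \<nu>. norm ((\<phi> (fst w) - snd w)\<^sup>2) \<le> norm (4 * (B\<^sup>2 + (snd w)\<^sup>2))"
    using AE_cube
  proof eventually_elim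
    case (elim w)
    then have "\<bar>\<phi> (fst w)\<bar>\<^sup>2 \<le> B\<^sup>2" by (intro power_mono B) auto
    then have "(\<phi> (fst w))\<^sup>2 \<le> B\<^sup>2 + (snd w)\<^sup>2" by (simp add: add_increasing2)
    moreover have "(snd w)\<^sup>2 \<le> B\<^sup>2 + (snd w)\<^sup>2" by simp
    ultimately have "(\<phi> (fst w) - snd w)\<^sup>2 \<le> 4 * (B\<^sup>2 + (snd w)\<^sup>2)" by (rule square_diff_le)
    then show ?case by simp
  qed
qed measurable

text \<open>Only the first \<open>n\<close> observations grow the tree, so \<open>j < n\<close>
  gives a training error and \<open>j \<ge> n\<close> the error at a fresh point.\<close>

definition point_error :: "nat \<Rightarrow> ((nat \<Rightarrow> (real ^ 'p) \<times> real) \<Rightarrow> real ^ 'p \<Rightarrow> real) \<Rightarrow> nat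
    \<Rightarrow> (nat \<Rightarrow> (real ^ 'p) \<times> real) \<Rightarrow> real" where
  "point_error n mh j z = (mh (restrict z {..<n}) (fst (z j)) - snd (z j))\<^sup>2"

lemma point_error_measurable:
  assumes "odt_estimator n t mh" "n \<le> N" "j < N"
  shows "point_error n mh j \<in> borel_measurable (sample N)"
proof -
  have [measurable]: "(\<lambda>z. z j) \<in> measurable (sample N) \<nu>"
    by (rule component_measurable[OF assms(3)])
  have [measurable]: "(\<lambda>z. mh (restrict z {..<n}) (fst (z j))) \<in> borel_measurable (sample N)"
    by (intro estimator_measurable[OF assms(1)] restrict_measurable assms) measurable
  show ?thesis unfolding point_error_def by measurable
qed

text \<open>A leaf mean is at most the largest response in absolute value, so leaf mean and response
  both have squares below the envelope. This is what makes the errors integrable without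
  truncation.\<close>

lemma point_error_le:
  assumes est: "odt_estimator n t mh" and "n \<le> N" "j < N"
    and z: "\<forall>j<N. fst (z j) \<in> unit_cube"
  shows "point_error n mh j z \<le> 4 * envelope N z"
proof -
  obtain L where mh: "mh (restrict z {..<n}) (fst (z j)) = node_mean n (restrict z {..<n}) (cell_of L (fst (z j)))"
    using odt_estimator_cell[OF est, of z] z assms(2,3) by (metis order_less_le_trans)
  have env: "0 \<le> envelope N z" using assms(3) by (intro less_imp_le envelope_pos) simp
  have "\<bar>snd (z i)\<bar> \<le> sqrt (envelope N z)" if "i < n" for i
    using envelope_ge[of i N z] that assms(2) by (intro real_le_rsqrt) simp
  then have "\<bar>mh (restrict z {..<n}) (fst (z j))\<bar> \<le> sqrt (envelope N z)"
    unfolding mh using env by (intro abs_node_mean_le) auto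
  then have "(mh (restrict z {..<n}) (fst (z j)))\<^sup>2 \<le> envelope N z"
    using env by (metis abs_ge_zero power2_abs power_mono real_sqrt_pow2)
  then show ?thesis
    unfolding point_error_def using envelope_ge[OF assms(3)] by (rule square_diff_le)
qed

lemma point_error_integrable:
  assumes "odt_estimator n t mh" "n \<le> N" "j < N"
  shows "integrable (sample N) (point_error n mh j)"
proof (rule Bochner_Integration.integrable_bound)
  show "integrable (sample N) (\<lambda>z. 4 * envelope N z)"
    using assms(3) by (intro integrable_mult_right envelope_integral) simp
  show "point_error n mh j \<in> borel_measurable (sample N)"
    by (rule point_error_measurable[OF assms])
  show "AE z in sample N. norm (point_error n mh j z) \<le> norm (4 * envelope N z)"
    using AE_sample_cube
  proof eventually_elim
    case (elim z)
    have "0 \<le> point_error n mh j z" by (simp add: point_error_def)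
    with point_error_le[OF assms elim] show ?case by simp
  qed
qed

text \<open>Exchangeability: permuting coordinates preserves a product of equal factors.\<close>

lemma swap_sample:
  assumes "S \<subseteq> {..<n}"
  shows "(\<lambda>z. \<lambda>j\<in>{..<2 * n}. z (swap_halves n S j)) \<in> measurable (sample (2 * n)) (sample (2 * n))"
    and "distr (sample (2 * n)) (sample (2 * n)) (\<lambda>z. \<lambda>j\<in>{..<2 * n}. z (swap_halves n S j)) = sample (2 * n)"
proof -
  show "(\<lambda>z. \<lambda>j\<in>{..<2 * n}. z (swap_halves n S j)) \<in> measurable (sample (2 * n)) (sample (2 * n))"
    using swap_halves_less[OF assms] by (intro measurable_restrict component_measurable) auto
  show "distr (sample (2 * n)) (sample (2 * n)) (\<lambda>z. \<lambda>j\<in>{..<2 * n}. z (swap_halves n S j)) = sample (2 * n)"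
    using distr_PiM_reindex[of "{..<2 * n}" "\<lambda>_. \<nu>" "swap_halves n S" "{..<2 * n}"]
      prob_space_axioms inj_on_swap_halves[OF assms] swap_halves_less[OF assms] by auto
qed

text \<open>All exchanges preserve the law of the doubled sample, so the expected gap equals the
  expectation of its average over \<open>S\<close>. For each fixed sample
  \<open>symmetrized_sum_le\<close> bounds this average, with \<open>B\<close> the square root of
  the envelope.\<close>

lemma symmetrization:
  assumes est: "odt_estimator n t mh" and n: "n > 0" and t: "t > 0"
  shows "(\<Sum>i<n. (\<integral>z. point_error n mh (n + i) z \<partial>sample (2 * n)) - (\<integral>z. point_error n mh i z \<partial>sample (2 * n)))
    \<le> 14 * ((ln (real (2 * n)) + exp_moment) / c) * sqrt (real n * ln (class_bound CARD('p) n t))"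
proof -
  let ?P = "sample (2 * n)" and ?e = "point_error n mh"
  let ?\<tau> = "\<lambda>S z. \<lambda>j\<in>{..<2 * n}. z (swap_halves n S j)"
  let ?r = "sqrt (real n * ln (class_bound CARD('p) n t))"
  define \<Phi> where "\<Phi> z = (\<Sum>i<n. ?e (n + i) z - ?e i z)" for z
  have int: "integrable ?P (?e j)" if "j < 2 * n" for j
    using that by (intro point_error_integrable[OF est]) auto
  have \<Phi>_int: "integrable ?P \<Phi>"
    unfolding \<Phi>_def by (intro Bochner_Integration.integrable_sum Bochner_Integration.integrable_diff int) auto
  have \<Phi>_eq: "(\<integral>z. \<Phi> z \<partial>?P) = (\<Sum>i<n. (\<integral>z. ?e (n + i) z \<partial>?P) - (\<integral>z. ?e i z \<partial>?P))"
    unfolding \<Phi>_def using int by (simp add: Bochner_Integration.integral_sum Bochner_Integration.integral_diff)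
  have swap: "integrable ?P (\<lambda>z. \<Phi> (?\<tau> S z))" "(\<integral>z. \<Phi> (?\<tau> S z) \<partial>?P) = (\<integral>z. \<Phi> z \<partial>?P)"
    if "S \<in> Pow {..<n}" for S
  proof -
    have S: "S \<subseteq> {..<n}" using that by simp
    have m: "\<Phi> \<in> borel_measurable ?P" using \<Phi>_int by simp
    show "integrable ?P (\<lambda>z. \<Phi> (?\<tau> S z))"
      using integrable_distr_eq[OF swap_sample(1)[OF S] m] \<Phi>_int by (simp only: swap_sample(2)[OF S])
    show "(\<integral>z. \<Phi> (?\<tau> S z) \<partial>?P) = (\<integral>z. \<Phi> z \<partial>?P)"
      using integral_distr[OF swap_sample(1)[OF S] m] by (simp only: swap_sample(2)[OF S])
  qed
  have pointwise: "(\<Sum>S\<in>Pow {..<n}. \<Phi> (?\<tau> S z)) \<le> 2 ^ n * (14 * envelope (2 * n) z * ?r)"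
    if z: "\<forall>j<2 * n. fst (z j) \<in> unit_cube" for z
  proof -
    let ?B = "sqrt (envelope (2 * n) z)"
    have env: "0 < envelope (2 * n) z" using n by (intro envelope_pos) simp
    have y: "\<bar>snd (z j)\<bar> \<le> ?B" if "j < 2 * n" for j
      using envelope_ge[OF that, of z] by (intro real_le_rsqrt) simp
    \<comment> \<open>The tree is regrown from the exchanged sample and so varies with
      \<open>S\<close>. Written on the unexchanged points, exchanging \<open>i\<close> with its copy
      reverses the sign of the \<open>i\<close>-th difference.\<close>
    let ?f = "\<lambda>S. mh (restrict (?\<tau> S z) {..<n})"
    have "(\<Sum>S\<in>Pow {..<n}. \<Phi> (?\<tau> S z)) = (\<Sum>S\<in>Pow {..<n}. \<Sum>i<n. flip S i
        * ((?f S (fst (z (n + i))) - snd (z (n + i)))\<^sup>2 - (?f S (fst (z i)) - snd (z i))\<^sup>2))"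
      unfolding \<Phi>_def point_error_def
      by (intro sum.cong refl) (auto simp: flip_def swap_halves_def)
    also have "\<dots> \<le> 2 ^ n * (14 * ?B\<^sup>2 * ?r)"
    proof (rule symmetrized_sum_le[OF _ y _ n t])
      fix S assume S: "S \<subseteq> {..<n}"
      have "fst (?\<tau> S z i) \<in> unit_cube" if "i < n" for i
        using that z swap_halves_less[OF S, of i] by simp
      then obtain L where L: "split_partition L" "size L = t" and
        mh: "\<And>x. x \<in> unit_cube \<Longrightarrow> ?f S x = node_mean n (restrict (?\<tau> S z) {..<n}) (cell_of L x)"
        using odt_estimator_cell[OF est, of "?\<tau> S z"] by blast
      have "\<bar>node_mean n (restrict (?\<tau> S z) {..<n}) A\<bar> \<le> ?B" for A
        using env y swap_halves_less[OF S] by (intro abs_node_mean_le) auto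
      with L mh z show "\<exists>L u. split_partition L \<and> size L = t \<and> (\<forall>A. \<bar>u A\<bar> \<le> ?B)
          \<and> (\<forall>j<2 * n. ?f S (fst (z j)) = u (cell_of L (fst (z j))))"
        by (intro exI[of _ L] exI[of _ "node_mean n (restrict (?\<tau> S z) {..<n})"]) auto
    qed (use z env in auto)
    also have "?B\<^sup>2 = envelope (2 * n) z" using env by simp
    finally show ?thesis .
  qed
  have "2 ^ n * (\<integral>z. \<Phi> z \<partial>?P) = (\<Sum>S\<in>Pow {..<n}. \<integral>z. \<Phi> (?\<tau> S z) \<partial>?P)"
    using swap(2) by (simp add: card_Pow)
  also have "\<dots> = (\<integral>z. (\<Sum>S\<in>Pow {..<n}. \<Phi> (?\<tau> S z)) \<partial>?P)"
    using swap(1) by (intro Bochner_Integration.integral_sum[symmetric])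
  also have "\<dots> \<le> (\<integral>z. 2 ^ n * (14 * envelope (2 * n) z * ?r) \<partial>?P)"
  proof (rule integral_mono_AE)
    show "integrable ?P (\<lambda>z. \<Sum>S\<in>Pow {..<n}. \<Phi> (?\<tau> S z))"
      using swap(1) by (intro Bochner_Integration.integrable_sum)
    show "integrable ?P (\<lambda>z. 2 ^ n * (14 * envelope (2 * n) z * ?r))"
      using envelope_integral(1)[of "2 * n"] n by simp
    show "AE z in ?P. (\<Sum>S\<in>Pow {..<n}. \<Phi> (?\<tau> S z)) \<le> 2 ^ n * (14 * envelope (2 * n) z * ?r)"
      using AE_sample_cube by eventually_elim (rule pointwise)
  qed
  also have "\<dots> = 2 ^ n * (14 * ((ln (real (2 * n)) + exp_moment) / c) * ?r)"
    using envelope_integral[of "2 * n"] n by simp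
  finally have "(\<integral>z. \<Phi> z \<partial>?P) \<le> 14 * ((ln (real (2 * n)) + exp_moment) / c) * ?r"
    by (simp only: mult_le_cancel_left_pos zero_less_power zero_less_numeral)
  then show ?thesis unfolding \<Phi>_eq .
qed

text \<open>Position \<open>j\<close> is moved to position \<open>n\<close>, directly behind the
  training sample, where the product over \<open>insert n {..<n}\<close> lets Fubini split off one
  factor.\<close>

lemma nn_integral_fresh_point:
  assumes j: "n \<le> j" "j < N"
    and h: "(\<lambda>(d, w). h d w) \<in> borel_measurable (sample n \<Otimes>\<^sub>M \<nu>)"
  shows "(\<integral>\<^sup>+z. h (restrict z {..<n}) (z j) \<partial>sample N) = (\<integral>\<^sup>+d. \<integral>\<^sup>+w. h d w \<partial>\<nu> \<partial>sample n)"
proof -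
  let ?I = "insert n {..<n}"
  let ?f = "\<lambda>i. if i < n then i else j"
  let ?Q = "\<Pi>\<^sub>M i\<in>?I. \<nu>"
  let ?\<tau> = "\<lambda>z. \<lambda>i\<in>?I. z (?f i)"
  let ?k = "\<lambda>z. h (restrict z {..<n}) (z n)"
  have \<nu>: "prob_space \<nu>" by (rule prob_space_axioms)
  interpret prod: product_prob_space "\<lambda>_. \<nu>" ?I
    by (rule product_prob_spaceI) (rule \<nu>)
  have \<tau>: "?\<tau> \<in> measurable (sample N) ?Q"
    using j by (intro measurable_restrict component_measurable) auto
  have distr: "distr (sample N) ?Q ?\<tau> = ?Q"
    using j \<nu>
    by (intro distr_PiM_reindex[of "{..<N}" "\<lambda>_. \<nu>" ?f ?I]) (auto simp: inj_on_def)
  have "(\<lambda>z. (restrict z {..<n}, z n)) \<in> measurable ?Q (sample n \<Otimes>\<^sub>M \<nu>)"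
    by (intro measurable_Pair measurable_restrict measurable_component_singleton) auto
  from measurable_compose[OF this h] have k: "?k \<in> borel_measurable ?Q" by simp
  have "(\<integral>\<^sup>+z. h (restrict z {..<n}) (z j) \<partial>sample N) = (\<integral>\<^sup>+z. ?k (?\<tau> z) \<partial>sample N)"
  proof (rule nn_integral_cong)
    fix z :: "nat \<Rightarrow> (real ^ 'p) \<times> real"
    have "restrict (?\<tau> z) {..<n} = restrict z {..<n}" by (auto simp: restrict_def fun_eq_iff)
    then show "h (restrict z {..<n}) (z j) = ?k (?\<tau> z)" by simp
  qed
  also have "\<dots> = (\<integral>\<^sup>+z. ?k z \<partial>distr (sample N) ?Q ?\<tau>)"
    by (rule nn_integral_distr[symmetric, OF \<tau>]) (use k in simp)
  also have "\<dots> = (\<integral>\<^sup>+z. ?k z \<partial>?Q)" by (simp only: distr)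
  also have "\<dots> = (\<integral>\<^sup>+d. \<integral>\<^sup>+w. ?k (d(n := w)) \<partial>\<nu> \<partial>sample n)"
    by (rule prod.product_nn_integral_insert) (use k in auto)
  also have "\<dots> = (\<integral>\<^sup>+d. \<integral>\<^sup>+w. h d w \<partial>\<nu> \<partial>sample n)"
  proof (rule nn_integral_cong)
    fix d assume "d \<in> space (sample n)"
    then have "restrict (d(n := w)) {..<n} = d" for w
      by (auto simp: space_PiM PiE_def extensional_def restrict_def fun_eq_iff)
    then show "(\<integral>\<^sup>+w. ?k (d(n := w)) \<partial>\<nu>) = (\<integral>\<^sup>+w. h d w \<partial>\<nu>)" by simp
  qed
  finally show ?thesis .
qed

text \<open>All \<open>n\<close> fresh points have the same expected error, the risk; summing over
  them gives every training point a partner. So \<open>n\<close> times the risk is the symmetrized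
  gap plus the training error, and the latter is compared with the error of \<open>g\<close> on the
  sample.\<close>

theorem risk_bound:
  assumes est: "odt_estimator n t mh" and n: "n > 0" and t: "2 ^ Suc K < t" and K: "K > 0"
    and g: "ridge_step v g" and W: "4 * v\<^sup>2 \<le> W" "W > 0"
  shows "(\<integral>\<^sup>+d. \<integral>\<^sup>+w. ennreal ((mh d (fst w) - snd w)\<^sup>2) \<partial>\<nu> \<partial>sample n)
    \<le> ennreal ((\<integral>w. (g (fst w) - snd w)\<^sup>2 \<partial>\<nu>) + W / real K
        + 14 * ((ln (real (2 * n)) + exp_moment) / c) * sqrt (ln (class_bound CARD('p) n t) / real n))"
    (is "?R \<le> ennreal (?G + _ + ?C * _)")
proof -
  let ?P = "sample (2 * n)" and ?e = "point_error n mh"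
  let ?l = "ln (class_bound CARD('p) n t)"
  interpret P: prob_space ?P by (rule prob_space_sample)
  have int: "integrable ?P (?e j)" if "j < 2 * n" for j
    using that by (intro point_error_integrable[OF est]) auto
  obtain B where B: "\<And>x. \<bar>g x\<bar> \<le> B" using ridge_step_bounded[OF g] by blast
  have g_int: "integrable \<nu> (\<lambda>w. (g (fst w) - snd w)\<^sup>2)"
    by (rule error_integrable[OF ridge_step_measurable[OF g] B])
  have g_component: "integrable ?P (\<lambda>z. (g (fst (z i)) - snd (z i))\<^sup>2)"
    "(\<integral>z. (g (fst (z i)) - snd (z i))\<^sup>2 \<partial>?P) = ?G" if "i < n" for i
    using integral_component[OF _ g_int, of i "2 * n"] that by auto
  have g_sum: "integrable ?P (\<lambda>z. \<Sum>i<n. (g (fst (z i)) - snd (z i))\<^sup>2)"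
    by (intro Bochner_Integration.integrable_sum g_component) auto
  have fresh: "?R = ennreal (\<integral>z. ?e (n + i) z \<partial>?P)" if i: "i < n" for i
  proof -
    have "(\<lambda>p. mh (fst p) (fst (snd p))) \<in> borel_measurable (sample n \<Otimes>\<^sub>M \<nu>)"
      by (rule estimator_measurable[OF est]) measurable
    then have "(\<lambda>(d, w). ennreal ((mh d (fst w) - snd w)\<^sup>2)) \<in> borel_measurable (sample n \<Otimes>\<^sub>M \<nu>)"
      unfolding split_beta' by measurable
    from nn_integral_fresh_point[OF _ _ this, of "n + i" "2 * n"] i
    have "?R = (\<integral>\<^sup>+z. ennreal (?e (n + i) z) \<partial>?P)" by (simp add: point_error_def)
    also have "\<dots> = ennreal (\<integral>z. ?e (n + i) z \<partial>?P)"
      using i by (intro nn_integral_eq_integral int) (auto simp: point_error_def)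
    finally show ?thesis .
  qed
  define R where "R = (\<integral>z. ?e n z \<partial>?P)"
  have R0: "0 \<le> R" unfolding R_def by (intro integral_nonneg_AE) (simp add: point_error_def)
  have R: "?R = ennreal R" using fresh[OF n] by (simp add: R_def)
  have eq: "(\<integral>z. ?e (n + i) z \<partial>?P) = R" if "i < n" for i
  proof -
    have "0 \<le> (\<integral>z. ?e (n + i) z \<partial>?P)" by (intro integral_nonneg_AE) (simp add: point_error_def)
    then show ?thesis using fresh[OF that] R R0 by simp
  qed
  have "(\<Sum>i<n. \<integral>z. ?e i z \<partial>?P) = (\<integral>z. (\<Sum>i<n. ?e i z) \<partial>?P)"
    using int by (intro Bochner_Integration.integral_sum[symmetric]) auto
  also have "\<dots> \<le> (\<integral>z. (\<Sum>i<n. (g (fst (z i)) - snd (z i))\<^sup>2) + real n * W / real K \<partial>?P)"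
  proof (rule integral_mono_AE)
    show "integrable ?P (\<lambda>z. \<Sum>i<n. ?e i z)"
      using int by (intro Bochner_Integration.integrable_sum) auto
    show "integrable ?P (\<lambda>z. (\<Sum>i<n. (g (fst (z i)) - snd (z i))\<^sup>2) + real n * W / real K)"
      using g_sum by simp
    show "AE z in ?P. (\<Sum>i<n. ?e i z) \<le> (\<Sum>i<n. (g (fst (z i)) - snd (z i))\<^sup>2) + real n * W / real K"
      using AE_sample_cube
    proof eventually_elim
      case (elim z)
      then have z: "fst (z i) \<in> unit_cube" if "i < n" for i using that by simp
      obtain L where L: "odt_leaves n (restrict z {..<n}) t L"
        and mh: "\<And>x. x \<in> unit_cube \<Longrightarrow> mh (restrict z {..<n}) x = leaf_estimate n (restrict z {..<n}) L x"
        using odt_estimator_cell[OF est, of z] z by blast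
      have cube: "\<forall>i<n. fst (restrict z {..<n} i) \<in> unit_cube" using z by simp
      have "(\<Sum>i<n. ?e i z) = (\<Sum>i<n. (leaf_estimate n (restrict z {..<n}) L (fst (restrict z {..<n} i))
          - snd (restrict z {..<n} i))\<^sup>2)"
        using z mh by (intro sum.cong) (auto simp: point_error_def)
      also have "\<dots> \<le> (\<Sum>i<n. (g (fst (restrict z {..<n} i)) - snd (restrict z {..<n} i))\<^sup>2) + real n * W / real K"
        by (rule odt_training_error[OF L g W n cube t K])
      finally show ?case by simp
    qed
  qed
  also have "\<dots> = (\<integral>z. (\<Sum>i<n. (g (fst (z i)) - snd (z i))\<^sup>2) \<partial>?P) + real n * W / real K"
    by (simp add: g_sum P.prob_space)
  also have "(\<integral>z. (\<Sum>i<n. (g (fst (z i)) - snd (z i))\<^sup>2) \<partial>?P)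
      = (\<Sum>i<n. \<integral>z. (g (fst (z i)) - snd (z i))\<^sup>2 \<partial>?P)"
    by (intro Bochner_Integration.integral_sum g_component) auto
  also have "\<dots> = real n * ?G" by (simp add: g_component)
  finally have train: "(\<Sum>i<n. \<integral>z. ?e i z \<partial>?P) \<le> real n * ?G + real n * W / real K" .
  have "real n * R = (\<Sum>i<n. (\<integral>z. ?e (n + i) z \<partial>?P) - (\<integral>z. ?e i z \<partial>?P)) + (\<Sum>i<n. \<integral>z. ?e i z \<partial>?P)"
    unfolding sum_subtractf using eq by simp
  also have "\<dots> \<le> ?C * sqrt (real n * ?l) + (real n * ?G + real n * W / real K)"
    using t by (intro add_mono train symmetrization[OF est n]) simp
  also have "sqrt (real n * ?l) = real n * sqrt (?l / real n)"
    using n by (simp add: real_sqrt_mult real_sqrt_divide field_simps)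
  also have "?C * (real n * sqrt (?l / real n)) + (real n * ?G + real n * W / real K)
      = real n * (?G + W / real K + ?C * sqrt (?l / real n))"
    by (simp add: algebra_simps)
  finally have "R \<le> ?G + W / real K + ?C * sqrt (?l / real n)"
    using n by (simp only: mult_le_cancel_left_pos of_nat_0_less_iff)
  then show ?thesis unfolding R by (rule ennreal_leI)
qed

end

section \<open>Consistency\<close>

text \<open>Since \<open>1 \<le> t \<le> n\<close>, both \<open>2 * t\<close> and
  \<open>Suc (2 * n)\<close> are at most \<open>3 * n\<close>, which merges the factors into the
  power \<open>p + 2\<close>.\<close>

lemma ln_class_bound_le:
  assumes "1 \<le> t" "t \<le> n"
  shows "ln (class_bound p n t) \<le> real t * (real (p + 2) * ln (3 * real n))"
proof -
  have "2 * t * Suc (2 * n) ^ (p + 1) \<le> (3 * n) * (3 * n) ^ (p + 1)"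
    using assms by (intro mult_le_mono power_mono) auto
  then have "(2 * t * Suc (2 * n) ^ (p + 1)) ^ t \<le> ((3 * n) ^ (p + 2)) ^ t"
    by (intro power_mono) simp_all
  then have "class_bound p n t \<le> real (((3 * n) ^ (p + 2)) ^ t)"
    unfolding class_bound_def by (rule of_nat_mono)
  also have "\<dots> = (3 * real n) ^ ((p + 2) * t)"
    by (simp only: power_mult of_nat_power of_nat_mult of_nat_numeral)
  finally have "ln (class_bound p n t) \<le> ln ((3 * real n) ^ ((p + 2) * t))"
    using class_bound_gt_1[of t p n] assms by (intro ln_mono) auto
  also have "\<dots> = real ((p + 2) * t) * ln (3 * real n)"
    by (rule ln_realpow)
  finally show ?thesis by (simp only: of_nat_mult mult_ac)
qed

lemma complexity_term_tendsto_0: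
  fixes t :: "nat \<Rightarrow> nat" and E c :: real
  assumes t: "\<And>n. n \<ge> 1 \<Longrightarrow> 1 \<le> t n \<and> t n \<le> n"
    and o: "(\<lambda>n. real (t n)) \<in> o(\<lambda>n. real n / ln (real n) ^ 4)"
  shows "(\<lambda>n. 14 * ((ln (real (2 * n)) + E) / c) * sqrt (ln (class_bound p n (t n)) / real n)) \<longlonglongrightarrow> 0"
proof -
  let ?a = "\<lambda>n. ln (real (2 * n)) + E"
  \<comment> \<open>The square of the sequence, up to the constant \<open>14 / c\<close>, is at most
    \<open>?u * ?w\<close>: \<open>?u\<close> is the quotient in the growth condition, and
    \<open>?w\<close> has three logarithms over four.\<close>
  let ?u = "\<lambda>n. real (t n) / (real n / ln (real n) ^ 4)"
  let ?w = "\<lambda>n. real (p + 2) * (ln (3 * real n) * (ln (2 * real n) + E)\<^sup>2 / ln (real n) ^ 4)"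
  have u: "?u \<longlonglongrightarrow> 0" using o by (rule smalloD_tendsto)
  have "(\<lambda>n. ln (3 * real n) * (ln (2 * real n) + E)\<^sup>2 / ln (real n) ^ 4) \<longlonglongrightarrow> 0"
    by real_asymp
  from tendsto_mult_right_zero[OF this] have w: "?w \<longlonglongrightarrow> 0" .
  have "(\<lambda>n. sqrt (?u n * ?w n)) \<longlonglongrightarrow> sqrt (0 * 0)"
    by (intro tendsto_intros u w)
  then have lim: "(\<lambda>n. sqrt (?u n * ?w n)) \<longlonglongrightarrow> 0" by simp
  have "(\<lambda>n. ?a n * sqrt (ln (class_bound p n (t n)) / real n)) \<longlonglongrightarrow> 0"
  proof (rule Lim_null_comparison[OF _ lim])
    show "\<forall>\<^sub>F n in sequentially. norm (?a n * sqrt (ln (class_bound p n (t n)) / real n)) \<le> sqrt (?u n * ?w n)"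
      using eventually_ge_at_top[of 3]
    proof eventually_elim
      case (elim n)
      then have n: "1 \<le> n" and ln: "0 < ln (real n)" by auto
      have tn: "1 \<le> t n" "t n \<le> n" using t[OF n] by auto
      have "0 \<le> ln (class_bound p n (t n))"
        using class_bound_gt_1[of "t n" p n] tn by simp
      then have "norm (?a n * sqrt (ln (class_bound p n (t n)) / real n))
          = sqrt ((?a n)\<^sup>2 * (ln (class_bound p n (t n)) / real n))"
        by (simp add: real_sqrt_mult real_sqrt_divide abs_mult)
      also have "\<dots> \<le> sqrt ((?a n)\<^sup>2 * (real (t n) * (real (p + 2) * ln (3 * real n)) / real n))"
        by (intro real_sqrt_le_mono mult_left_mono divide_right_mono ln_class_bound_le tn) auto
      also have "(?a n)\<^sup>2 * (real (t n) * (real (p + 2) * ln (3 * real n)) / real n) = ?u n * ?w n"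
        using ln n by (simp add: field_simps)
      finally show ?case .
    qed
  qed
  from tendsto_mult_right_zero[OF this, of "14 / c"] show ?thesis
    by (simp only: times_divide_eq_left times_divide_eq_right mult.assoc)
qed

text \<open>Truncation of negative numbers to 0 makes \<open>ennreal\<close> subadditive on all
  reals, so the signs of the error terms need no discussion.\<close>

lemma ennreal_add_le: "ennreal (a + b) \<le> ennreal a + ennreal b"
  by (auto simp: ennreal_plus_if intro: ennreal_leI)

section \<open>Regression function, noise and decomposition of the risk\<close>

locale regression = prob_space M for M :: "'a measure" +
  fixes X :: "'a \<Rightarrow> real ^ 'p::finite" and Y :: "'a \<Rightarrow> real"
    and m :: "real ^ 'p \<Rightarrow> real" and c :: real
  assumes X [measurable]: "X \<in> borel_measurable M" and Y [measurable]: "Y \<in> borel_measurable M"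
    and X_cube: "AE \<omega> in M. X \<omega> \<in> unit_cube"
    and m [measurable]: "m \<in> borel_measurable borel"
    and cond_exp: "AE \<omega> in M. real_cond_exp M (vimage_algebra (space M) X borel) Y \<omega> = m (X \<omega>)"
    and c: "c > 0" and exp_int: "integrable M (\<lambda>\<omega>. exp (c * (Y \<omega>)\<^sup>2))"
    and m_int: "integrable M (\<lambda>\<omega>. (m (X \<omega>))\<^sup>2)"
begin

abbreviation law_X :: "(real ^ 'p) measure" where "law_X \<equiv> distr M borel X"

abbreviation law_XY :: "((real ^ 'p) \<times> real) measure" where
  "law_XY \<equiv> distr M borel (\<lambda>\<omega>. (X \<omega>, Y \<omega>))"

lemma pair_measurable [measurable]: "(\<lambda>\<omega>. (X \<omega>, Y \<omega>)) \<in> borel_measurable M"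
  by (rule borel_measurable_Pair[OF X Y])

lemma fst_snd_borel [measurable]:
  "fst \<in> borel_measurable (borel :: ((real ^ 'p) \<times> real) measure)"
  "snd \<in> borel_measurable (borel :: ((real ^ 'p) \<times> real) measure)"
  by (intro borel_measurable_continuous_onI continuous_on_fst continuous_on_snd continuous_on_id)+

sublocale muX: cube_law law_X
proof -
  interpret L: prob_space law_X by (rule prob_space_distr) simp
  show "cube_law law_X"
    by unfold_locales (use X_cube in \<open>simp_all add: AE_distr_iff\<close>)
qed

sublocale nuXY: sample_law law_XY c
proof -
  interpret L: prob_space law_XY by (rule prob_space_distr) simp
  have meas: "(\<lambda>w. exp (c * (snd w)\<^sup>2)) \<in> borel_measurable (borel :: ((real ^ 'p) \<times> real) measure)"
    by measurable
  have cube: "{w \<in> space borel. fst w \<in> unit_cube} \<in> sets (borel :: ((real ^ 'p) \<times> real) measure)"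
    by measurable
  show "sample_law law_XY c"
  proof
    show "AE w in law_XY. fst w \<in> unit_cube"
      using X_cube cube by (subst AE_distr_iff) auto
    show "integrable law_XY (\<lambda>w. exp (c * (snd w)\<^sup>2))"
      using exp_int meas by (subst integrable_distr_eq) auto
  qed (use c in auto)
qed

text \<open>The risk of \<open>m\<close> itself, which enters the risk of every bounded predictor as
  a fixed summand.\<close>

definition noise :: real where
  "noise = (\<integral>\<omega>. (m (X \<omega>) - Y \<omega>)\<^sup>2 \<partial>M)"

lemma Y_sq_integrable: "integrable M (\<lambda>\<omega>. (Y \<omega>)\<^sup>2)"
  using nuXY.response_sq_integrable by (subst (asm) integrable_distr_eq) auto

lemma integrable_mult_of_squares:
  assumes "f \<in> borel_measurable M" "g \<in> borel_measurable M"
    "integrable M (\<lambda>\<omega>. (f \<omega>)\<^sup>2)" "integrable M (\<lambda>\<omega>. (g \<omega>)\<^sup>2)"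
  shows "integrable M (\<lambda>\<omega>. f \<omega> * g \<omega> :: real)"
proof (rule Bochner_Integration.integrable_bound)
  show "integrable M (\<lambda>\<omega>. (f \<omega>)\<^sup>2 + (g \<omega>)\<^sup>2)" using assms by simp
  show "AE \<omega> in M. norm (f \<omega> * g \<omega>) \<le> norm ((f \<omega>)\<^sup>2 + (g \<omega>)\<^sup>2)"
  proof (rule AE_I2)
    fix \<omega>
    have "0 \<le> (\<bar>f \<omega>\<bar> - \<bar>g \<omega>\<bar>)\<^sup>2" by simp
    then have "2 * (\<bar>f \<omega>\<bar> * \<bar>g \<omega>\<bar>) \<le> \<bar>f \<omega>\<bar>\<^sup>2 + \<bar>g \<omega>\<bar>\<^sup>2" by (simp only: power2_diff)
    moreover have "0 \<le> \<bar>f \<omega>\<bar> * \<bar>g \<omega>\<bar>" by simp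
    ultimately have "\<bar>f \<omega>\<bar> * \<bar>g \<omega>\<bar> \<le> \<bar>f \<omega>\<bar>\<^sup>2 + \<bar>g \<omega>\<bar>\<^sup>2" by linarith
    then show "norm (f \<omega> * g \<omega>) \<le> norm ((f \<omega>)\<^sup>2 + (g \<omega>)\<^sup>2)" by (simp add: abs_mult)
  qed
qed (use assms in measurable)

text \<open>\<open>h (X)\<close> is measurable for the sigma-algebra generated by \<open>X\<close>,
  so conditional expectation allows \<open>m (X)\<close> to replace \<open>Y\<close> next to it
  under the integral.\<close>

lemma residual_orthogonal:
  assumes h: "h \<in> borel_measurable borel" and h_int: "integrable M (\<lambda>\<omega>. (h (X \<omega>))\<^sup>2)"
  shows "(\<integral>\<omega>. h (X \<omega>) * (m (X \<omega>) - Y \<omega>) \<partial>M) = 0"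
proof -
  let ?F = "vimage_algebra (space M) X borel"
  have hX [measurable]: "(\<lambda>\<omega>. h (X \<omega>)) \<in> borel_measurable M" using h by measurable
  interpret F: finite_measure_subalgebra M ?F
  proof unfold_locales
    show "subalgebra M ?F"
      unfolding subalgebra_def
      using measurable_sets[OF X] by (auto simp: sets_vimage_algebra2)
  qed
  have hF: "(\<lambda>\<omega>. h (X \<omega>)) \<in> borel_measurable ?F"
    by (rule measurable_compose[OF measurable_vimage_algebra1 h]) simp
  have hY: "integrable M (\<lambda>\<omega>. h (X \<omega>) * Y \<omega>)"
    by (rule integrable_mult_of_squares[OF hX Y h_int Y_sq_integrable])
  have hm: "integrable M (\<lambda>\<omega>. h (X \<omega>) * m (X \<omega>))"
    by (rule integrable_mult_of_squares[OF hX _ h_int m_int]) measurable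
  have "(\<integral>\<omega>. h (X \<omega>) * m (X \<omega>) \<partial>M) = (\<integral>\<omega>. h (X \<omega>) * real_cond_exp M ?F Y \<omega> \<partial>M)"
    using cond_exp by (intro integral_cong_AE) auto
  also have "\<dots> = (\<integral>\<omega>. h (X \<omega>) * Y \<omega> \<partial>M)"
    by (rule F.real_cond_exp_intg(2)[OF hY hF Y])
  finally show ?thesis
    using hY hm by (simp add: right_diff_distrib)
qed

text \<open>Pythagoras: the cross term vanishes by orthogonality of the residual to
  \<open>\<phi> - m\<close>.\<close>

lemma risk_decomposition:
  assumes \<phi>: "\<phi> \<in> borel_measurable borel" and B: "\<And>x. x \<in> unit_cube \<Longrightarrow> \<bar>\<phi> x\<bar> \<le> B"
  shows "integrable M (\<lambda>\<omega>. (\<phi> (X \<omega>) - m (X \<omega>))\<^sup>2)"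
    and "(\<integral>w. (\<phi> (fst w) - snd w)\<^sup>2 \<partial>law_XY) = (\<integral>\<omega>. (\<phi> (X \<omega>) - m (X \<omega>))\<^sup>2 \<partial>M) + noise"
proof -
  note \<phi> [measurable]
  have \<phi>_sq: "integrable M (\<lambda>\<omega>. (\<phi> (X \<omega>))\<^sup>2)"
  proof (rule Bochner_Integration.integrable_bound)
    show "integrable M (\<lambda>\<omega>. B\<^sup>2)" by simp
    show "AE \<omega> in M. norm ((\<phi> (X \<omega>))\<^sup>2) \<le> norm (B\<^sup>2)"
      using X_cube
    proof eventually_elim
      case (elim \<omega>)
      then show ?case using power_mono[OF B, of "X \<omega>" 2] by simp
    qed
  qed measurable
  have "integrable M (\<lambda>\<omega>. \<phi> (X \<omega>) * m (X \<omega>))"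
    by (rule integrable_mult_of_squares[OF _ _ \<phi>_sq m_int]) measurable
  then show h_int: "integrable M (\<lambda>\<omega>. (\<phi> (X \<omega>) - m (X \<omega>))\<^sup>2)"
    using \<phi>_sq m_int by (simp add: power2_diff mult.assoc)
  have "integrable M (\<lambda>\<omega>. m (X \<omega>) * Y \<omega>)"
    by (rule integrable_mult_of_squares[OF _ _ m_int Y_sq_integrable]) measurable
  then have n_int: "integrable M (\<lambda>\<omega>. (m (X \<omega>) - Y \<omega>)\<^sup>2)"
    using Y_sq_integrable m_int by (simp add: power2_diff mult.assoc)
  have x_int: "integrable M (\<lambda>\<omega>. (\<phi> (X \<omega>) - m (X \<omega>)) * (m (X \<omega>) - Y \<omega>))"
    by (rule integrable_mult_of_squares[OF _ _ h_int n_int]) measurable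
  have x_zero: "(\<integral>\<omega>. (\<phi> (X \<omega>) - m (X \<omega>)) * (m (X \<omega>) - Y \<omega>) \<partial>M) = 0"
    using h_int by (intro residual_orthogonal[where h = "\<lambda>x. \<phi> x - m x"]) auto
  have "(\<integral>w. (\<phi> (fst w) - snd w)\<^sup>2 \<partial>law_XY) = (\<integral>\<omega>. (\<phi> (X \<omega>) - Y \<omega>)\<^sup>2 \<partial>M)"
    by (subst integral_distr) auto
  also have "\<dots> = (\<integral>\<omega>. (\<phi> (X \<omega>) - m (X \<omega>))\<^sup>2 + 2 * ((\<phi> (X \<omega>) - m (X \<omega>)) * (m (X \<omega>) - Y \<omega>))
      + (m (X \<omega>) - Y \<omega>)\<^sup>2 \<partial>M)"
    by (intro Bochner_Integration.integral_cong refl) (simp add: power2_eq_square algebra_simps)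
  also have "\<dots> = (\<integral>\<omega>. (\<phi> (X \<omega>) - m (X \<omega>))\<^sup>2 \<partial>M) + noise"
    using h_int n_int x_int x_zero by (simp add: noise_def)
  finally show "(\<integral>w. (\<phi> (fst w) - snd w)\<^sup>2 \<partial>law_XY) = (\<integral>\<omega>. (\<phi> (X \<omega>) - m (X \<omega>))\<^sup>2 \<partial>M) + noise" .
qed

lemma noise_nonneg: "0 \<le> noise"
  unfolding noise_def by (intro integral_nonneg_AE) simp

lemma nn_l2_error:
  assumes \<phi>: "\<phi> \<in> borel_measurable borel" and B: "\<And>x. x \<in> unit_cube \<Longrightarrow> \<bar>\<phi> x\<bar> \<le> B"
  shows "(\<integral>\<^sup>+x. ennreal ((\<phi> x - m x)\<^sup>2) \<partial>law_X) = ennreal (\<integral>\<omega>. (\<phi> (X \<omega>) - m (X \<omega>))\<^sup>2 \<partial>M)"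
proof -
  have "(\<integral>\<^sup>+x. ennreal ((\<phi> x - m x)\<^sup>2) \<partial>law_X) = (\<integral>\<^sup>+\<omega>. ennreal ((\<phi> (X \<omega>) - m (X \<omega>))\<^sup>2) \<partial>M)"
    by (rule nn_integral_distr[OF X]) (use \<phi> in simp)
  also have "\<dots> = ennreal (\<integral>\<omega>. (\<phi> (X \<omega>) - m (X \<omega>))\<^sup>2 \<partial>M)"
    by (intro nn_integral_eq_integral risk_decomposition(1)[OF \<phi> B]) auto
  finally show ?thesis .
qed

lemma nn_risk_decomposition:
  assumes \<phi>: "\<phi> \<in> borel_measurable borel" and B: "\<And>x. x \<in> unit_cube \<Longrightarrow> \<bar>\<phi> x\<bar> \<le> B"
  shows "(\<integral>\<^sup>+w. ennreal ((\<phi> (fst w) - snd w)\<^sup>2) \<partial>law_XY)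
    = (\<integral>\<^sup>+x. ennreal ((\<phi> x - m x)\<^sup>2) \<partial>law_X) + ennreal noise"
proof -
  have "(\<integral>\<^sup>+w. ennreal ((\<phi> (fst w) - snd w)\<^sup>2) \<partial>law_XY) = ennreal (\<integral>w. (\<phi> (fst w) - snd w)\<^sup>2 \<partial>law_XY)"
    by (intro nn_integral_eq_integral nuXY.error_integrable[OF \<phi> B]) auto
  also have "\<dots> = ennreal ((\<integral>\<omega>. (\<phi> (X \<omega>) - m (X \<omega>))\<^sup>2 \<partial>M) + noise)"
    by (simp only: risk_decomposition(2)[OF \<phi> B])
  also have "\<dots> = ennreal (\<integral>\<omega>. (\<phi> (X \<omega>) - m (X \<omega>))\<^sup>2 \<partial>M) + ennreal noise"
    by (intro ennreal_plus noise_nonneg integral_nonneg_AE) simp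
  finally show ?thesis by (simp only: nn_l2_error[OF \<phi> B])
qed

section \<open>Excess risk of the tree and its limit\<close>

abbreviation excess_risk :: "nat \<Rightarrow> ((nat \<Rightarrow> (real ^ 'p) \<times> real) \<Rightarrow> real ^ 'p \<Rightarrow> real) \<Rightarrow> ennreal" where
  "excess_risk n mh \<equiv> \<integral>\<^sup>+d. \<integral>\<^sup>+x. ennreal ((mh d x - m x)\<^sup>2) \<partial>law_X \<partial>nuXY.sample n"

lemma l2_error_measurable:
  assumes "odt_estimator n t mh"
  shows "(\<lambda>d. \<integral>\<^sup>+x. ennreal ((mh d x - m x)\<^sup>2) \<partial>law_X) \<in> borel_measurable (nuXY.sample n)"
proof -
  have [measurable]: "(\<lambda>p. mh (fst p) (snd p)) \<in> borel_measurable (nuXY.sample n \<Otimes>\<^sub>M law_X)"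
    by (rule nuXY.estimator_measurable[OF assms]) measurable
  have "(\<lambda>(d, x). ennreal ((mh d x - m x)\<^sup>2)) \<in> borel_measurable (nuXY.sample n \<Otimes>\<^sub>M law_X)"
    unfolding split_beta' by measurable
  then show ?thesis by (rule muX.borel_measurable_nn_integral)
qed

text \<open>Pythagoras is applied to the tree and to \<open>g\<close>: both risks exceed the squared
  distance to \<open>m\<close> by the same finite \<open>noise\<close>, which cancels. The constant
  \<open>4 * v\<^sup>2 + 1\<close> is a choice of \<open>W\<close> that is always positive.\<close>

lemma excess_risk_le:
  assumes est: "odt_estimator n t mh" and n: "n > 0" and t: "2 ^ Suc K < t" and K: "K > 0"
    and g: "ridge_step v g"
  shows "excess_risk n mh \<le> muX.l2_dist m g + ennreal ((4 * v\<^sup>2 + 1) / real K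
        + 14 * ((ln (real (2 * n)) + nuXY.exp_moment) / c) * sqrt (ln (class_bound CARD('p) n t) / real n))"
    (is "_ \<le> _ + ennreal (?A + ?D)")
proof -
  interpret S: prob_space "nuXY.sample n" by (rule nuXY.prob_space_sample)
  obtain B where B: "\<And>x. \<bar>g x\<bar> \<le> B" using ridge_step_bounded[OF g] by blast
  note g' = ridge_step_measurable[OF g] B
  have "(\<integral>\<^sup>+d. \<integral>\<^sup>+w. ennreal ((mh d (fst w) - snd w)\<^sup>2) \<partial>law_XY \<partial>nuXY.sample n)
      = (\<integral>\<^sup>+d. (\<integral>\<^sup>+x. ennreal ((mh d x - m x)\<^sup>2) \<partial>law_X) + ennreal noise \<partial>nuXY.sample n)"
  proof (rule nn_integral_cong_AE)
    show "AE d in nuXY.sample n. (\<integral>\<^sup>+w. ennreal ((mh d (fst w) - snd w)\<^sup>2) \<partial>law_XY)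
        = (\<integral>\<^sup>+x. ennreal ((mh d x - m x)\<^sup>2) \<partial>law_X) + ennreal noise"
      using nuXY.AE_sample_cube AE_space
    proof eventually_elim
      case (elim d)
      have d: "restrict d {..<n} = d"
        using elim(2) by (auto simp: space_PiM PiE_def extensional_def restrict_def fun_eq_iff)
      obtain L where mh: "\<And>x. x \<in> unit_cube \<Longrightarrow> mh d x = node_mean n d (cell_of L x)"
        using odt_estimator_cell[OF est, of d] elim(1) unfolding d by blast
      \<comment> \<open>A bound that depends on the sample is enough, as the decomposition is
        applied to one \<open>d\<close> at a time.\<close>
      have le: "\<bar>snd (d i)\<bar> \<le> (\<Sum>i<n. \<bar>snd (d i)\<bar>)" if "i < n" for i
        using that by (intro member_le_sum) auto
      have bound: "\<bar>mh d x\<bar> \<le> (\<Sum>i<n. \<bar>snd (d i)\<bar>)" if "x \<in> unit_cube" for x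
        unfolding mh[OF that] by (intro abs_node_mean_le le sum_nonneg) auto
      have meas: "mh d \<in> borel_measurable borel"
        by (rule nuXY.estimator_measurable[OF est, where d = "\<lambda>_. d"]) (use elim(2) in auto)
      show ?case by (rule nn_risk_decomposition[OF meas bound])
    qed
  qed
  also have "\<dots> = excess_risk n mh + ennreal noise"
    using l2_error_measurable[OF est] by (subst nn_integral_add) (auto simp: S.emeasure_space_1)
  finally have "excess_risk n mh + ennreal noise \<le> ennreal ((\<integral>w. (g (fst w) - snd w)\<^sup>2 \<partial>law_XY) + ?A + ?D)"
    using nuXY.risk_bound[OF est n t K g, of "4 * v\<^sup>2 + 1"] by (simp add: add_nonneg_pos)
  also have "(\<integral>w. (g (fst w) - snd w)\<^sup>2 \<partial>law_XY) + ?A + ?D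
      = ((\<integral>\<omega>. (g (X \<omega>) - m (X \<omega>))\<^sup>2 \<partial>M) + noise) + (?A + ?D)"
    by (simp only: risk_decomposition(2)[OF g'] add.assoc)
  also have "ennreal \<dots> \<le> ennreal ((\<integral>\<omega>. (g (X \<omega>) - m (X \<omega>))\<^sup>2 \<partial>M) + noise) + ennreal (?A + ?D)"
    by (rule ennreal_add_le)
  also have "ennreal ((\<integral>\<omega>. (g (X \<omega>) - m (X \<omega>))\<^sup>2 \<partial>M) + noise)
      = ennreal (\<integral>\<omega>. (g (X \<omega>) - m (X \<omega>))\<^sup>2 \<partial>M) + ennreal noise"
    by (intro ennreal_plus noise_nonneg integral_nonneg_AE) simp
  also have "ennreal (\<integral>\<omega>. (g (X \<omega>) - m (X \<omega>))\<^sup>2 \<partial>M) = muX.l2_dist m g"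
    unfolding nn_l2_error[OF g', symmetric] muX.l2_dist_def by (simp only: power2_commute)
  finally have "ennreal noise + excess_risk n mh \<le> ennreal noise + (muX.l2_dist m g + ennreal (?A + ?D))"
    by (simp only: add_ac)
  then show ?thesis by (simp add: ennreal_add_left_cancel_le)
qed

text \<open>Each of three error terms receives \<open>r / 3\<close>. Approximation fixes
  \<open>g\<close>, its mass \<open>v\<close> fixes \<open>K\<close>, and only the complexity term
  and the condition \<open>2 ^ Suc K < t n\<close> call for large \<open>n\<close>.\<close>

theorem excess_risk_tendsto_0:
  assumes t: "\<And>n. n \<ge> 1 \<Longrightarrow> 1 \<le> t n \<and> t n \<le> n"
    and est: "\<And>n. n \<ge> 1 \<Longrightarrow> odt_estimator n (t n) (mh n)"
    and t_inf: "filterlim t at_top sequentially"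
    and t_o: "(\<lambda>n. real (t n)) \<in> o(\<lambda>n. real n / ln (real n) ^ 4)"
  shows "(\<lambda>n. excess_risk n (mh n)) \<longlonglongrightarrow> 0"
proof (rule order_tendstoI)
  fix a :: ennreal assume "0 < a"
  then obtain r where r: "0 < r" "ennreal r \<le> a"
    \<comment> \<open>For infinite \<open>a\<close> the witness is 1.\<close>
    by (cases a) (auto intro: that[of 1])
  have "(\<integral>\<^sup>+x. ennreal ((m x)\<^sup>2) \<partial>law_X) = (\<integral>\<^sup>+\<omega>. ennreal ((m (X \<omega>))\<^sup>2) \<partial>M)"
    by (rule nn_integral_distr[OF X]) simp
  also have "\<dots> = ennreal (\<integral>\<omega>. (m (X \<omega>))\<^sup>2 \<partial>M)"
    by (intro nn_integral_eq_integral m_int) auto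
  finally have "muX.approximable m"
    by (intro muX.square_integrable_approximable m) simp
  moreover have "r / 3 > 0" using r by simp
  ultimately obtain v g where g: "ridge_step v g" "muX.l2_dist m g < ennreal (r / 3)"
    by (rule muX.approximableD)
  obtain K where K: "3 * (4 * v\<^sup>2 + 1) / r < real K" using reals_Archimedean2 by blast
  have "0 < 3 * (4 * v\<^sup>2 + 1) / r" using r by (intro divide_pos_pos) (simp_all add: add_nonneg_pos)
  with K have "0 < real K" by linarith
  then have "K > 0" by simp
  have AK: "(4 * v\<^sup>2 + 1) / real K < r / 3"
    using K r \<open>0 < real K\<close> by (simp add: field_simps)
  let ?D = "\<lambda>n. 14 * ((ln (real (2 * n)) + nuXY.exp_moment) / c) * sqrt (ln (class_bound CARD('p) n (t n)) / real n)"
  have "\<forall>\<^sub>F n in sequentially. ?D n < r / 3"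
    using complexity_term_tendsto_0[OF t t_o] r by (intro order_tendstoD) auto
  moreover have "\<forall>\<^sub>F n in sequentially. 2 ^ Suc K < t n"
    using t_inf unfolding filterlim_at_top Suc_le_eq[symmetric] by blast
  ultimately show "\<forall>\<^sub>F n in sequentially. excess_risk n (mh n) < a"
    using eventually_ge_at_top[of 1]
  proof eventually_elim
    case (elim n)
    have "excess_risk n (mh n) \<le> muX.l2_dist m g + ennreal ((4 * v\<^sup>2 + 1) / real K + ?D n)"
      using elim by (intro excess_risk_le est \<open>K > 0\<close> g) auto
    also have "\<dots> < ennreal (r / 3) + ennreal (r / 3 + r / 3)"
      using g AK elim(1) r by (intro add_strict_mono ennreal_lessI) auto
    also have "\<dots> = ennreal (r / 3 + (r / 3 + r / 3))"
      using r by (intro ennreal_plus[symmetric]) auto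
    also have "\<dots> = ennreal r" by simp
    finally show ?case using r(2) by (rule order_less_le_trans)
  qed
qed simp

end

theorem theorem3p1:
  fixes M :: "'a measure"
    and X :: "'a \<Rightarrow> real ^ 'p::finite" and Y :: "'a \<Rightarrow> real"
    and Xs :: "nat \<Rightarrow> 'a \<Rightarrow> real ^ 'p" and Ys :: "nat \<Rightarrow> 'a \<Rightarrow> real"
    and m :: "real ^ 'p \<Rightarrow> real"
    and t :: "nat \<Rightarrow> nat"
    and mhat :: "nat \<Rightarrow> 'p sample \<Rightarrow> real ^ 'p \<Rightarrow> real"
    and c :: real
  assumes "prob_space M"
    and "X \<in> borel_measurable M" and "Y \<in> borel_measurable M"
    and "AE \<omega> in M. X \<omega> \<in> unit_cube"
    and "m \<in> borel_measurable borel"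
    and "AE \<omega> in M. real_cond_exp M (vimage_algebra (space M) X borel) Y \<omega> = m (X \<omega>)"
    and "prob_space.indep_vars M (\<lambda>_. borel) (\<lambda>i \<omega>. (Xs i \<omega>, Ys i \<omega>)) UNIV"
    and "\<And>i. distr M borel (\<lambda>\<omega>. (Xs i \<omega>, Ys i \<omega>)) = distr M borel (\<lambda>\<omega>. (X \<omega>, Y \<omega>))"
    and "c > 0" and "integrable M (\<lambda>\<omega>. exp (c * (Y \<omega>)\<^sup>2))"
    and "integrable M (\<lambda>\<omega>. (m (X \<omega>))\<^sup>2)"
    and "\<And>n. n \<ge> 1 \<Longrightarrow> 1 \<le> t n \<and> t n \<le> n"
    and "\<And>n. n \<ge> 1 \<Longrightarrow> odt_estimator n (t n) (mhat n)"
    and "filterlim t at_top sequentially"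
    and "(\<lambda>n. real (t n)) \<in> o(\<lambda>n. real n / ln (real n) ^ 4)"
  shows "(\<lambda>n. \<integral>\<^sup>+\<omega>. (\<integral>\<^sup>+x. ennreal ((mhat n (\<lambda>i\<in>{..<n}. (Xs i \<omega>, Ys i \<omega>)) x - m x)\<^sup>2)
                  \<partial>distr M borel X) \<partial>M) \<longlonglongrightarrow> 0"
proof -
  interpret regression M X Y m c
    using assms by (intro regression.intro regression_axioms.intro)
  let ?Z = "\<lambda>n \<omega>. \<lambda>i\<in>{..<n}. (Xs i \<omega>, Ys i \<omega>)"
  have rv: "(\<lambda>\<omega>. (Xs i \<omega>, Ys i \<omega>)) \<in> borel_measurable M" for i
    using assms(7) by (simp add: indep_vars_def)
  \<comment> \<open>The risk depends on the observations only through their joint law, which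
    independence and equal distributions identify with \<open>nuXY.sample n\<close>.\<close>
  have "excess_risk n (mhat n) = (\<integral>\<^sup>+\<omega>. (\<integral>\<^sup>+x. ennreal ((mhat n (?Z n \<omega>) x - m x)\<^sup>2) \<partial>law_X) \<partial>M)"
    if "n \<ge> 1" for n
  proof -
    let ?h = "\<lambda>d. \<integral>\<^sup>+x. ennreal ((mhat n d x - m x)\<^sup>2) \<partial>law_X"
    let ?B = "\<Pi>\<^sub>M i\<in>{..<n}. (borel :: ((real ^ 'p) \<times> real) measure)"
    have "indep_vars (\<lambda>_. borel) (\<lambda>i \<omega>. (Xs i \<omega>, Ys i \<omega>)) {..<n}"
      by (rule indep_vars_subset[OF assms(7)]) simp
    moreover have "{..<n} \<noteq> {}" using that by (auto simp: lessThan_empty_iff)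
    ultimately have distr: "distr M ?B (?Z n) = nuXY.sample n"
      using indep_vars_iff_distr_eq_PiM[where M' = "\<lambda>_. borel" and X = "\<lambda>i \<omega>. (Xs i \<omega>, Ys i \<omega>)" and I = "{..<n}"] rv
      by (simp add: assms(8))
    have "?h \<in> borel_measurable (nuXY.sample n)"
      using assms(13)[OF that] by (rule l2_error_measurable)
    then have h: "?h \<in> borel_measurable ?B"
      using measurable_cong_sets[OF nuXY.sets_sample refl] by blast
    have Z: "?Z n \<in> measurable M ?B"
      by (intro measurable_restrict rv)
    have "excess_risk n (mhat n) = (\<integral>\<^sup>+d. ?h d \<partial>distr M ?B (?Z n))" by (simp only: distr)
    also have "\<dots> = (\<integral>\<^sup>+\<omega>. ?h (?Z n \<omega>) \<partial>M)"
      by (rule nn_integral_distr[OF Z]) (use h in simp)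
    finally show ?thesis .
  qed
  then have "\<forall>\<^sub>F n in sequentially. excess_risk n (mhat n)
      = (\<integral>\<^sup>+\<omega>. (\<integral>\<^sup>+x. ennreal ((mhat n (?Z n \<omega>) x - m x)\<^sup>2) \<partial>law_X) \<partial>M)"
    by (auto simp: eventually_sequentially)
  from Lim_transform_eventually[OF excess_risk_tendsto_0[OF assms(12-15)] this] show ?thesis .
qed

end
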